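(* Let $n,t\geq 1$ be integers such that $n\leq (t+1)(t+3)$. Let $S=K[x_1,\ldots,x_n]$ and $\mathbf m=(x_1,\ldots,x_n)\subset S$. Then $$\operatorname{hdepth}(\mathbf m^t)=\left\lceil \frac{n}{t+1} \right\rceil .$$
   Context: $K$ is an infinite field and $S=K[x_1,\ldots,x_n]$ is the polynomial ring with the standard $\mathbb Z$-grading ($\deg x_i=1$). For a finitely generated graded $S$-module $M$, the Hilbert depth $\operatorname{hdepth}(M)$ is the maximal depth of a finitely generated graded $S$-module $N$ having the same Hilbert series as $M$. *)

theory Defs
  imports
    "Jordan_Normal_Form.VS_Connect"
    "HOL-Algebra.Ideal_Product"
    "HOL-Library.Poly_Mapping"
    "HOL-Library.Extended_Nat"
    "HOL-Computational_Algebra.Formal_Laurent_Series"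
begin

text \<open>Monomials are exponent vectors \<open>nat \<Rightarrow>\<^sub>0 nat\<close>, so this type is the polynomial ring in the
  variables \<open>x\<^sub>0, x\<^sub>1, \<dots>\<close>. The ring \<open>K[x\<^sub>1, \<dots>, x\<^sub>n]\<close> is its subring \<open>mpoly_ring n\<close> of polynomials
  involving only the variables with index below \<open>n\<close>.\<close>

type_synonym 'a mpoly = "(nat \<Rightarrow>\<^sub>0 nat) \<Rightarrow>\<^sub>0 'a"

definition mpoly_ring :: "nat \<Rightarrow> 'a::comm_ring_1 mpoly ring" where
  "mpoly_ring n = class_ring\<lparr>carrier := {p. \<forall>m\<in>Poly_Mapping.keys p. Poly_Mapping.keys m \<subseteq> {..<n}}\<rparr>"

lemma carrier_mpoly_ring [simp]:
    "carrier (mpoly_ring n) = {p. \<forall>m\<in>Poly_Mapping.keys p. Poly_Mapping.keys m \<subseteq> {..<n}}"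
  and mult_mpoly_ring [simp]: "monoid.mult (mpoly_ring n) = (*)"
  and one_mpoly_ring [simp]: "one (mpoly_ring n) = 1"
  and zero_mpoly_ring [simp]: "zero (mpoly_ring n) = 0"
  and add_mpoly_ring [simp]: "add (mpoly_ring n) = (+)"
  by (simp_all add: mpoly_ring_def)

lemma cring_mpoly_ring: "cring (mpoly_ring n :: 'a::comm_ring_1 mpoly ring)"
proof -
  define P where "P = {p :: 'a mpoly. \<forall>m\<in>Poly_Mapping.keys p. Poly_Mapping.keys m \<subseteq> {..<n}}"
  have carrier: "carrier (mpoly_ring n) = P" by (simp add: P_def)
  have times: "p * q \<in> P" if "p \<in> P" "q \<in> P" for p q
    unfolding P_def
  proof (rule CollectI, rule ballI)
    fix m assume "m \<in> Poly_Mapping.keys (p * q)"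
    then obtain a b where "m = a + b" "a \<in> Poly_Mapping.keys p" "b \<in> Poly_Mapping.keys q"
      using keys_mult[of p q] by blast
    then show "Poly_Mapping.keys m \<subseteq> {..<n}"
      using that Poly_Mapping.keys_add[of a b] unfolding P_def by blast
  qed
  have plus: "p + q \<in> P" if "p \<in> P" "q \<in> P" for p q
    using that Poly_Mapping.keys_add[of p q] unfolding P_def by blast
  have uminus: "- p \<in> P" if "p \<in> P" for p
    using that by (simp add: P_def)
  have zero_one: "0 \<in> P" "1 \<in> P" by (simp_all add: P_def)
  show ?thesis
  proof (rule cringI, goal_cases)
    case 1
    show ?case
    proof (rule abelian_groupI)
      fix p :: "'a mpoly" assume "p \<in> carrier (mpoly_ring n)"
      then show "\<exists>q\<in>carrier (mpoly_ring n). q \<oplus>\<^bsub>mpoly_ring n\<^esub> p = \<zero>\<^bsub>mpoly_ring n\<^esub>"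
        unfolding carrier using uminus by (intro bexI[of _ "- p"]) simp_all
    qed (simp_all del: carrier_mpoly_ring add: carrier plus zero_one add.assoc add.commute)
  next
    case 2
    show ?case
      by (rule comm_monoidI)
        (simp_all del: carrier_mpoly_ring add: carrier times zero_one mult.assoc mult.commute)
  qed (simp add: distrib_right)
qed

definition mconst :: "'a::comm_ring_1 \<Rightarrow> 'a mpoly" where
  "mconst c = Poly_Mapping.single 0 c"

definition mvar :: "nat \<Rightarrow> 'a::comm_ring_1 mpoly" where
  "mvar i = Poly_Mapping.single (Poly_Mapping.single i 1) 1"

definition mdeg :: "(nat \<Rightarrow>\<^sub>0 nat) \<Rightarrow> nat" where
  "mdeg m = (\<Sum>i\<in>Poly_Mapping.keys m. Poly_Mapping.lookup m i)"

definition mpoly_homog :: "nat \<Rightarrow> int \<Rightarrow> 'a::comm_ring_1 mpoly set" where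
  "mpoly_homog n d = {p \<in> carrier (mpoly_ring n). \<forall>m\<in>Poly_Mapping.keys p. int (mdeg m) = d}"

record ('a, 'b) gmodule = "('a, 'b) module" +
  component :: "int \<Rightarrow> 'b set"

locale graded_module = Module.module "mpoly_ring n" M
  for n :: nat and M :: "('a::field mpoly, 'b) gmodule" (structure) +
  assumes component_subgroup: "\<And>d. additive_subgroup (component M d) M"
    and component_smult:
      "\<And>d e p v. \<lbrakk>p \<in> mpoly_homog n d; v \<in> component M e\<rbrakk> \<Longrightarrow> p \<odot> v \<in> component M (d + e)"
    and direct_sum: "\<And>v. v \<in> carrier M \<Longrightarrow>
      \<exists>!c. (\<forall>d. c d \<in> component M d) \<and> finite {d. c d \<noteq> \<zero>} \<and> v = (\<Oplus>d\<in>{d. c d \<noteq> \<zero>}. c d)"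

locale fg_graded_module = graded_module n M
  for n :: nat and M :: "('a::field mpoly, 'b) gmodule" (structure) +
  assumes finitely_generated: "\<exists>A. finite A \<and> A \<subseteq> carrier M \<and> span A = carrier M"

lemma ex_inj_coefficients:
  assumes "finite A"
  shows "\<exists>h :: ('b \<Rightarrow> 'a::comm_ring_1 mpoly) \<Rightarrow> 'a mpoly. \<forall>a b. h a = h b \<longrightarrow> (\<forall>x\<in>A. a x = b x)"
  using assms
proof (induction A)
  case (insert y A)
  then obtain h :: "('b \<Rightarrow> 'a mpoly) \<Rightarrow> 'a mpoly"
    where h: "\<And>a b. h a = h b \<Longrightarrow> \<forall>x\<in>A. a x = b x" by blast
  have "inj (\<lambda>i. mvar i :: 'a mpoly)"
    by (auto simp: inj_on_def mvar_def dest!: arg_cong[of _ _ Poly_Mapping.keys])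
  then have "infinite (UNIV :: 'a mpoly set)"
    using infinite_UNIV_nat finite_imageD finite_subset subset_UNIV by metis
  then have "(card_of ((UNIV :: 'a mpoly set) \<times> (UNIV :: 'a mpoly set)), card_of (UNIV :: 'a mpoly set)) \<in> ordLeq"
    using card_of_Times_same_infinite ordIso_imp_ordLeq by blast
  then obtain g :: "'a mpoly \<times> 'a mpoly \<Rightarrow> 'a mpoly" where "inj g"
    by (metis UNIV_Times_UNIV card_of_ordLeq)
  then show ?case
    by (intro exI[of _ "\<lambda>a. g (a y, h a)"]) (auto simp: inj_eq dest: h)
qed simp

lemma (in graded_module) component_closed: "v \<in> component M d \<Longrightarrow> v \<in> carrier M"
  using component_subgroup additive_subgroup.a_Hcarr by fast

lemma ex_graded_module_on_mpoly:
  fixes M :: "('a::field mpoly, 'b) gmodule"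
  assumes "fg_graded_module n M"
  shows "\<exists>(N :: ('a mpoly, 'a mpoly) gmodule) f. fg_graded_module n N \<and>
    bij_betw f (carrier M) (carrier N) \<and>
    (\<forall>u\<in>carrier M. \<forall>v\<in>carrier M. f (u \<oplus>\<^bsub>M\<^esub> v) = f u \<oplus>\<^bsub>N\<^esub> f v) \<and>
    (\<forall>p\<in>carrier (mpoly_ring n). \<forall>v\<in>carrier M. f (p \<odot>\<^bsub>M\<^esub> v) = p \<odot>\<^bsub>N\<^esub> f v) \<and>
    (\<forall>d. f ` component M d = component N d)"
proof -
  interpret M: fg_graded_module n M by fact
  obtain A where A: "finite A" "A \<subseteq> carrier M" "M.span A = carrier M"
    using M.finitely_generated by blast
  obtain h :: "('b \<Rightarrow> 'a mpoly) \<Rightarrow> 'a mpoly"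
    where h: "\<And>a b. h a = h b \<Longrightarrow> \<forall>x\<in>A. a x = b x"
    using ex_inj_coefficients[OF A(1)] by blast
  have "\<forall>v\<in>carrier M. \<exists>a. a \<in> A \<rightarrow> carrier (mpoly_ring n) \<and> v = M.lincomb a A"
    using A M.finite_span[of A] by blast
  then obtain a where a: "\<And>v. v \<in> carrier M \<Longrightarrow> a v \<in> A \<rightarrow> carrier (mpoly_ring n)"
      "\<And>v. v \<in> carrier M \<Longrightarrow> v = M.lincomb (a v) A"
    by metis
  define f where "f v = h (a v)" for v
  have inj: "inj_on f (carrier M)"
  proof (rule inj_onI)
    fix u v assume uv: "u \<in> carrier M" "v \<in> carrier M" "f u = f v"
    then have "\<forall>x\<in>A. a u x = a v x"
      using h by (auto simp: f_def)
    then have "M.lincomb (a u) A = M.lincomb (a v) A"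
      using A a(1) uv by (intro M.lincomb_cong) auto
    then show "u = v" using a uv by metis
  qed
  define g where "g = inv_into (carrier M) f"
  have gf [simp]: "g (f v) = v" if "v \<in> carrier M" for v
    using inj that by (simp add: g_def)
  define N :: "('a mpoly, 'a mpoly) gmodule" where
    "N = \<lparr>carrier = f ` carrier M, monoid.mult = (\<lambda>_ _. f \<zero>\<^bsub>M\<^esub>), one = f \<zero>\<^bsub>M\<^esub>, zero = f \<zero>\<^bsub>M\<^esub>,
      add = (\<lambda>u v. f (g u \<oplus>\<^bsub>M\<^esub> g v)), module.smult = (\<lambda>p u. f (p \<odot>\<^bsub>M\<^esub> g u)),
      component = (\<lambda>d. f ` component M d)\<rparr>"
  have [simp]: "carrier N = f ` carrier M" "\<zero>\<^bsub>N\<^esub> = f \<zero>\<^bsub>M\<^esub>" "component N d = f ` component M d"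
      "u \<oplus>\<^bsub>N\<^esub> v = f (g u \<oplus>\<^bsub>M\<^esub> g v)" "p \<odot>\<^bsub>N\<^esub> u = f (p \<odot>\<^bsub>M\<^esub> g u)" for u v p d
    by (simp_all add: N_def)
  have f_eq [simp]: "f u = f v \<longleftrightarrow> u = v" if "u \<in> carrier M" "v \<in> carrier M" for u v
    using inj that by (simp add: inj_on_eq_iff)
  have "abelian_group N"
  proof (rule abelian_groupI)
    fix x assume "x \<in> carrier N"
    then obtain v where v: "v \<in> carrier M" "x = f v" by auto
    then show "\<exists>y\<in>carrier N. y \<oplus>\<^bsub>N\<^esub> x = \<zero>\<^bsub>N\<^esub>"
      by (intro bexI[of _ "f (\<ominus>\<^bsub>M\<^esub> v)"]) (auto simp: M.M.l_neg)
  qed (auto simp: M.M.a_ac)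
  then interpret N: Module.module "mpoly_ring n" N
    by (intro moduleI cring_mpoly_ring)
      (auto simp del: carrier_mpoly_ring mult_mpoly_ring add_mpoly_ring one_mpoly_ring
        simp: M.smult_l_distr M.smult_r_distr M.smult_assoc1)
  have finsum: "(\<Oplus>\<^bsub>N\<^esub>x\<in>X. f (w x)) = f (\<Oplus>\<^bsub>M\<^esub>x\<in>X. w x)" if "w \<in> X \<rightarrow> carrier M" for w and X :: "'c set"
    using that by (induction X rule: infinite_finite_induct) (auto simp: Pi_iff image_iff)
  have comp: "v \<in> carrier M" if "v \<in> component M d" for v d
    using that by (rule M.component_closed)
  have "graded_module n N"
  proof (rule graded_module.intro[OF N.module_axioms], rule graded_module_axioms.intro)
    fix d
    interpret C: additive_subgroup "component M d" M by (rule M.component_subgroup)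
    show "additive_subgroup (component N d) N"
    proof (rule additive_subgroup.intro, rule N.M.add.subgroupI)
      fix x assume "x \<in> component N d"
      then obtain v where v: "v \<in> component M d" "x = f v" by auto
      have "f (\<ominus>\<^bsub>M\<^esub> v) \<oplus>\<^bsub>N\<^esub> x = \<zero>\<^bsub>N\<^esub>"
        using v comp[OF v(1)] by (simp add: M.M.l_neg)
      then have "\<ominus>\<^bsub>N\<^esub> x = f (\<ominus>\<^bsub>M\<^esub> v)"
        using v comp[OF v(1)] by (intro N.M.minus_equality) auto
      then show "\<ominus>\<^bsub>N\<^esub> x \<in> component N d"
        using v(1) C.a_inv_closed by simp
    next
      show "component N d \<subseteq> carrier N" using comp by auto
    next
      have "component M d \<noteq> {}" by (metis C.zero_closed empty_iff)
      then show "component N d \<noteq> {}" by simp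
    next
      fix x y assume "x \<in> component N d" "y \<in> component N d"
      then show "x \<oplus>\<^bsub>N\<^esub> y \<in> component N d"
        using comp C.a_closed by auto
    qed
  next
    fix d e and p :: "'a mpoly" and x
    assume "p \<in> mpoly_homog n d" "x \<in> component N e"
    moreover then obtain v where "v \<in> component M e" "x = f v" by auto
    ultimately show "p \<odot>\<^bsub>N\<^esub> x \<in> component N (d + e)"
      using comp M.component_smult by simp
  next
    fix x assume "x \<in> carrier N"
    then obtain v where v: "v \<in> carrier M" "x = f v" by auto
    let ?P = "\<lambda>c. (\<forall>d. c d \<in> component M d) \<and> finite {d. c d \<noteq> \<zero>\<^bsub>M\<^esub>} \<and>
        v = (\<Oplus>\<^bsub>M\<^esub>d\<in>{d. c d \<noteq> \<zero>\<^bsub>M\<^esub>}. c d)"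
    let ?Q = "\<lambda>c. (\<forall>d. c d \<in> component N d) \<and> finite {d. c d \<noteq> \<zero>\<^bsub>N\<^esub>} \<and>
        x = (\<Oplus>\<^bsub>N\<^esub>d\<in>{d. c d \<noteq> \<zero>\<^bsub>N\<^esub>}. c d)"
    have Q: "?Q (\<lambda>d. f (c d)) \<longleftrightarrow> ?P c" if c: "\<And>d. c d \<in> component M d" for c
    proof -
      have cM: "c d \<in> carrier M" for d using comp c by blast
      then have "(\<Oplus>\<^bsub>N\<^esub>d\<in>{d. c d \<noteq> \<zero>\<^bsub>M\<^esub>}. f (c d)) = f (\<Oplus>\<^bsub>M\<^esub>d\<in>{d. c d \<noteq> \<zero>\<^bsub>M\<^esub>}. c d)"
        by (intro finsum) auto
      then show ?thesis using c cM v by (simp add: M.M.finsum_closed Pi_iff)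
    qed
    obtain c where c: "?P c" and uniq: "\<And>c'. ?P c' \<Longrightarrow> c' = c"
      using M.direct_sum[OF v(1)] by auto
    have ex: "?Q (\<lambda>d. f (c d))" using Q c by blast
    have unique: "b = (\<lambda>d. f (c d))" if b: "?Q b" for b
    proof -
      have bM: "g (b d) \<in> component M d \<and> f (g (b d)) = b d" for d
      proof -
        have "b d \<in> f ` component M d" using b by simp
        then show ?thesis using comp by auto
      qed
      then have "(\<lambda>d. f (g (b d))) = b" by simp
      then have "?P (\<lambda>d. g (b d))"
        using Q[of "\<lambda>d. g (b d)"] b bM by simp
      then have "(\<lambda>d. g (b d)) = c" using uniq[of "\<lambda>d. g (b d)"] by blast
      then have "g (b d) = c d" for d by (simp add: fun_eq_iff)
      then show ?thesis using bM by (simp add: fun_eq_iff)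
    qed
    show "\<exists>!c. ?Q c"
      by (rule ex1I[of ?Q "\<lambda>d. f (c d)", OF ex unique])
  qed
  then interpret N: graded_module n N .
  interpret N: fg_graded_module n N
  proof
    have "carrier N \<subseteq> N.span (f ` A)"
    proof
      fix x assume "x \<in> carrier N"
      then obtain v where v: "v \<in> carrier M" "x = f v" by auto
      have "N.lincomb (a v \<circ> g) (f ` A) = (\<Oplus>\<^bsub>N\<^esub>y\<in>A. a v (g (f y)) \<odot>\<^bsub>N\<^esub> f y)"
        unfolding N.lincomb_def
        by (subst N.M.finsum_reindex) (use A a(1) v inj in \<open>auto intro: inj_on_subset simp: Pi_iff subset_iff\<close>)
      also have "\<dots> = (\<Oplus>\<^bsub>N\<^esub>y\<in>A. f (a v y \<odot>\<^bsub>M\<^esub> y))"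
        by (rule N.M.finsum_cong') (use A a(1) v in \<open>auto simp: Pi_iff subset_iff\<close>)
      also have "\<dots> = f (M.lincomb (a v) A)"
        unfolding M.lincomb_def by (rule finsum) (use A a(1) v in \<open>auto simp: Pi_iff subset_iff\<close>)
      also have "\<dots> = x" by (simp only: a(2)[OF v(1), symmetric] v(2))
      finally have "x = N.lincomb (a v \<circ> g) (f ` A)" ..
      moreover have "a v \<circ> g \<in> f ` A \<rightarrow> carrier (mpoly_ring n)"
        using A a(1) v by (auto simp: Pi_iff subset_iff)
      ultimately show "x \<in> N.span (f ` A)"
        using A unfolding N.span_def by blast
    qed
    moreover have "N.span (f ` A) \<subseteq> carrier N"
      using A by (intro N.span_is_subset2) auto
    ultimately show "\<exists>B. finite B \<and> B \<subseteq> carrier N \<and> N.span B = carrier N"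
      using A by (intro exI[of _ "f ` A"]) auto
  qed
  have "fg_graded_module n N" by (rule N.fg_graded_module_axioms)
  with inj show ?thesis
    by (intro exI[of _ N] exI[of _ f]) (simp add: bij_betw_def)
qed

lemma (in graded_module) smult_monomial:
  assumes "Poly_Mapping.single m k \<in> carrier (mpoly_ring n)" "v \<in> component M e"
  shows "Poly_Mapping.single m k \<odot> v \<in> component M (int (mdeg m) + e)"
proof -
  have "Poly_Mapping.single m k \<in> mpoly_homog n (int (mdeg m))"
    using assms(1) unfolding mpoly_homog_def by auto
  then show ?thesis using component_smult assms(2) by blast
qed

lemma (in fg_graded_module) components_bounded_below:
  "\<exists>b. \<forall>d<b. component M d = {\<zero>}"
proof -
  obtain A where A: "finite A" "A \<subseteq> carrier M" "span A = carrier M"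
    using finitely_generated by blast
  define D where "D v c \<longleftrightarrow> (\<forall>d. c d \<in> component M d) \<and> finite {d. c d \<noteq> \<zero>} \<and>
      v = (\<Oplus>d\<in>{d. c d \<noteq> \<zero>}. c d)" for v and c :: "int \<Rightarrow> 'b"
  have D_ex: "\<exists>c. D v c" if "v \<in> carrier M" for v
    using direct_sum[OF that] unfolding D_def by blast
  have D_uniq: "c = c'" if "v \<in> carrier M" "D v c" "D v c'" for v c c'
    using direct_sum[OF that(1)] that(2,3) unfolding D_def by blast
  have comp_zero: "\<zero> \<in> component M d" for d
    using component_subgroup additive_subgroup.zero_closed by fast
  have comp_add: "u \<oplus> v \<in> component M d" if "u \<in> component M d" "v \<in> component M d" for u v d
    using component_subgroup additive_subgroup.a_closed that by fast
  have comp: "c d \<in> carrier M" if "D v c" for v c d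
    using that component_closed unfolding D_def by blast
  obtain c where c: "\<And>a. a \<in> A \<Longrightarrow> D a (c a)"
    using D_ex A(2) by (metis subsetD)
  define S where "S = (\<Union>a\<in>A. {d. c a d \<noteq> \<zero>})"
  have "finite S" using A(1) c unfolding S_def D_def by auto
  then obtain b where b: "\<And>d. d \<in> S \<Longrightarrow> b \<le> d"
    by (metis Min_le)
  define W where "W = {v \<in> carrier M. \<exists>c. D v c \<and> (\<forall>d<b. c d = \<zero>)}"
  have W_base: "v \<in> W" if v: "v \<in> component M d" and "b \<le> d" for v d
  proof -
    let ?c = "\<lambda>e. if e = d then v else \<zero>"
    have vM: "v \<in> carrier M" using v by (rule component_closed)
    have "{e. ?c e \<noteq> \<zero>} = (if v = \<zero> then {} else {d})" by auto
    then have "D v ?c" using v vM comp_zero unfolding D_def by auto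
    then show ?thesis using vM \<open>b \<le> d\<close> unfolding W_def by (auto intro!: exI[of _ ?c])
  qed
  have W_add: "u \<oplus> v \<in> W" if u: "u \<in> W" and v: "v \<in> W" for u v
  proof -
    obtain c1 c2 where c1: "D u c1" "\<forall>d<b. c1 d = \<zero>" and c2: "D v c2" "\<forall>d<b. c2 d = \<zero>"
      using u v unfolding W_def by blast
    let ?c = "\<lambda>d. c1 d \<oplus> c2 d"
    let ?F = "{d. c1 d \<noteq> \<zero>} \<union> {d. c2 d \<noteq> \<zero>}"
    have fin: "finite ?F" using c1 c2 unfolding D_def by blast
    have sub: "{d. ?c d \<noteq> \<zero>} \<subseteq> ?F" by auto
    have cl: "c1 d \<in> carrier M" "c2 d \<in> carrier M" for d using c1 c2 comp by auto
    have "u = (\<Oplus>d\<in>{d. c1 d \<noteq> \<zero>}. c1 d)" using c1 unfolding D_def by blast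
    also have "\<dots> = (\<Oplus>d\<in>?F. c1 d)"
      by (rule M.add.finprod_mono_neutral_cong_left) (use fin cl in auto)
    finally have u: "u = (\<Oplus>d\<in>?F. c1 d)" .
    have "v = (\<Oplus>d\<in>{d. c2 d \<noteq> \<zero>}. c2 d)" using c2 unfolding D_def by blast
    also have "\<dots> = (\<Oplus>d\<in>?F. c2 d)"
      by (rule M.add.finprod_mono_neutral_cong_left) (use fin cl in auto)
    finally have v: "v = (\<Oplus>d\<in>?F. c2 d)" .
    have "(\<Oplus>d\<in>{d. ?c d \<noteq> \<zero>}. ?c d) = (\<Oplus>d\<in>?F. ?c d)"
      by (rule M.add.finprod_mono_neutral_cong_left) (use fin cl in auto)
    also have "\<dots> = u \<oplus> v"
      unfolding u v by (rule M.finsum_addf) (use cl in auto)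
    finally have "u \<oplus> v = (\<Oplus>d\<in>{d. ?c d \<noteq> \<zero>}. ?c d)" ..
    moreover have "finite {d. ?c d \<noteq> \<zero>}" using fin sub by (rule finite_subset[rotated])
    moreover have "?c d \<in> component M d" for d
      using c1 c2 comp_add unfolding D_def by blast
    ultimately have "D (u \<oplus> v) ?c" unfolding D_def by blast
    moreover have "u \<oplus> v \<in> carrier M" using that unfolding W_def by blast
    moreover have "\<forall>d<b. ?c d = \<zero>" using c1 c2 by simp
    ultimately show ?thesis unfolding W_def by blast
  qed
  have W_carrier: "v \<in> carrier M" if "v \<in> W" for v using that unfolding W_def by blast
  have W_zero: "\<zero> \<in> W" using W_base[OF comp_zero order_refl] .
  have W_sum: "(\<Oplus>x\<in>X. w x) \<in> W" if "\<And>x. x \<in> X \<Longrightarrow> w x \<in> W" for w and X :: "'z set"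
    using that
  proof (induction X rule: infinite_finite_induct)
    case (insert x X)
    then have "(\<Oplus>x\<in>insert x X. w x) = w x \<oplus> (\<Oplus>x\<in>X. w x)"
      by (intro M.finsum_insert) (auto intro: W_carrier)
    then show ?case using insert W_add by simp
  qed (use W_zero in auto)
  have W_mono: "Poly_Mapping.single m k \<odot> v \<in> W"
    if p: "Poly_Mapping.single m k \<in> carrier (mpoly_ring n)" and v: "v \<in> W" for m k v
  proof -
    obtain c where c: "D v c" "\<forall>d<b. c d = \<zero>" using v unfolding W_def by blast
    have "v = (\<Oplus>d\<in>{d. c d \<noteq> \<zero>}. c d)" "finite {d. c d \<noteq> \<zero>}"
      using c unfolding D_def by blast+
    then have "Poly_Mapping.single m k \<odot> v
        = (\<Oplus>d\<in>{d. c d \<noteq> \<zero>}. Poly_Mapping.single m k \<odot> c d)"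
      using finsum_smult_ldistr[of "{d. c d \<noteq> \<zero>}" "Poly_Mapping.single m k" c] p comp[OF c(1)]
      by simp
    moreover have "Poly_Mapping.single m k \<odot> c d \<in> W" if "c d \<noteq> \<zero>" for d
    proof (rule W_base)
      show "Poly_Mapping.single m k \<odot> c d \<in> component M (int (mdeg m) + d)"
        using c p unfolding D_def by (intro smult_monomial) auto
      show "b \<le> int (mdeg m) + d" using c(2) that by force
    qed
    then have "(\<Oplus>d\<in>{d. c d \<noteq> \<zero>}. Poly_Mapping.single m k \<odot> c d) \<in> W"
      by (intro W_sum) blast
    ultimately show ?thesis by (simp only:)
  qed
  have W_smult: "p \<odot> v \<in> W" if "p \<in> carrier (mpoly_ring n)" "v \<in> W" for p v
    using that(1)
  proof (induction p rule: Poly_Mapping.update_induct)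
    case const
    then show ?case using W_zero W_carrier[OF that(2)] smult_l_null by simp
  next
    case (update p m k)
    have eq: "Poly_Mapping.update m k p = Poly_Mapping.single m k \<oplus>\<^bsub>mpoly_ring n\<^esub> p"
      using update.hyps
      by (auto intro!: poly_mapping_eqI simp: lookup_add lookup_single lookup_update when_def in_keys_iff)
    have "Poly_Mapping.keys (Poly_Mapping.update m k p) = insert m (Poly_Mapping.keys p)"
      using update.hyps by (auto simp: keys_update)
    then have cl: "p \<in> carrier (mpoly_ring n)"
        "Poly_Mapping.single m k \<in> carrier (mpoly_ring n)"
      using update.prems by auto
    have "Poly_Mapping.update m k p \<odot> v = Poly_Mapping.single m k \<odot> v \<oplus> p \<odot> v"
      unfolding eq by (rule smult_l_distr[OF cl(2,1) W_carrier[OF that(2)]])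
    then show ?case using W_add W_mono cl that(2) update.IH by simp
  qed
  have "A \<subseteq> W"
  proof
    fix a assume a: "a \<in> A"
    then have "\<forall>d<b. c a d = \<zero>" using b unfolding S_def by force
    then show "a \<in> W" using a A(2) c unfolding W_def by blast
  qed
  have carrier: "carrier M \<subseteq> W"
  proof
    fix v assume "v \<in> carrier M"
    then obtain a where a: "a \<in> A \<rightarrow> carrier (mpoly_ring n)" "v = lincomb a A"
      using A finite_span[OF A(1,2)] by blast
    show "v \<in> W"
      unfolding a(2) lincomb_def
      by (rule W_sum, rule W_smult) (use a(1) \<open>A \<subseteq> W\<close> in \<open>auto simp del: carrier_mpoly_ring\<close>)
  qed
  show ?thesis
  proof (intro exI allI impI equalityI subsetI)
    fix d v assume d: "d < b" and v: "v \<in> component M d"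
    have vM: "v \<in> carrier M" using v by (rule component_closed)
    then obtain c where c: "D v c" "\<forall>d<b. c d = \<zero>" using carrier unfolding W_def by blast
    let ?c = "\<lambda>e. if e = d then v else \<zero>"
    have "{e. ?c e \<noteq> \<zero>} = (if v = \<zero> then {} else {d})" by auto
    then have "D v ?c" using v vM comp_zero unfolding D_def by auto
    then have "?c = c" using D_uniq vM c by blast
    then have "v = c d" by (metis (mono_tags))
    then show "v \<in> {\<zero>}" using c d by simp
  next
    fix d v assume "d < b" "v \<in> {\<zero>}"
    then show "v \<in> component M d" using comp_zero by simp
  qed
qed

definition component_space :: "('a::field mpoly, 'b) gmodule \<Rightarrow> int \<Rightarrow> ('a, 'b) module" where
  "component_space M d = \<lparr>carrier = component M d, monoid.mult = monoid.mult M, one = one M,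
     zero = zero M, add = add M, module.smult = (\<lambda>c v. mconst c \<odot>\<^bsub>M\<^esub> v)\<rparr>"

lemma (in graded_module) component_space_vectorspace:
  "vectorspace class_ring (component_space M d)"
proof -
  have mc: "mconst k \<in> carrier (mpoly_ring n)" for k :: 'a
    by (auto simp: mconst_def)
  have mul: "mconst k \<odot> v \<in> component M d" if "v \<in> component M d" for k v
    using smult_monomial[of 0 k v d] mc[of k] that by (simp add: mconst_def mdeg_def)
  have add: "mconst (k + l) = mconst k \<oplus>\<^bsub>mpoly_ring n\<^esub> mconst l"
    and times: "mconst (k * l) = mconst k \<otimes>\<^bsub>mpoly_ring n\<^esub> mconst l"
    and one: "mconst 1 = \<one>\<^bsub>mpoly_ring n\<^esub>" for k l :: 'a
    by (simp_all add: mconst_def single_add mult_single)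
  interpret C: additive_subgroup "component M d" M by (rule component_subgroup)
  note cl = component_closed[of _ d]
  have "abelian_group (component_space M d)"
  proof (rule abelian_groupI)
    fix v assume "v \<in> carrier (component_space M d)"
    then have "v \<in> component M d" by (simp add: component_space_def)
    then show "\<exists>u\<in>carrier (component_space M d). u \<oplus>\<^bsub>component_space M d\<^esub> v = \<zero>\<^bsub>component_space M d\<^esub>"
      by (intro bexI[of _ "\<ominus> v"]) (simp_all add: component_space_def M.l_neg cl)
  qed (simp_all add: component_space_def cl M.a_ac)
  moreover have "cring (class_ring :: 'a ring)" by (rule class_cring.cring_axioms)
  ultimately have "Module.module class_ring (component_space M d)"
    using mc
    by (intro moduleI)
      (simp_all add: component_space_def mul add times one cl smult_l_distr smult_r_distr
        smult_assoc1 del: carrier_mpoly_ring mult_mpoly_ring add_mpoly_ring one_mpoly_ring)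
  then show ?thesis
    by (intro vectorspace.intro class_field)
qed

text \<open>The argument of \<open>Abs_fls\<close> has to vanish in all sufficiently negative degrees. For finitely
  generated \<open>M\<close> it does; see \<open>fls_nth_hilbert_series\<close>.\<close>

definition hilbert_series :: "('a::field mpoly, 'b) gmodule \<Rightarrow> int fls" where
  "hilbert_series M = Abs_fls (\<lambda>d. int (vectorspace.dim class_ring (component_space M d)))"

lemma (in fg_graded_module) fls_nth_hilbert_series:
  "fls_nth (hilbert_series M) d = int (vectorspace.dim class_ring (component_space M d))"
proof -
  obtain b where b: "\<And>d. d < b \<Longrightarrow> component M d = {\<zero>}"
    using components_bounded_below by blast
  have dim0: "vectorspace.dim class_ring (component_space M d) = 0" if "d < b" for d
  proof -
    interpret V: vectorspace "class_ring :: 'a ring" "component_space M d"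
      by (rule component_space_vectorspace)
    have "carrier (component_space M d) = {\<zero>\<^bsub>component_space M d\<^esub>}"
      using b[OF that] by (simp add: component_space_def)
    then have "V.span {} = carrier (component_space M d)"
      using V.span_empty by simp
    then have "V.dim \<le> card ({} :: 'b set)"
      unfolding V.dim_def by (intro Least_le exI[of _ "{}"]) auto
    then show ?thesis by simp
  qed
  have "eventually (\<lambda>k. int (vectorspace.dim class_ring (component_space M (- int k))) = 0) cofinite"
    unfolding cofinite_eq_sequentially eventually_sequentially
    by (rule exI[of _ "nat (1 - b)"]) (auto intro!: dim0)
  then show ?thesis
    unfolding hilbert_series_def by (subst Abs_fls_inverse) auto
qed

definition max_ideal :: "nat \<Rightarrow> 'a::field mpoly set" where
  "max_ideal n = Idl\<^bsub>mpoly_ring n\<^esub> (mvar ` {..<n})"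

definition list_smult :: "('a::field mpoly, 'b) gmodule \<Rightarrow> 'a mpoly list \<Rightarrow> 'b set" where
  "list_smult M fs = {\<Oplus>\<^bsub>M\<^esub>j\<in>{..<length fs}. (fs ! j) \<odot>\<^bsub>M\<^esub> w j | w. w \<in> {..<length fs} \<rightarrow> carrier M}"

text \<open>Since \<open>list_smult M fs\<close> is \<open>(f\<^sub>1, \<dots>, f\<^sub>r) M\<close>, the middle condition says that \<open>f\<^sub>i\<close> is a nonzerodivisor on
  \<open>M / (f\<^sub>1, \<dots>, f\<^bsub>i-1\<^esub>) M\<close>.\<close>

definition regular_sequence :: "nat \<Rightarrow> ('a::field mpoly, 'b) gmodule \<Rightarrow> 'a mpoly list \<Rightarrow> bool" where
  "regular_sequence n M fs \<longleftrightarrow> set fs \<subseteq> carrier (mpoly_ring n) \<and>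
     (\<forall>i<length fs. \<forall>v\<in>carrier M.
        (fs ! i) \<odot>\<^bsub>M\<^esub> v \<in> list_smult M (take i fs) \<longrightarrow> v \<in> list_smult M (take i fs)) \<and>
     list_smult M fs \<noteq> carrier M"

text \<open>The depth is the maximal length of an \<open>M\<close>-regular sequence in the graded maximal ideal, with
  the usual convention that the zero module has infinite depth.\<close>

definition depth :: "nat \<Rightarrow> ('a::field mpoly, 'b) gmodule \<Rightarrow> enat" where
  "depth n M = (if carrier M = {\<zero>\<^bsub>M\<^esub>} then \<infinity>
     else Sup {enat (length fs) | fs. set fs \<subseteq> max_ideal n \<and> regular_sequence n M fs})"

text \<open>The modules \<open>N\<close> below have their elements in the type \<open>'a mpoly\<close>. This is no restriction: by
  \<open>ex_graded_module_on_mpoly\<close>, every finitely generated graded module has an isomorphic copy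
  there. A finite supremum of a nonempty set of extended naturals is attained, so this is a
  maximum.\<close>

definition hdepth :: "nat \<Rightarrow> ('a::field mpoly, 'b) gmodule \<Rightarrow> enat" where
  "hdepth n M = Sup {depth n N | N :: ('a mpoly, 'a mpoly) gmodule.
     fg_graded_module n N \<and> hilbert_series N = hilbert_series M}"

definition graded_ideal :: "nat \<Rightarrow> 'a::field mpoly set \<Rightarrow> ('a mpoly, 'a mpoly) gmodule" where
  "graded_ideal n I = \<lparr>carrier = I, monoid.mult = (*), one = 1, zero = 0, add = (+), module.smult = (*),
     component = (\<lambda>d. I \<inter> mpoly_homog n d)\<rparr>"

end

theory Submission
  imports Defs
begin

text \<open>The variables are called \<open>x\<^sub>1, \<dots>, x\<^sub>n\<close> here, and \<open>mvar 0, \<dots>, mvar (n - 1)\<close> in the formal text.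
  Put \<open>r = \<lceil>n/(t+1)\<rceil>\<close>, and let \<open>H\<close> be the Hilbert series of \<open>m\<^sup>t\<close>, whose coefficient at \<open>z\<^sup>d\<close> is
  \<open>(n + d - 1) choose d\<close> for \<open>d \<ge> t\<close> and \<open>0\<close> for \<open>d < t\<close>.

  \<^bold>\<open>Upper bound.\<close> Let \<open>N\<close> have Hilbert series \<open>H\<close>, and let \<open>f\<^sub>1, \<dots>, f\<^sub>s\<close> in \<open>m\<close> be regular on \<open>N\<close>. The \<open>f\<^sub>i\<close>
  need not be homogeneous, but since \<open>K\<close> is infinite they can be traded one by one for linear forms
  \<open>l\<^sub>1, \<dots>, l\<^sub>s\<close>, each of them a nonzerodivisor modulo its predecessors (\<open>linear_weakly_regular_sequence\<close>).
  As \<open>N\<close> begins in degree \<open>t\<close>, the map \<open>(w\<^sub>i) \<mapsto> \<Sum> l\<^sub>i w\<^sub>i\<close> embeds the \<open>s\<close>-th power of \<open>N\<^sub>t\<close> into \<open>N\<close> in degree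
  \<open>t + 1\<close> (\<open>regular_sequence_length_bound\<close>). Comparing dimensions gives \<open>s \<le> (n+t)/(t+1)\<close>, so \<open>s \<le> r\<close>.

  For the trade, a generic linear form \<open>l\<close> is needed that is a nonzerodivisor modulo each of the
  submodules \<open>(f\<^sub>1, \<dots>, f\<^sub>i) N\<close> with \<open>i < s\<close>. Write such a submodule \<open>U\<close> as an irredundant intersection of finitely
  many irreducible submodules \<open>Q\<close>, which exist because \<open>N\<close> is Noetherian. Modulo an irreducible submodule every ring element is a
  nonzerodivisor or nilpotent, so that the zero divisors form a subspace; and this subspace does not contain all
  the variables, because otherwise some element outside \<open>U\<close> would be multiplied into \<open>U\<close> by all of \<open>m\<close>,
  although \<open>f\<^bsub>i+1\<^esub> \<in> m\<close> is a nonzerodivisor modulo \<open>U\<close> (\<open>zero_divisors_covered\<close>). Finitely many proper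
  subspaces do not cover the linear forms over an infinite field. Such an \<open>l\<close> can then be moved to the front
  of the sequence at the cost of the last entry \<open>f\<^sub>s\<close> (\<open>weakly_regular_exchange\<close>).

  \<^bold>\<open>Lower bound.\<close> Let \<open>c\<^sub>j\<close> be the coefficients of \<open>(1 - z)\<^sup>r H\<close>. They are nonnegative
  (\<open>hilbert_numerator_nonneg\<close>), and from degree \<open>t + r\<close> on they agree with those of \<open>1/(1 - z)\<^bsup>n-r\<^esup>\<close>,
  which count the monomials in \<open>n - r\<close> variables. Hence \<open>H\<close> is also the Hilbert series of the direct sum of
  the ideal \<open>(x\<^bsub>r+1\<^esub>, \<dots>, x\<^sub>n)\<close> to the power \<open>t + r\<close> and of \<open>c\<^sub>j\<close> copies of \<open>K[x\<^sub>1, \<dots>, x\<^sub>r]\<close> generated in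
  degree \<open>j\<close>, for \<open>t \<le> j < t + r\<close>, on which the other variables act as zero. This module is free over
  \<open>K[x\<^sub>1, \<dots>, x\<^sub>r]\<close>, so \<open>x\<^sub>1, \<dots>, x\<^sub>r\<close> is a regular sequence on it and its depth is at least \<open>r\<close>.\<close>

section \<open>Binomial estimates for the coefficients of the numerator\<close>

definition geom :: "int fps" where "geom = Abs_fps (\<lambda>_. 1)"

lemma geom_nth [simp]: "fps_nth geom d = 1"
  by (simp add: geom_def)

lemma one_minus_X_geom: "(1 - fps_X) * geom = 1"
  by (rule fps_ext) (simp add: left_diff_distrib fps_X_mult_nth)

lemma geom_power_nth: "fps_nth (geom ^ n) d = int ((n + d - 1) choose d)"
proof (induction n arbitrary: d)
  case 0
  then show ?case by (cases d) simp_all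
next
  case (Suc n)
  have "fps_nth (geom ^ Suc n) d = (\<Sum>i\<le>d. int ((n + i - 1) choose i))"
    by (simp add: fps_mult_nth Suc mult.commute[of geom] atLeast0AtMost)
  also have "\<dots> = int ((n + d) choose d)"
  proof (induction d)
    case (Suc d)
    then show ?case by (simp add: add.commute)
  qed simp
  finally show ?case by simp
qed

lemma one_minus_X_power_nth:
  "fps_nth ((1 - fps_X) ^ r :: int fps) i = (- 1) ^ i * int (r choose i)"
proof (induction r arbitrary: i)
  case 0
  then show ?case by (cases i) simp_all
next
  case (Suc r)
  then show ?case
    by (cases i) (simp_all add: left_diff_distrib fps_X_mult_nth algebra_simps)
qed

lemma one_minus_X_power_geom_power:
  assumes "r \<le> n" shows "(1 - fps_X) ^ r * geom ^ n = geom ^ (n - r)"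
proof -
  have "(1 - fps_X) ^ r * geom ^ n = ((1 - fps_X) * geom) ^ r * geom ^ (n - r)"
    using assms by (simp add: power_mult_distrib mult.assoc flip: power_add)
  then show ?thesis by (simp add: one_minus_X_geom)
qed

lemma alternating_sum_bounds:
  fixes T :: "nat \<Rightarrow> int"
  assumes "\<And>i. i \<le> m \<Longrightarrow> 0 \<le> T i" and "\<And>i. i < m \<Longrightarrow> T (Suc i) \<le> T i"
  shows "0 \<le> (\<Sum>i\<le>m. (- 1) ^ i * T i) \<and> (\<Sum>i\<le>m. (- 1) ^ i * T i) \<le> T 0"
  using assms
proof (induction m arbitrary: T)
  case (Suc m)
  have "(\<Sum>i\<le>Suc m. (- 1) ^ i * T i) = T 0 - (\<Sum>i\<le>m. (- 1) ^ i * T (Suc i))"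
    by (subst sum.atMost_Suc_shift) (simp add: sum_negf)
  moreover have "0 \<le> (\<Sum>i\<le>m. (- 1) ^ i * T (Suc i))" "(\<Sum>i\<le>m. (- 1) ^ i * T (Suc i)) \<le> T 1"
    using Suc.IH[of "\<lambda>i. T (Suc i)"] Suc.prems by auto
  moreover have "T 1 \<le> T 0" using Suc.prems(2)[of 0] by simp
  ultimately show ?case by linarith
qed simp

text \<open>The case \<open>n = (r-1)(t+1) + 1\<close>, \<open>k = 3\<close> of \<open>binomial_inequality\<close> below. The falling factorial on the
  right has four more factors than the one on the left. Matching the remaining \<open>t - 1\<close> factors pairwise, each
  quotient is at most \<open>1 + 1/t\<close>, so that they lose at most \<open>(1 + 1/t)\<^sup>t \<le> e \<le> 3\<close> altogether; the four extra
  factors are each about \<open>r t\<close> and outweigh \<open>r choose 4\<close>, the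
  quotient of the factorials and this loss together.\<close>

lemma binomial_inequality_4:
  fixes r t :: nat
  assumes r: "r \<ge> 4" and t: "t \<ge> 1"
  shows "(r choose 4) * ((r * (t + 1) - 2) choose (t - 1)) \<le> (r * t + 2) choose (t + 3)"
proof -
  obtain s where s: "t = Suc s" using t by (cases t) auto
  define R T where "R = real r" and "T = real t"
  define x where "x = R * T"
  define P where "P = (\<Prod>i<s. R * (T + 1) - 2 - real i)"
  define Q where "Q = (\<Prod>i<s. x - 1 - real i)"
  define e where "e = (1 + 1 / T) ^ s"
  have rt: "T \<ge> 1" "R \<ge> 4" using t r by (auto simp: T_def R_def)
  have step: "T * (R - 1) \<le> x - 1 - real i" if "i < s" for i
  proof -
    have "1 + real i \<le> T" using that by (simp add: T_def s)
    then show ?thesis by (simp add: x_def right_diff_distrib mult.commute)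
  qed
  have tr: "0 \<le> T * (R - 1)" using rt by simp
  have xT: "R * (T + 1) = x + R" by (simp add: x_def distrib_left)
  have "P \<le> (\<Prod>i<s. (1 + 1 / T) * (x - 1 - real i))"
    unfolding P_def
  proof (rule prod_mono, rule conjI)
    fix i assume "i \<in> {..<s}"
    then have i: "T * (R - 1) \<le> x - 1 - real i" using step by simp
    then have "R - 1 \<le> (x - 1 - real i) / T"
      using rt by (simp add: pos_le_divide_eq mult.commute)
    then show "R * (T + 1) - 2 - real i \<le> (1 + 1 / T) * (x - 1 - real i)"
      unfolding xT distrib_right by simp
    show "0 \<le> R * (T + 1) - 2 - real i"
      using i tr rt unfolding xT by linarith
  qed
  then have PQ: "P \<le> e * Q" by (simp add: e_def Q_def prod.distrib)
  have Q0: "Q \<ge> 0" unfolding Q_def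
    using step tr by (intro prod_nonneg ballI) (meson lessThan_iff order_trans)
  have e: "(T + 1) * (T + 2) * (T + 3) * e \<le> 24 * T ^ 3"
  proof (cases "s = 0")
    case True
    then show ?thesis by (simp add: e_def T_def s)
  next
    case False
    then have t2: "T \<ge> 2" using s by (simp add: T_def)
    have "e \<le> (1 + 1 / T) ^ t"
      unfolding e_def using rt s by (intro power_increasing) auto
    also have "\<dots> \<le> exp 1"
      using exp_ge_one_plus_x_over_n_power_n[of t 1] t by (simp add: T_def)
    also have "\<dots> \<le> 3" by (rule exp_le)
    finally have e3: "e \<le> 3" .
    have "(T + 1) * (T + 2) * (T + 3) * e \<le> (T + 1) * (T + 2) * (T + 3) * 3"
      using rt by (intro mult_left_mono[OF e3]) simp
    also have "\<dots> \<le> 24 * T ^ 3"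
    proof -
      define u where "u = T - 2"
      have u: "T = u + 2" "u \<ge> 0" using t2 by (simp_all add: u_def)
      show ?thesis unfolding u(1) using u(2)
        by (simp add: power3_eq_cube algebra_simps)
    qed
    finally show ?thesis .
  qed
  have P0: "real ((r * (t + 1) - 2) choose (t - 1)) * fact (t - 1) = P"
  proof -
    have "4 * 1 \<le> r * (t + 1)" using r t by (intro mult_le_mono) auto
    then have "real (r * (t + 1) - 2) = R * (T + 1) - 2"
      by (subst of_nat_diff) (auto simp: R_def T_def distrib_left)
    then show ?thesis
      by (simp only: binomial_gbinomial gbinomial_mult_fact' P_def atLeast0LessThan) (simp add: s)
  qed
  have Q1: "real ((r * t + 2) choose (t + 3)) * fact (t + 3) = (x + 2) * (x + 1) * x * (x - T) * Q"
  proof -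
    have *: "(\<Prod>i<s + 4. g i) = g 0 * g 1 * g 2 * (\<Prod>i<s. g (i + 3)) * g (s + 3)" for g :: "nat \<Rightarrow> real"
    proof -
      have "(\<Prod>i<s + 4. g i) = (\<Prod>i<Suc (Suc (Suc s)). g i) * g (s + 3)"
        by (simp add: eval_nat_numeral)
      then show ?thesis
        by (simp add: prod.lessThan_Suc_shift numeral_2_eq_2 numeral_3_eq_3 mult.assoc
            del: prod.lessThan_Suc)
    qed
    have "real ((r * t + 2) choose (t + 3)) * fact (t + 3) = (\<Prod>i<s + 4. x + 2 - real i)"
      by (simp only: binomial_gbinomial gbinomial_mult_fact' atLeast0LessThan)
        (simp add: x_def R_def T_def s ac_simps distrib_left)
    also have "\<dots> = (x + 2) * (x + 1) * x * (x - T) * (\<Prod>i<s. x + 2 - real (i + 3))"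
      unfolding * by (simp add: T_def s ac_simps)
    also have "(\<Prod>i<s. x + 2 - real (i + 3)) = Q"
      unfolding Q_def by (intro prod.cong) auto
    finally show ?thesis .
  qed
  have f3: "fact (t + 3) = (T + 3) * (T + 2) * (T + 1) * T * fact (t - 1)"
    by (simp add: s T_def numeral_3_eq_3 ac_simps)
  have r4: "real (r choose 4) * 24 = R * (R - 1) * (R - 2) * (R - 3)"
  proof -
    have "real (r choose 4) * fact 4 = (\<Prod>i<4. R - real i)"
      unfolding R_def by (simp only: binomial_gbinomial gbinomial_mult_fact' atLeast0LessThan)
    also have "(\<Prod>i<4. R - real i) = R * (R - 1) * (R - 2) * (R - 3)"
      by (simp add: eval_nat_numeral lessThan_Suc ac_simps)
    finally show ?thesis by (simp add: fact_numeral)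
  qed
  have "(R - 2) * (R - 3) \<le> R * R" using rt by (intro mult_mono) auto
  then have "R * (R - 1) * ((R - 2) * (R - 3)) \<le> R * (R - 1) * (R * R)"
    using rt by (intro mult_left_mono) auto
  moreover have "R * (R - 1) * ((R - 2) * (R - 3)) = R * (R - 1) * (R - 2) * (R - 3)"
      "R * (R - 1) * (R * R) = R ^ 3 * (R - 1)"
    by (simp_all only: power3_eq_cube ac_simps)
  ultimately have RR: "R * (R - 1) * (R - 2) * (R - 3) \<le> R ^ 3 * (R - 1)" by linarith
  have "P \<ge> 0" by (simp flip: P0)
  have "(R * (R - 1) * (R - 2) * (R - 3)) * P \<le> (R ^ 3 * (R - 1)) * (e * Q)"
    by (rule mult_mono[OF RR PQ]) (use rt \<open>P \<ge> 0\<close> in auto)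
  then have "(R * (R - 1) * (R - 2) * (R - 3)) * P * ((T + 3) * (T + 2) * (T + 1) * T)
      \<le> (R ^ 3 * (R - 1)) * (e * Q) * ((T + 3) * (T + 2) * (T + 1) * T)"
    using rt by (intro mult_right_mono) auto
  also have "\<dots> = (R ^ 3 * (R - 1) * Q * T) * ((T + 1) * (T + 2) * (T + 3) * e)"
    by (simp only: ac_simps)
  also have "\<dots> \<le> (R ^ 3 * (R - 1) * Q * T) * (24 * T ^ 3)"
    using e Q0 rt by (intro mult_left_mono) auto
  also have "\<dots> = 24 * (x * x * x * (T * (R - 1)) * Q)"
    unfolding x_def power3_eq_cube by (simp only: ac_simps)
  also have "T * (R - 1) = x - T" by (simp add: x_def right_diff_distrib mult.commute)
  also have "24 * (x * x * x * (x - T) * Q) \<le> 24 * ((x + 2) * (x + 1) * x * (x - T) * Q)"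
  proof -
    have "x \<ge> 0" using rt by (simp add: x_def)
    moreover have "x - T \<ge> 0" using tr by (simp add: x_def right_diff_distrib mult.commute)
    ultimately show ?thesis using Q0
      by (intro mult_left_mono mult_right_mono mult_mono) auto
  qed
  finally have "real (r choose 4) * 24 * (real ((r * (t + 1) - 2) choose (t - 1)) * fact (t - 1))
      * ((T + 3) * (T + 2) * (T + 1) * T) \<le> 24 * (real ((r * t + 2) choose (t + 3)) * fact (t + 3))"
    by (simp only: r4 P0 Q1)
  then have "real ((r choose 4) * ((r * (t + 1) - 2) choose (t - 1))) * (24 * fact (t + 3))
     \<le> real ((r * t + 2) choose (t + 3)) * (24 * fact (t + 3))"
    unfolding f3 of_nat_mult by (simp only: ac_simps)
  moreover have "(0::real) < 24 * fact (t + 3)" by simp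
  ultimately have "real ((r choose 4) * ((r * (t + 1) - 2) choose (t - 1))) \<le> real ((r * t + 2) choose (t + 3))"
    using mult_le_cancel_right_pos by blast
  then show ?thesis by (simp only: of_nat_le_iff)
qed

text \<open>For \<open>k > 3\<close> and for larger \<open>n\<close> this follows from \<open>binomial_inequality_4\<close>, because the right-hand
  side grows faster in both variables, as the quotients of consecutive binomial coefficients show.\<close>

lemma binomial_inequality:
  assumes t: "t \<ge> 1" and n: "(r - 1) * (t + 1) < n" and k: "3 \<le> k" "k < r"
  shows "(r choose Suc k) * ((n + t - 2) choose (t - 1)) \<le> (n - r + t + k - 1) choose (t + k)"
proof -
  have mono_k: "(r choose Suc k) * ((r * (t + 1) - 2) choose (t - 1)) \<le> (r * t + k - 1) choose (t + k)"
    using k(1)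
  proof (induction k rule: dec_induct)
    case base
    show ?case
      using binomial_inequality_4[OF _ t, of r] k by (simp add: eval_nat_numeral)
  next
    case (step k)
    let ?A = "(r * (t + 1) - 2) choose (t - 1)"
    have 1: "Suc (Suc k) * (r choose Suc (Suc k)) = (r - Suc k) * (r choose Suc k)"
      unfolding binomial_absorption binomial_absorb_comp ..
    have 2: "Suc (t + k) * ((r * t + k) choose Suc (t + k)) = (r * t + k) * ((r * t + k - 1) choose (t + k))"
      by (rule binomial_absorption)
    have 3: "(r - Suc k) * Suc (t + k) \<le> (r * t + k) * Suc (Suc k)"
    proof -
      have "Suc (t + k) \<le> t * Suc (Suc k)" using t by (cases t) auto
      then have "(r - Suc k) * Suc (t + k) \<le> r * (t * Suc (Suc k))" by (intro mult_le_mono) auto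
      also have "\<dots> \<le> (r * t + k) * Suc (Suc k)" by (simp only: mult.assoc[symmetric] mult_le_mono1 le_add1)
      finally show ?thesis .
    qed
    have "((r choose Suc (Suc k)) * ?A) * (Suc (Suc k) * Suc (t + k))
        = (Suc (Suc k) * (r choose Suc (Suc k))) * ?A * Suc (t + k)"
      by (simp only: ac_simps)
    also have "\<dots> = ((r choose Suc k) * ?A) * ((r - Suc k) * Suc (t + k))"
      unfolding 1 by (simp only: ac_simps)
    also have "\<dots> \<le> ((r * t + k - 1) choose (t + k)) * ((r * t + k) * Suc (Suc k))"
      using step.IH 3 by (rule mult_le_mono)
    also have "\<dots> = ((r * t + k) * ((r * t + k - 1) choose (t + k))) * Suc (Suc k)"
      by (simp only: ac_simps)
    also have "\<dots> = ((r * t + k) choose Suc (t + k)) * (Suc (Suc k) * Suc (t + k))"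
      unfolding 2[symmetric] by (simp only: ac_simps)
    finally have "(r choose Suc (Suc k)) * ?A \<le> (r * t + k) choose Suc (t + k)"
      by (subst (asm) mult_le_cancel2) simp
    then show ?case by simp
  qed
  obtain q where q: "r = Suc q" using k by (cases r) auto
  have "q * t + q < n" using n q by (simp add: algebra_simps)
  then have "Suc (q * t + q) \<le> n" by simp
  then show ?thesis
  proof (induction n rule: dec_induct)
    case base
    have "Suc (q * t + q) + t - 2 = r * (t + 1) - 2" "Suc (q * t + q) - r + t + k - 1 = r * t + k - 1"
      using t by (simp_all add: q)
    then show ?case using mono_k by (simp only:)
  next
    case (step n)
    let ?C = "r choose Suc k" and ?A = "(n + t - 2) choose (t - 1)"
      and ?A' = "(n + t - 1) choose (t - 1)" and ?B = "(n - r + t + k - 1) choose (t + k)"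
      and ?B' = "(n - r + t + k) choose (t + k)"
    have "q * 1 \<le> q * t" using t by (intro mult_le_mono) auto
    then have nr: "n - r > 0" using step(1) k unfolding q by linarith
    have 1: "n * ?A' = (n + t - 1) * ?A"
      using binomial_absorb_comp[of "n + t - 1" "t - 1"] t by (simp add: numeral_2_eq_2)
    have 2: "(n - r) * ?B' = (n - r + t + k) * ?B"
      using binomial_absorb_comp[of "n - r + t + k" "t + k"] by simp
    have 3: "(n + t - 1) * (n - r) \<le> n * (n - r + t + k)"
    proof -
      have "(n + t - 1) * (n - r) = n * (n - r) + (t - 1) * (n - r)"
        using t by (simp add: distrib_right[symmetric])
      also have "(t - 1) * (n - r) \<le> (t + k) * n" by (intro mult_le_mono) auto
      finally show ?thesis by (simp add: algebra_simps)
    qed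
    have "(?C * ?A') * (n * (n - r)) = ?C * (n * ?A') * (n - r)" by (simp only: ac_simps)
    also have "\<dots> = (?C * ?A) * ((n + t - 1) * (n - r))" unfolding 1 by (simp only: ac_simps)
    also have "\<dots> \<le> ?B * (n * (n - r + t + k))" using step.IH 3 by (rule mult_le_mono)
    also have "\<dots> = ((n - r + t + k) * ?B) * n" by (simp only: ac_simps)
    also have "\<dots> = ?B' * (n * (n - r))" unfolding 2[symmetric] by (simp only: ac_simps)
    finally have "?C * ?A' \<le> ?B'" using nr by (subst (asm) mult_le_cancel2) simp
    moreover have "Suc n + t - 2 = n + t - 1" "Suc n - r + t + k - 1 = n - r + t + k"
      using t nr by simp_all
    ultimately show ?case by (simp only:)
  qed
qed

lemma first_difference_nonneg:
  assumes "r * (t + 1) \<le> n + t"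
  shows "r * ((n + t - 1) choose t) \<le> (n + t) choose (t + 1)"
proof -
  have *: "Suc t * ((n + t) choose Suc t) = (n + t) * ((n + t - 1) choose t)"
    by (rule binomial_absorption)
  have "r * ((n + t - 1) choose t) * Suc t = (r * (t + 1)) * ((n + t - 1) choose t)"
    by (simp add: distrib_left distrib_right)
  also have "\<dots> \<le> (n + t) * ((n + t - 1) choose t)" using assms by (rule mult_le_mono1)
  also have "\<dots> = ((n + t) choose (t + 1)) * Suc t" unfolding *[symmetric] by simp
  finally show ?thesis by (subst (asm) mult_le_cancel2) simp
qed

text \<open>The sum is the coefficient of \<open>(1 - z)\<^sup>r H\<close> in degree \<open>t + k\<close>. If it ran up to \<open>t + k\<close> it would be a
  coefficient of \<open>1/(1 - z)\<^bsup>n-r\<^esup>\<close>, which is nonnegative. The missing tail alternates, and its terms decrease in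
  absolute value, so it lies between \<open>0\<close> and its first term. For even \<open>k\<close> removing the tail only increases the
  sum. For odd \<open>k \<ge> 3\<close> the first term of the tail is small enough by \<open>binomial_inequality\<close>. For \<open>k = 1\<close> that
  estimate may fail, but there the sum has only two terms; it is here that \<open>r \<le> (n+t)/(t+1)\<close> is sharp.\<close>

lemma hilbert_numerator_nonneg:
  assumes t: "t \<ge> 1" and n: "(r - 1) * (t + 1) < n" and r: "r \<ge> 1" "r \<le> n"
  shows "0 \<le> (\<Sum>i\<le>k. (- 1) ^ i * (int (r choose i) * int ((n + (t + k - i) - 1) choose (t + k - i))))"
proof -
  define T where "T i = int (r choose i) * int ((n + (t + k - i) - 1) choose (t + k - i))" for i
  have T0: "T i \<ge> 0" for i by (simp add: T_def)
  have full: "(\<Sum>i\<le>t + k. (- 1) ^ i * T i) = int ((n - r + (t + k) - 1) choose (t + k))"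
  proof -
    have "(\<Sum>i\<le>t + k. (- 1) ^ i * T i) = fps_nth ((1 - fps_X) ^ r * geom ^ n) (t + k)"
      by (simp add: fps_mult_nth one_minus_X_power_nth geom_power_nth T_def atLeast0AtMost mult.assoc)
    then show ?thesis by (simp add: one_minus_X_power_geom_power[OF r(2)] geom_power_nth)
  qed
  define W where "W = (\<Sum>i\<le>t - 1. (- 1) ^ i * T (Suc k + i))"
  have split: "(\<Sum>i\<le>t + k. (- 1) ^ i * T i) = (\<Sum>i\<le>k. (- 1) ^ i * T i) + (- 1) ^ Suc k * W"
  proof -
    have *: "{..t + k} = {..k} \<union> (\<lambda>i. Suc k + i) ` {..t - 1}"
    proof (rule equalityI; rule subsetI)
      fix i assume "i \<in> {..t + k}"
      then show "i \<in> {..k} \<union> (\<lambda>i. Suc k + i) ` {..t - 1}"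
        using t by (cases "i \<le> k") (auto intro!: rev_image_eqI[of "i - Suc k"])
    qed (use t in auto)
    have "(\<Sum>i\<in>(\<lambda>i. Suc k + i) ` {..t - 1}. (- 1) ^ i * T i) = (- 1) ^ Suc k * W"
      unfolding W_def by (subst sum.reindex) (auto simp: sum_distrib_left power_add mult.assoc o_def)
    then show ?thesis
      by (simp only: *, subst sum.union_disjoint) auto
  qed
  have decr: "T (Suc i) \<le> T i" if i: "Suc k \<le> i" "i < t + k" for i
  proof -
    define m where "m = t + k - i"
    have m: "m \<ge> 1" "m \<le> t" using i by (auto simp: m_def)
    have 1: "Suc i * (r choose Suc i) = (r - i) * (r choose i)"
      unfolding binomial_absorption binomial_absorb_comp ..
    have 2: "m * ((n + m - 1) choose m) = (n + m - 1) * ((n + (m - 1) - 1) choose (m - 1))"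
      using binomial_absorption[of "m - 1" "n + m - 1"] m by simp
    have "(r - i) * m \<le> (r - 1) * (t + 1)" using i m by (intro mult_le_mono) auto
    then have 3: "(r - i) * m \<le> Suc i * (n + m - 1)" using n by simp
    have "(r choose Suc i) * ((n + (m - 1) - 1) choose (m - 1)) * (Suc i * (n + m - 1))
        = (Suc i * (r choose Suc i)) * ((n + m - 1) * ((n + (m - 1) - 1) choose (m - 1)))"
      by (simp only: ac_simps)
    also have "\<dots> = ((r choose i) * ((n + m - 1) choose m)) * ((r - i) * m)"
      unfolding 1 2[symmetric] by (simp only: ac_simps)
    also have "\<dots> \<le> ((r choose i) * ((n + m - 1) choose m)) * (Suc i * (n + m - 1))"
      using 3 by (rule mult_le_mono2)
    finally have "(r choose Suc i) * ((n + (m - 1) - 1) choose (m - 1)) \<le> (r choose i) * ((n + m - 1) choose m)"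
      using n m by (subst (asm) mult_le_cancel2) auto
    moreover have "t + k - Suc i = m - 1" by (simp add: m_def)
    ultimately show ?thesis unfolding T_def m_def[symmetric] by (simp flip: of_nat_mult)
  qed
  have W: "0 \<le> W \<and> W \<le> T (Suc k + 0)"
    unfolding W_def by (rule alternating_sum_bounds) (use T0 decr in auto)
  have "0 \<le> (\<Sum>i\<le>k. (- 1) ^ i * T i)"
  proof (cases "even k")
    case True
    then show ?thesis using split full W by simp
  next
    case odd: False
    show ?thesis
    proof (cases "k = 1")
      case True
      have "r * (t + 1) \<le> n + t" using n r by (cases r) auto
      from first_difference_nonneg[OF this]
      have "int (r * ((n + t - 1) choose t)) \<le> int ((n + t) choose (t + 1))" by (simp only: of_nat_le_iff)
      then show ?thesis using True by (simp add: T_def)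
    next
      case False
      then have k: "3 \<le> k" using odd by (cases "k = 2") (auto simp: not_less_eq_eq[symmetric] intro: ccontr, presburger)
      have "T (Suc k) \<le> int ((n - r + (t + k) - 1) choose (t + k))"
      proof (cases "k < r")
        case True
        have "t + k - Suc k = t - 1" "n + (t - 1) - 1 = n + t - 2" "n - r + (t + k) - 1 = n - r + t + k - 1"
          using t by auto
        then show ?thesis unfolding T_def
          using binomial_inequality[OF t n k True] by (simp only: of_nat_le_iff flip: of_nat_mult)
      qed (simp add: T_def binomial_eq_0)
      then show ?thesis using split full W odd by simp
    qed
  qed
  then show ?thesis by (simp only: T_def)
qed

section \<open>Chain conditions\<close>

text \<open>From here on polynomials are handled by the operations of their type. The record operations and the
  carrier stay folded, so that the module axioms keep matching.\<close>

declare carrier_mpoly_ring [simp del] mult_mpoly_ring [simp del] one_mpoly_ring [simp del]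
  zero_mpoly_ring [simp del] add_mpoly_ring [simp del]

lemma nat_seq_incseq_subseq:
  fixes s :: "nat \<Rightarrow> nat"
  shows "\<exists>f. strict_mono f \<and> incseq (\<lambda>i. s (f i))"
proof -
  obtain f where f: "strict_mono f" "monoseq (\<lambda>i. s (f i))"
    using seq_monosub by blast
  then consider "incseq (\<lambda>i. s (f i))" | "decseq (\<lambda>i. s (f i))"
    using monoseq_iff by blast
  then show ?thesis
  proof cases
    case 2
    obtain N where N: "\<And>i. s (f N) \<le> s (f i)"
      using ex_has_least_nat[of "\<lambda>_. True" 0 "\<lambda>i. s (f i)"] by auto
    have "s (f (i + N)) = s (f N)" for i
      using N[of "i + N"] decseqD[OF 2, of N "i + N"] by simp
    moreover have "strict_mono (\<lambda>i. f (i + N))"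
      using f(1) by (simp add: strict_mono_def)
    ultimately show ?thesis
      by (intro exI[of _ "\<lambda>i. f (i + N)"]) (simp add: incseq_def)
  qed (use f in blast)
qed

text \<open>Dickson's lemma: along a suitable subsequence all \<open>n\<close> exponents are nondecreasing.\<close>

lemma dickson:
  fixes s :: "nat \<Rightarrow> nat \<Rightarrow>\<^sub>0 nat"
  assumes "\<And>i. Poly_Mapping.keys (s i) \<subseteq> {..<n}"
  shows "\<exists>i j m. i < j \<and> s j = s i + m \<and> Poly_Mapping.keys m \<subseteq> {..<n}"
proof -
  have "\<exists>f. strict_mono f \<and> (\<forall>k<n. incseq (\<lambda>i. Poly_Mapping.lookup (s (f i)) k))"
  proof (induction n)
    case 0
    then show ?case using strict_mono_id by (auto simp: strict_mono_def)
  next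
    case (Suc n)
    then obtain f where f: "strict_mono f" "\<And>k. k < n \<Longrightarrow> incseq (\<lambda>i. Poly_Mapping.lookup (s (f i)) k)"
      by blast
    obtain g where g: "strict_mono g" "incseq (\<lambda>i. Poly_Mapping.lookup (s (f (g i))) n)"
      using nat_seq_incseq_subseq[of "\<lambda>i. Poly_Mapping.lookup (s (f i)) n"] by blast
    have "incseq (\<lambda>i. Poly_Mapping.lookup (s (f (g i))) k)" if "k < Suc n" for k
    proof (cases "k = n")
      case False
      then have "incseq (\<lambda>i. Poly_Mapping.lookup (s (f i)) k)" using f(2) that by simp
      then show ?thesis using g(1) by (simp add: incseq_def strict_mono_less_eq)
    qed (use g in simp)
    moreover have "strict_mono (\<lambda>i. f (g i))" using f(1) g(1) by (simp add: strict_mono_def)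
    ultimately show ?case by (intro exI[of _ "\<lambda>i. f (g i)"]) blast
  qed
  then obtain f where f: "strict_mono f" "\<And>k. k < n \<Longrightarrow> incseq (\<lambda>i. Poly_Mapping.lookup (s (f i)) k)"
    by blast
  define m where "m = s (f 1) - s (f 0)"
  have le: "Poly_Mapping.lookup (s (f 0)) k \<le> Poly_Mapping.lookup (s (f 1)) k" for k
  proof (cases "k < n")
    case True
    then show ?thesis using f(2) incseqD[of "\<lambda>i. Poly_Mapping.lookup (s (f i)) k" 0 1] by simp
  next
    case False
    then have "k \<notin> Poly_Mapping.keys (s (f 0))" using assms by fastforce
    then show ?thesis by (simp add: in_keys_iff)
  qed
  have "s (f 1) = s (f 0) + m"
    unfolding m_def using le by (intro poly_mapping_eqI) (simp add: lookup_add lookup_minus)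
  moreover have "Poly_Mapping.keys m \<subseteq> {..<n}"
  proof
    fix k assume "k \<in> Poly_Mapping.keys m"
    then have "k \<in> Poly_Mapping.keys (s (f 1))"
      by (simp add: m_def in_keys_iff lookup_minus)
    then show "k \<in> {..<n}" by (rule subsetD[OF assms])
  qed
  moreover have "f 0 < f 1" using f(1) by (simp add: strict_mono_def)
  ultimately show ?thesis by (intro exI[of _ "f 0"] exI[of _ "f 1"] exI[of _ m] conjI)
qed

text \<open>The lexicographic order is not well-founded on monomials in infinitely many variables; on those in \<open>n\<close>
  variables it is, by Dickson's lemma, because a multiple of a monomial is never smaller.\<close>

lemma wf_monomials:
  "wf {(a, b :: nat \<Rightarrow>\<^sub>0 nat). a < b \<and> Poly_Mapping.keys a \<subseteq> {..<n} \<and> Poly_Mapping.keys b \<subseteq> {..<n}}"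
  unfolding wf_iff_no_infinite_down_chain
proof (intro allI notI, elim exE)
  fix s :: "nat \<Rightarrow> nat \<Rightarrow>\<^sub>0 nat"
  assume s: "\<forall>i. (s (Suc i), s i) \<in> {(a, b). a < b \<and> Poly_Mapping.keys a \<subseteq> {..<n} \<and> Poly_Mapping.keys b \<subseteq> {..<n}}"
  then have "\<And>i. Poly_Mapping.keys (s i) \<subseteq> {..<n}" by simp
  then obtain i j m where ij: "i < j" "s j = s i + m" using dickson by blast
  have "s (i + Suc k) < s i" for k
  proof (induction k)
    case 0
    then show ?case using s by simp
  next
    case (Suc k)
    have "s (i + Suc (Suc k)) < s (i + Suc k)" using s by simp
    then show ?case using Suc.IH by (rule less_trans)
  qed
  from this[of "j - Suc i"] have "s j < s i" using ij(1) by simp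
  moreover have "\<not> m < 0"
    by transfer (simp add: less_fun_def)
  ultimately show False using ij(2) add_less_cancel_left[of "s i" m 0] by simp
qed

lemma mpoly_carrier_iff: "p \<in> carrier (mpoly_ring n) \<longleftrightarrow> (\<forall>m\<in>Poly_Mapping.keys p. Poly_Mapping.keys m \<subseteq> {..<n})"
  by (simp add: carrier_mpoly_ring)

lemma single_in_carrier [simp, intro]:
  "Poly_Mapping.keys m \<subseteq> {..<n} \<Longrightarrow> Poly_Mapping.single m c \<in> carrier (mpoly_ring n)"
  by (simp add: mpoly_carrier_iff)

lemma mconst_in_carrier [simp, intro]: "mconst c \<in> carrier (mpoly_ring n)"
  by (simp add: mconst_def)

lemma mvar_in_carrier [simp, intro]: "i < n \<Longrightarrow> mvar i \<in> carrier (mpoly_ring n)"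
  by (simp add: mvar_def)

lemma mpoly_carrier_closed [simp, intro]:
  fixes p q :: "'a::comm_ring_1 mpoly"
  shows "0 \<in> carrier (mpoly_ring n)" "1 \<in> carrier (mpoly_ring n)"
    and "p \<in> carrier (mpoly_ring n) \<Longrightarrow> q \<in> carrier (mpoly_ring n) \<Longrightarrow> p + q \<in> carrier (mpoly_ring n)"
    and "p \<in> carrier (mpoly_ring n) \<Longrightarrow> q \<in> carrier (mpoly_ring n) \<Longrightarrow> p * q \<in> carrier (mpoly_ring n)"
    and "p \<in> carrier (mpoly_ring n) \<Longrightarrow> - p \<in> carrier (mpoly_ring n)"
proof -
  interpret cring "mpoly_ring n :: 'a mpoly ring" by (rule cring_mpoly_ring)
  show "0 \<in> carrier (mpoly_ring n)" "1 \<in> carrier (mpoly_ring n)"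
    by (simp_all add: mpoly_carrier_iff)
  show "p \<in> carrier (mpoly_ring n) \<Longrightarrow> q \<in> carrier (mpoly_ring n) \<Longrightarrow> p + q \<in> carrier (mpoly_ring n)"
    "p \<in> carrier (mpoly_ring n) \<Longrightarrow> q \<in> carrier (mpoly_ring n) \<Longrightarrow> p * q \<in> carrier (mpoly_ring n)"
    using a_closed[of p q] m_closed[of p q] by (simp_all add: add_mpoly_ring mult_mpoly_ring)
  show "p \<in> carrier (mpoly_ring n) \<Longrightarrow> - p \<in> carrier (mpoly_ring n)"
    by (simp add: mpoly_carrier_iff)
qed

definition lead_monom :: "'a::zero mpoly \<Rightarrow> nat \<Rightarrow>\<^sub>0 nat" where
  "lead_monom p = Max (Poly_Mapping.keys p)"

lemma lead_monom_in_keys: "p \<noteq> 0 \<Longrightarrow> lead_monom p \<in> Poly_Mapping.keys p"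
  unfolding lead_monom_def by (intro Max_in) simp_all

lemma le_lead_monom: "m \<in> Poly_Mapping.keys p \<Longrightarrow> m \<le> lead_monom p"
  unfolding lead_monom_def by simp

lemma lookup_single_times:
  "Poly_Mapping.lookup (Poly_Mapping.single m c * p) (m + k) = (c :: 'a::comm_ring_1) * Poly_Mapping.lookup p (k :: nat \<Rightarrow>\<^sub>0 nat)"
  by (simp only: lookup_mult lookup_single when_mult Sum_any_when_equal' add_left_cancel)

lemma lead_monom_reduce:
  fixes p q :: "'a::field mpoly"
  assumes "q \<noteq> 0" "lead_monom p = lead_monom q + m"
  shows "\<exists>c. p - Poly_Mapping.single m c * q = 0 \<or> lead_monom (p - Poly_Mapping.single m c * q) < lead_monom p"
proof -
  define c where "c = Poly_Mapping.lookup p (lead_monom p) / Poly_Mapping.lookup q (lead_monom q)"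
  define g where "g = p - Poly_Mapping.single m c * q"
  have "Poly_Mapping.lookup q (lead_monom q) \<noteq> 0"
    using lead_monom_in_keys[OF assms(1)] by (simp add: in_keys_iff)
  then have lookup0: "Poly_Mapping.lookup g (lead_monom p) = 0"
    using lookup_single_times[of m c q "lead_monom q"]
    by (simp add: g_def lookup_minus assms(2) add.commute[of m] c_def)
  have le: "k \<le> lead_monom p" if "k \<in> Poly_Mapping.keys g" for k
  proof -
    have "k \<in> Poly_Mapping.keys p \<or> k \<in> Poly_Mapping.keys (Poly_Mapping.single m c * q)"
      using subsetD[OF keys_diff that[unfolded g_def]] by simp
    then show ?thesis
    proof
      assume "k \<in> Poly_Mapping.keys (Poly_Mapping.single m c * q)"
      then obtain a b where ab: "k = a + b" "a \<in> Poly_Mapping.keys (Poly_Mapping.single m c)" "b \<in> Poly_Mapping.keys q"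
        using keys_mult[of "Poly_Mapping.single m c" q] by blast
      have "a = m" using ab(2) by (simp split: if_splits)
      then show ?thesis
        unfolding ab(1) assms(2) add.commute[of _ m] using le_lead_monom[OF ab(3)] by (simp add: add_left_mono)
    qed (rule le_lead_monom)
  qed
  have "g = 0 \<or> lead_monom g < lead_monom p"
  proof (cases "g = 0")
    case False
    then have "lead_monom g \<in> Poly_Mapping.keys g" by (rule lead_monom_in_keys)
    moreover have "lead_monom p \<notin> Poly_Mapping.keys g" using lookup0 by (simp add: in_keys_iff)
    ultimately have "lead_monom g \<noteq> lead_monom p" by metis
    with le[OF \<open>lead_monom g \<in> Poly_Mapping.keys g\<close>] show ?thesis by (intro disjI2 le_neq_trans)
  qed simp
  then show ?thesis unfolding g_def by blast
qed

text \<open>Hilbert's basis theorem. If the chain does not stabilise, choose for every \<open>N\<close> an element of the union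
  outside \<open>I N\<close> with minimal leading monomial. By Dickson's lemma one of the chosen leading monomials divides a
  later one, so a reduction step produces an element that contradicts minimality.\<close>

theorem ideals_stabilise:
  fixes I :: "nat \<Rightarrow> 'a::field mpoly set"
  assumes carrier: "\<And>i. I i \<subseteq> carrier (mpoly_ring n)"
    and zero: "\<And>i. 0 \<in> I i"
    and add: "\<And>i p q. p \<in> I i \<Longrightarrow> q \<in> I i \<Longrightarrow> p + q \<in> I i"
    and mult: "\<And>i p q. p \<in> carrier (mpoly_ring n) \<Longrightarrow> q \<in> I i \<Longrightarrow> p * q \<in> I i"
    and mono: "\<And>i j. i \<le> j \<Longrightarrow> I i \<subseteq> I j"
  shows "\<exists>N. \<forall>j\<ge>N. I j = I N"
proof (rule ccontr)
  assume contr: "\<not> ?thesis"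
  define U where "U = (\<Union>i. I i)"
  have "\<exists>p. p \<in> U - I N \<and> (\<forall>q\<in>U - I N. \<not> lead_monom q < lead_monom p)" for N
  proof -
    from contr obtain j where "j \<ge> N" "I j \<noteq> I N" by blast
    then have "lead_monom ` (U - I N) \<noteq> {}" using mono[of N j] unfolding U_def by blast
    moreover have "wf {(a, b :: nat \<Rightarrow>\<^sub>0 nat). a < b \<and> Poly_Mapping.keys a \<subseteq> {..<n} \<and> Poly_Mapping.keys b \<subseteq> {..<n}}"
      by (rule wf_monomials)
    ultimately obtain m where m: "m \<in> lead_monom ` (U - I N)"
      "\<And>b. (b, m) \<in> {(a, b). a < b \<and> Poly_Mapping.keys a \<subseteq> {..<n} \<and> Poly_Mapping.keys b \<subseteq> {..<n}} \<Longrightarrow> b \<notin> lead_monom ` (U - I N)"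
      by (metis (no_types, lifting) wf_eq_minimal2 ex_in_conv wfE_min)
    have keys: "Poly_Mapping.keys (lead_monom p) \<subseteq> {..<n}" if "p \<in> U - I N" for p
    proof -
      have "p \<noteq> 0" "p \<in> carrier (mpoly_ring n)" using that zero carrier unfolding U_def by auto
      then show ?thesis using lead_monom_in_keys by (auto simp: mpoly_carrier_iff)
    qed
    show ?thesis using m keys by (auto simp: image_iff) 
  qed
  then obtain p where p: "\<And>N. p N \<in> U" "\<And>N. p N \<notin> I N"
    and p_min: "\<And>N q. q \<in> U \<Longrightarrow> q \<notin> I N \<Longrightarrow> \<not> lead_monom q < lead_monom (p N)"
    by (metis Diff_iff)
  have "\<exists>j. p N \<in> I j" for N using p(1) unfolding U_def by blast
  then obtain d where d: "\<And>N. p N \<in> I (d N)" by metis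
  have d_gt: "N < d N" for N using d[of N] p(2)[of N] mono[of "d N" N] by (meson leI subsetD)
  \<comment> \<open>Indices along which every chosen element already lies in the next ideal.\<close>
  define e where "e k = (d ^^ k) 0" for k
  have e_Suc: "e (Suc k) = d (e k)" for k by (simp add: e_def)
  have e_mono: "e i \<le> e j" if "i \<le> j" for i j
    using that by (induction j rule: dec_induct) (auto simp: e_Suc intro: order_trans less_imp_le d_gt)
  have nz: "p N \<noteq> 0" for N using p(2)[of N] zero[of N] by metis
  have pU: "p N \<in> carrier (mpoly_ring n)" for N using p(1) carrier unfolding U_def by blast
  have "Poly_Mapping.keys (lead_monom (p (e k))) \<subseteq> {..<n}" for k
    using lead_monom_in_keys[OF nz] pU by (auto simp: mpoly_carrier_iff)
  then obtain i j m where ij: "i < j" "lead_monom (p (e j)) = lead_monom (p (e i)) + m"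
      "Poly_Mapping.keys m \<subseteq> {..<n}"
    using dickson[of "\<lambda>k. lead_monom (p (e k))" n] by blast
  obtain c where c: "p (e j) - Poly_Mapping.single m c * p (e i) = 0
      \<or> lead_monom (p (e j) - Poly_Mapping.single m c * p (e i)) < lead_monom (p (e j))"
    using lead_monom_reduce[OF nz ij(2)] by blast
  define q where "q = Poly_Mapping.single m c * p (e i)"
  have "p (e i) \<in> I (e j)" using d[of "e i"] mono[OF e_mono[of "Suc i" j]] ij(1) by (auto simp: e_Suc)
  then have q: "q \<in> I (e j)" unfolding q_def using ij(3) by (intro mult) auto
  have "- 1 \<in> carrier (mpoly_ring n)" by auto
  then have "- 1 * q \<in> I (d (e j))" using q d_gt[of "e j"] mono[of "e j" "d (e j)"] by (intro mult) auto
  then have "p (e j) - q \<in> U" using add[OF d[of "e j"]] unfolding U_def by fastforce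
  moreover have "p (e j) - q \<notin> I (e j)"
    using add[OF _ q, of "p (e j) - q"] p(2)[of "e j"] by auto
  moreover from this have "p (e j) - q \<noteq> 0" using zero by metis
  ultimately show False using c p_min[of "p (e j) - q" "e j"] unfolding q_def by blast
qed


locale mpoly_module = Module.module "mpoly_ring n" M
  for n :: nat and M :: "('a::field mpoly, 'b, 'c) module_scheme" (structure)
begin

abbreviation "R \<equiv> mpoly_ring n :: 'a mpoly ring"

lemma smult_add_left: "\<lbrakk>p \<in> carrier R; q \<in> carrier R; v \<in> carrier M\<rbrakk> \<Longrightarrow> (p + q) \<odot> v = p \<odot> v \<oplus> q \<odot> v"
  using smult_l_distr[of p q v] by (simp add: add_mpoly_ring)

lemma smult_mult: "\<lbrakk>p \<in> carrier R; q \<in> carrier R; v \<in> carrier M\<rbrakk> \<Longrightarrow> (p * q) \<odot> v = p \<odot> (q \<odot> v)"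
  using smult_assoc1[of p q v] by (simp add: mult_mpoly_ring)

lemma smult_one': "v \<in> carrier M \<Longrightarrow> 1 \<odot> v = v"
  using smult_one[of v] by (simp add: one_mpoly_ring)

lemma smult_zero': "v \<in> carrier M \<Longrightarrow> 0 \<odot> v = \<zero>"
  using smult_l_null[of v] by (simp add: zero_mpoly_ring)

lemma smult_minus_one: "v \<in> carrier M \<Longrightarrow> (- 1) \<odot> v = \<ominus> v"
proof -
  assume v: "v \<in> carrier M"
  have "(- 1) \<odot> v \<oplus> 1 \<odot> v = \<zero>"
    using v smult_add_left[of "- 1" 1 v] by (simp add: smult_zero')
  then show "(- 1) \<odot> v = \<ominus> v" using v by (intro M.minus_equality[symmetric]) (simp_all add: smult_one')
qed

lemma smult_commute:
  assumes "p \<in> carrier R" "q \<in> carrier R" "v \<in> carrier M"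
  shows "p \<odot> (q \<odot> v) = q \<odot> (p \<odot> v)"
  using assms smult_mult[of p q v] smult_mult[of q p v] by (simp add: mult.commute)

lemma submodule_carrier: "submodule R U M \<Longrightarrow> u \<in> U \<Longrightarrow> u \<in> carrier M"
  and submodule_zero: "submodule R U M \<Longrightarrow> \<zero> \<in> U"
  and submodule_add: "submodule R U M \<Longrightarrow> u \<in> U \<Longrightarrow> v \<in> U \<Longrightarrow> u \<oplus> v \<in> U"
  and submodule_smult: "submodule R U M \<Longrightarrow> p \<in> carrier R \<Longrightarrow> u \<in> U \<Longrightarrow> p \<odot> u \<in> U"
  unfolding submodule_def by auto

lemma submodule_minus: "submodule R U M \<Longrightarrow> u \<in> U \<Longrightarrow> v \<in> U \<Longrightarrow> u \<ominus> v \<in> U"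
  unfolding a_minus_def
  by (metis smult_minus_one submodule_add submodule_carrier submodule_smult mpoly_carrier_closed(2,5))

lemma add_minus_cancel:
  assumes "u \<in> carrier M" "v \<in> carrier M" "w \<in> carrier M"
  shows "u \<oplus> (v \<oplus> \<ominus> u) = v" "u \<oplus> (v \<oplus> (\<ominus> u \<oplus> w)) = v \<oplus> w"
  using assms M.a_lcomm[of u v "\<ominus> u"] M.a_lcomm[of u v "\<ominus> u \<oplus> w"]
  by (simp_all add: M.r_neg M.r_neg1 M.r_neg2)

lemma submodule_add_cancel:
  assumes "submodule R U M" "u \<oplus> v \<in> U" "u \<in> U" "v \<in> carrier M"
  shows "v \<in> U"
proof -
  have u: "u \<in> carrier M" using assms submodule_carrier by blast
  have "(u \<oplus> v) \<ominus> u = v" using u assms(4)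
    by (simp add: a_minus_def M.a_ac add_minus_cancel)
  then show ?thesis using submodule_minus[OF assms(1,2,3)] by simp
qed

lemma submoduleI':
  assumes "U \<subseteq> carrier M" "\<zero> \<in> U" "\<And>u v. u \<in> U \<Longrightarrow> v \<in> U \<Longrightarrow> u \<oplus> v \<in> U"
    "\<And>p u. p \<in> carrier R \<Longrightarrow> u \<in> U \<Longrightarrow> p \<odot> u \<in> U"
  shows "submodule R U M"
  unfolding submodule_def using assms module_axioms by auto

lemma submodule_Int: "submodule R U M \<Longrightarrow> submodule R W M \<Longrightarrow> submodule R (U \<inter> W) M"
  by (rule submoduleI') (auto dest: submodule_carrier submodule_zero submodule_add submodule_smult)

lemma span_insert:
  assumes A: "finite A" "A \<subseteq> carrier M" "a \<in> carrier M" "a \<notin> A" and v: "v \<in> span (insert a A)"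
  shows "\<exists>p\<in>carrier R. \<exists>w\<in>span A. v = p \<odot> a \<oplus> w"
proof -
  obtain c where c: "c \<in> insert a A \<rightarrow> carrier R" "v = lincomb c (insert a A)"
    using v A finite_span[of "insert a A"] by auto
  have "v = c a \<odot> a \<oplus> lincomb c A"
    using lincomb_insert[of A c a] A c by auto
  moreover have "lincomb c A \<in> span A" using A c unfolding span_def by auto
  ultimately show ?thesis using c(1) by blast
qed

text \<open>Induction on the number of generators: a submodule of the span of \<open>insert a A\<close> is determined, within
  a chain, by its intersection with the span of \<open>A\<close> and by the ideal of the coefficients of \<open>a\<close>.\<close>

lemma submodules_stabilise_span:
  fixes U :: "nat \<Rightarrow> 'b set"
  assumes "finite A" "A \<subseteq> carrier M"
    and "\<And>i. submodule R (U i) M" "\<And>i. U i \<subseteq> span A" "\<And>i j. i \<le> j \<Longrightarrow> U i \<subseteq> U j"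
  shows "\<exists>N. \<forall>j\<ge>N. U j = U N"
  using assms
proof (induction A arbitrary: U)
  case empty
  have "span {} = {\<zero>}" unfolding span_def lincomb_def by auto
  then have "U i = {\<zero>}" for i using empty(2,3) submodule_zero by auto
  then show ?case by simp
next
  case (insert a A)
  have a: "a \<in> carrier M" and A: "A \<subseteq> carrier M" using insert.prems by auto
  have sA: "submodule R (span A) M" using A by (rule span_is_submodule)
  note sU = insert.prems(2)
  have "\<exists>N. \<forall>j\<ge>N. U j \<inter> span A = U N \<inter> span A"
  proof (rule insert.IH[OF A])
    show "submodule R (U i \<inter> span A) M" for i using sU sA by (rule submodule_Int)
    show "U i \<inter> span A \<subseteq> U j \<inter> span A" if "i \<le> j" for i j using insert.prems(4)[OF that] by blast
  qed simp
  then obtain N1 where N1: "\<And>j. j \<ge> N1 \<Longrightarrow> U j \<inter> span A = U N1 \<inter> span A" by blast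
  define I where "I i = {p \<in> carrier R. \<exists>w\<in>span A. p \<odot> a \<oplus> w \<in> U i}" for i
  have "\<exists>N. \<forall>j\<ge>N. I j = I N"
  proof (rule ideals_stabilise)
    fix i j
    show "I i \<subseteq> carrier R" by (auto simp: I_def)
    show "0 \<in> I i" using submodule_zero[OF sU] submodule_zero[OF sA] a
      by (auto simp: I_def smult_zero' intro!: bexI[of _ \<zero>])
    show "i \<le> j \<Longrightarrow> I i \<subseteq> I j" using insert.prems(4)[of i j] by (auto simp: I_def)
    fix p q
    {
      assume "p \<in> I i" "q \<in> I i"
      then obtain w w' where w: "p \<in> carrier R" "q \<in> carrier R" "w \<in> span A" "p \<odot> a \<oplus> w \<in> U i" "w' \<in> span A" "q \<odot> a \<oplus> w' \<in> U i"
        by (auto simp: I_def)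
      have wM: "w \<in> carrier M" "w' \<in> carrier M" using w submodule_carrier[OF sA] by auto
      have "(p + q) \<odot> a \<oplus> (w \<oplus> w') = (p \<odot> a \<oplus> w) \<oplus> (q \<odot> a \<oplus> w')"
        using w wM a by (simp add: smult_add_left M.a_ac)
      then have "(p + q) \<odot> a \<oplus> (w \<oplus> w') \<in> U i" using submodule_add[OF sU w(4,6)] by simp
      then show "p + q \<in> I i" using w submodule_add[OF sA w(3,5)] unfolding I_def by blast
    }
    {
      assume p: "p \<in> carrier R" and "q \<in> I i"
      then obtain w where w: "q \<in> carrier R" "w \<in> span A" "q \<odot> a \<oplus> w \<in> U i" by (auto simp: I_def)
      have wM: "w \<in> carrier M" using w submodule_carrier[OF sA] by auto
      have "(p * q) \<odot> a \<oplus> p \<odot> w = p \<odot> (q \<odot> a \<oplus> w)"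
        using p w wM a by (simp add: smult_mult smult_r_distr)
      then have "(p * q) \<odot> a \<oplus> p \<odot> w \<in> U i" using submodule_smult[OF sU p w(3)] by simp
      then show "p * q \<in> I i" using p w submodule_smult[OF sA p w(2)] unfolding I_def by blast
    }
  qed
  then obtain N2 where N2: "\<And>j. j \<ge> N2 \<Longrightarrow> I j = I N2" by blast
  define N where "N = max N1 N2"
  have "U j \<subseteq> U N" if j: "j \<ge> N" for j
  proof
    fix u assume u: "u \<in> U j"
    then have "u \<in> span (insert a A)" using insert.prems(3) by blast
    then obtain p w where pw: "p \<in> carrier R" "w \<in> span A" "u = p \<odot> a \<oplus> w"
      using span_insert[of A a u] insert.hyps a A by blast
    have "p \<in> I j" using pw u unfolding I_def by blast
    then have "p \<in> I N" using N2[of j] N2[of N] j by (simp add: N_def)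
    then obtain w' where w': "w' \<in> span A" "p \<odot> a \<oplus> w' \<in> U N" unfolding I_def by blast
    have wM: "w \<in> carrier M" "w' \<in> carrier M" using pw(2) w' submodule_carrier[OF sA] by auto
    have "w \<ominus> w' = u \<ominus> (p \<odot> a \<oplus> w')"
      using pw wM a by (simp add: a_minus_def M.minus_add M.a_ac add_minus_cancel M.r_neg)
    moreover have "u \<ominus> (p \<odot> a \<oplus> w') \<in> U j"
      using u w'(2) insert.prems(4)[OF j] by (intro submodule_minus[OF sU]) auto
    ultimately have "w \<ominus> w' \<in> U j \<inter> span A" using submodule_minus[OF sA pw(2) w'(1)] by simp
    then have "w \<ominus> w' \<in> U N" using N1[of j] N1[of N] j by (auto simp: N_def)
    then have "(p \<odot> a \<oplus> w') \<oplus> (w \<ominus> w') \<in> U N" by (intro submodule_add[OF sU w'(2)])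
    moreover have "(p \<odot> a \<oplus> w') \<oplus> (w \<ominus> w') = u"
      using pw wM a by (simp add: a_minus_def M.a_ac add_minus_cancel)
    ultimately show "u \<in> U N" by simp
  qed
  then show ?case using insert.prems(4) by blast
qed

end

section \<open>Zero divisors and linear regular sequences\<close>

context mpoly_module begin

definition nonzerodivisor_mod :: "'b set \<Rightarrow> 'a mpoly \<Rightarrow> bool" where
  "nonzerodivisor_mod U l \<longleftrightarrow> (\<forall>v\<in>carrier M. l \<odot> v \<in> U \<longrightarrow> v \<in> U)"

definition irreducible_submodule :: "'b set \<Rightarrow> bool" where
  "irreducible_submodule Q \<longleftrightarrow> submodule R Q M \<and>
     (\<forall>U W. submodule R U M \<longrightarrow> submodule R W M \<longrightarrow> Q = U \<inter> W \<longrightarrow> Q = U \<or> Q = W)"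

text \<open>The submodule \<open>U + f M\<close>. Working with the submodules \<open>(f\<^sub>1, \<dots>, f\<^sub>i) M\<close> of one fixed module avoids all
  quotient modules.\<close>

definition extend :: "'b set \<Rightarrow> 'a mpoly \<Rightarrow> 'b set" where
  "extend U f = {u \<oplus> f \<odot> v | u v. u \<in> U \<and> v \<in> carrier M}"

text \<open>A regular sequence relative to \<open>U\<close>, without the condition that the final quotient is nonzero.\<close>

fun weakly_regular :: "'b set \<Rightarrow> 'a mpoly list \<Rightarrow> bool" where
  "weakly_regular U [] = True"
| "weakly_regular U (f # fs) = (nonzerodivisor_mod U f \<and> weakly_regular (extend U f) fs)"

fun nonzerodivisor_along :: "'b set \<Rightarrow> 'a mpoly \<Rightarrow> 'a mpoly list \<Rightarrow> bool" where
  "nonzerodivisor_along U l [] = True"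
| "nonzerodivisor_along U l (f # fs) = (nonzerodivisor_mod U l \<and> nonzerodivisor_along (extend U f) l fs)"

lemma extend_submodule:
  assumes "submodule R U M" "f \<in> carrier R"
  shows "submodule R (extend U f) M"
proof (rule submoduleI')
  note U = submodule_carrier[OF assms(1)] submodule_zero[OF assms(1)] submodule_add[OF assms(1)] submodule_smult[OF assms(1)]
  show "extend U f \<subseteq> carrier M" using U assms(2) unfolding extend_def by auto
  have "\<zero> = \<zero> \<oplus> f \<odot> \<zero>" using assms(2) by simp
  then show "\<zero> \<in> extend U f" unfolding extend_def using U by blast
  fix x y assume "x \<in> extend U f" "y \<in> extend U f"
  then obtain u v u' v' where x: "x = u \<oplus> f \<odot> v" "u \<in> U" "v \<in> carrier M" and y: "y = u' \<oplus> f \<odot> v'" "u' \<in> U" "v' \<in> carrier M"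
    unfolding extend_def by blast
  have "x \<oplus> y = (u \<oplus> u') \<oplus> f \<odot> (v \<oplus> v')"
    using x y U(1) assms(2) by (simp add: smult_r_distr M.a_ac)
  then show "x \<oplus> y \<in> extend U f" unfolding extend_def using x y U(3) by blast
next
  note U = submodule_carrier[OF assms(1)] submodule_zero[OF assms(1)] submodule_add[OF assms(1)] submodule_smult[OF assms(1)]
  fix p x assume p: "p \<in> carrier R" and "x \<in> extend U f"
  then obtain u v where x: "x = u \<oplus> f \<odot> v" "u \<in> U" "v \<in> carrier M"
    unfolding extend_def by blast
  have "p \<odot> x = p \<odot> u \<oplus> f \<odot> (p \<odot> v)"
    using x p U(1) assms(2) smult_commute[of p f v] by (simp add: smult_r_distr)
  then show "p \<odot> x \<in> extend U f" unfolding extend_def using x p U(4) by blast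
qed

lemma extend_commute:
  assumes "submodule R U M" "f \<in> carrier R" "g \<in> carrier R"
  shows "extend (extend U f) g = extend (extend U g) f"
proof -
  have "extend (extend U f) g \<subseteq> extend (extend U g) f" if "f \<in> carrier R" "g \<in> carrier R" for f g
  proof
    fix x assume "x \<in> extend (extend U f) g"
    then obtain u v w where x: "x = (u \<oplus> f \<odot> v) \<oplus> g \<odot> w" "u \<in> U" "v \<in> carrier M" "w \<in> carrier M"
      unfolding extend_def by blast
    then have "x = (u \<oplus> g \<odot> w) \<oplus> f \<odot> v"
      using submodule_carrier[OF assms(1)] that by (simp add: M.a_ac)
    then show "x \<in> extend (extend U g) f" unfolding extend_def using x by blast
  qed
  then show ?thesis using assms by blast
qed

lemma subset_extend:
  assumes "submodule R U M" "f \<in> carrier R"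
  shows "U \<subseteq> extend U f"
proof
  fix u assume u: "u \<in> U"
  have "u = u \<oplus> f \<odot> \<zero>" using u submodule_carrier[OF assms(1)] assms(2) by simp
  then show "u \<in> extend U f" unfolding extend_def using u by blast
qed

lemma smult_in_extend:
  assumes "submodule R U M" "f \<in> carrier R" "v \<in> carrier M"
  shows "f \<odot> v \<in> extend U f"
proof -
  have "f \<odot> v = \<zero> \<oplus> f \<odot> v" using assms by simp
  then show ?thesis unfolding extend_def using submodule_zero[OF assms(1)] assms(3) by blast
qed

text \<open>The classical swap of two neighbours of a regular sequence: from \<open>f v \<in> U + l M\<close> one finds
  \<open>w'\<close> with \<open>f (v - l w') \<in> U\<close>.\<close>

lemma nonzerodivisor_exchange:
  assumes U: "submodule R U M" and f: "f \<in> carrier R" and l: "l \<in> carrier R"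
    and fU: "nonzerodivisor_mod U f" and lf: "nonzerodivisor_mod (extend U f) l"
  shows "nonzerodivisor_mod (extend U l) f"
  unfolding nonzerodivisor_mod_def
proof (intro ballI impI)
  fix v assume v: "v \<in> carrier M" "f \<odot> v \<in> extend U l"
  then obtain u w where u: "u \<in> U" and w: "w \<in> carrier M" and fv: "f \<odot> v = u \<oplus> l \<odot> w"
    unfolding extend_def by blast
  have uM: "u \<in> carrier M" using u U submodule_carrier by blast
  have "u \<oplus> l \<odot> w \<in> extend U f" unfolding fv[symmetric] using U f v(1) by (rule smult_in_extend)
  then have "l \<odot> w \<in> extend U f"
    using submodule_add_cancel[OF extend_submodule[OF U f]] subset_extend[OF U f] u w l by blast
  then have "w \<in> extend U f" using lf w unfolding nonzerodivisor_mod_def by blast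
  then obtain u' w' where u': "u' \<in> U" and w': "w' \<in> carrier M" and w_eq: "w = u' \<oplus> f \<odot> w'"
    unfolding extend_def by blast
  have u'M: "u' \<in> carrier M" using u' U submodule_carrier by blast
  have "f \<odot> v = (u \<oplus> l \<odot> u') \<oplus> f \<odot> (l \<odot> w')"
    unfolding fv w_eq using uM u'M w' f l smult_commute[of l f w']
    by (simp add: smult_r_distr M.a_assoc)
  then have "f \<odot> (v \<ominus> l \<odot> w') = u \<oplus> l \<odot> u'"
    using v(1) w' f l uM u'M by (simp add: a_minus_def smult_r_distr smult_r_minus M.a_assoc M.r_neg)
  also have "\<dots> \<in> U" using u u' l U by (intro submodule_add[OF U] submodule_smult[OF U])
  finally have "v \<ominus> l \<odot> w' \<in> U" using fU v(1) w' l unfolding nonzerodivisor_mod_def by simp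
  moreover have "v = (v \<ominus> l \<odot> w') \<oplus> l \<odot> w'"
    using v(1) w' l by (simp add: a_minus_def M.a_assoc M.l_neg)
  ultimately show "v \<in> extend U l" unfolding extend_def using w' by blast
qed

text \<open>If \<open>l\<close> is a nonzerodivisor modulo all the submodules that the sequence runs through, then it can replace the last entry, and repeated
  swaps move it from there to the front.\<close>

lemma weakly_regular_exchange:
  assumes "submodule R U M" "l \<in> carrier R" "set fs \<subseteq> carrier R" "f \<in> carrier R"
    and "weakly_regular U (fs @ [f])" "nonzerodivisor_along U l (fs @ [f])"
  shows "weakly_regular (extend U l) fs"
  using assms
proof (induction fs arbitrary: U)
  case (Cons g fs)
  have g: "g \<in> carrier R" using Cons.prems by simp
  have sub: "submodule R (extend U g) M" using Cons.prems(1) g by (rule extend_submodule)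
  have reg: "nonzerodivisor_mod U g" "weakly_regular (extend U g) (fs @ [f])"
    and along: "nonzerodivisor_along (extend U g) l (fs @ [f])"
    using Cons.prems(5,6) by simp_all
  have "nonzerodivisor_mod (extend U g) l" using along by (cases fs) simp_all
  then have "nonzerodivisor_mod (extend U l) g"
    by (rule nonzerodivisor_exchange[OF Cons.prems(1) g Cons.prems(2) reg(1)])
  moreover have "weakly_regular (extend (extend U g) l) fs"
    using Cons.prems(3) by (intro Cons.IH[OF sub Cons.prems(2) _ Cons.prems(4) reg(2) along]) simp
  ultimately show ?case using extend_commute[OF Cons.prems(1) g Cons.prems(2)] by simp
qed simp

lemma smult_power_Suc: "l \<in> carrier R \<Longrightarrow> v \<in> carrier M \<Longrightarrow> l ^ Suc k \<odot> v = l \<odot> (l ^ k \<odot> v)"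
  and power_in_carrier: "l \<in> carrier R \<Longrightarrow> l ^ k \<in> carrier R"
proof -
  show *: "l ^ k \<in> carrier R" if "l \<in> carrier R" for l and k
    using that by (induction k) auto
  show "l \<in> carrier R \<Longrightarrow> v \<in> carrier M \<Longrightarrow> l ^ Suc k \<odot> v = l \<odot> (l ^ k \<odot> v)"
    using smult_mult[of l "l ^ k" v] * by simp
qed

lemma last_power_outside:
  assumes "l \<in> carrier R" "w \<in> carrier M" "w \<notin> Q" "l ^ k \<odot> w \<in> Q"
  shows "\<exists>j. l ^ j \<odot> w \<notin> Q \<and> l \<odot> (l ^ j \<odot> w) \<in> Q"
proof (rule ccontr)
  assume contr: "\<not> ?thesis"
  have "l ^ j \<odot> w \<notin> Q" for j
  proof (induction j)
    case 0
    then show ?case using assms(2,3) by (simp add: smult_one')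
  next
    case (Suc j)
    then show ?case using contr unfolding smult_power_Suc[OF assms(1,2)] by blast
  qed
  then show False using assms(4) by blast
qed

text \<open>Multiply a witness for \<open>l\<close> by the last power of \<open>l'\<close> that does not send it into \<open>Q\<close>; the result is
  a common witness for \<open>l\<close> and \<open>l'\<close>.\<close>

lemma nonzerodivisor_add:
  assumes Q: "submodule R Q M" and l: "l \<in> carrier R" "l' \<in> carrier R"
    and zd: "\<not> nonzerodivisor_mod Q l" and nilp: "\<And>v. v \<in> carrier M \<Longrightarrow> l' ^ k \<odot> v \<in> Q"
  shows "\<not> nonzerodivisor_mod Q (l + l')"
proof -
  obtain v where v: "v \<in> carrier M" "v \<notin> Q" "l \<odot> v \<in> Q"
    using zd unfolding nonzerodivisor_mod_def by blast
  obtain j where j: "l' ^ j \<odot> v \<notin> Q" "l' \<odot> (l' ^ j \<odot> v) \<in> Q"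
    using last_power_outside[OF l(2) v(1,2) nilp[OF v(1)]] by blast
  define w where "w = l' ^ j \<odot> v"
  have w: "w \<in> carrier M" using v l power_in_carrier by (simp add: w_def)
  have "l \<odot> w = l' ^ j \<odot> (l \<odot> v)"
    unfolding w_def using l v power_in_carrier by (intro smult_commute) auto
  then have "l \<odot> w \<in> Q" using submodule_smult[OF Q] v l power_in_carrier by simp
  then have "(l + l') \<odot> w \<in> Q"
    using j l w submodule_add[OF Q] by (simp add: smult_add_left w_def)
  then show ?thesis using j w unfolding nonzerodivisor_mod_def w_def by blast
qed

lemma max_ideal_smult:
  assumes U: "submodule R U M" and v: "v \<in> carrier M" and x: "\<And>i. i < n \<Longrightarrow> mvar i \<odot> v \<in> U"
    and f: "f \<in> max_ideal n"
  shows "f \<odot> v \<in> U"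
proof -
  define J where "J = {p \<in> carrier R. p \<odot> v \<in> U}"
  have "ideal J R"
  proof (rule idealI)
    show "Ring.ring R" using R.ring_axioms .
    show "subgroup J (add_monoid R)"
    proof (rule R.add.subgroupI)
      fix p q assume "p \<in> J" "q \<in> J"
      then show "p \<oplus>\<^bsub>R\<^esub> q \<in> J" 
        using v submodule_add[OF U] by (auto simp: J_def add_mpoly_ring smult_add_left)
    next
      fix p assume p: "p \<in> J"
      then have "\<ominus>\<^bsub>R\<^esub> p \<odot> v = \<ominus> (p \<odot> v)" using v by (simp add: J_def smult_l_minus)
      also have "\<dots> = \<zero> \<ominus> p \<odot> v" using p v by (simp add: J_def a_minus_def)
      also have "\<dots> \<in> U" using p submodule_zero[OF U] by (intro submodule_minus[OF U]) (auto simp: J_def)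
      finally show "\<ominus>\<^bsub>R\<^esub> p \<in> J" using p by (simp add: J_def)
    next
      have "0 \<in> J" using v submodule_zero[OF U] by (simp add: J_def smult_zero')
      then show "J \<noteq> {}" by blast
    qed (auto simp: J_def)
    fix p q assume pq: "p \<in> J" "q \<in> carrier R"
    then have "(q * p) \<odot> v \<in> U"
      using v submodule_smult[OF U] by (simp add: J_def smult_mult)
    then show "q \<otimes>\<^bsub>R\<^esub> p \<in> J" "p \<otimes>\<^bsub>R\<^esub> q \<in> J"
      using pq by (simp_all add: J_def mult_mpoly_ring mult.commute)
  qed
  moreover have "mvar ` {..<n} \<subseteq> J" using x by (auto simp: J_def)
  ultimately have "max_ideal n \<subseteq> J" unfolding max_ideal_def by (rule R.genideal_minimal)
  then show ?thesis using f by (auto simp: J_def)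
qed

lemma max_ideal_carrier: "max_ideal n \<subseteq> carrier R"
  unfolding max_ideal_def by (rule R.genideal_minimal[OF R.oneideal]) auto

end

text \<open>Missing a variable makes \<open>Z\<close> meet the linear forms in a proper subspace. The empty set is admitted as
  well, which does no harm because these sets only have to be avoided.\<close>

definition proper_subspace :: "nat \<Rightarrow> 'a::field mpoly set \<Rightarrow> bool" where
  "proper_subspace n Z \<longleftrightarrow> (\<forall>p\<in>Z. \<forall>q\<in>Z. p + q \<in> Z) \<and> (\<forall>c. \<forall>p\<in>Z. mconst c * p \<in> Z) \<and> (\<exists>i<n. mvar i \<notin> Z)"

lemma mconst_mult: "mconst (a * b) = mconst a * mconst b" "mconst (a + b) = mconst a + mconst b"
    "mconst 1 = 1" "mconst 0 = 0" "mconst (- a) = - mconst a" "mconst (a - b) = mconst a - mconst b"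
  by (simp_all add: mconst_def mult_single single_add single_uminus single_diff)

lemma linear_forms_closed:
  fixes p q :: "'a::field mpoly"
  shows "p \<in> mpoly_homog n d \<Longrightarrow> q \<in> mpoly_homog n d \<Longrightarrow> p + q \<in> mpoly_homog n d"
    and "p \<in> mpoly_homog n d \<Longrightarrow> mconst c * p \<in> mpoly_homog n d"
    and "i < n \<Longrightarrow> mvar i \<in> mpoly_homog n 1"
    and "0 \<in> mpoly_homog n d"
proof -
  show "p \<in> mpoly_homog n d \<Longrightarrow> q \<in> mpoly_homog n d \<Longrightarrow> p + q \<in> mpoly_homog n d"
    using Poly_Mapping.keys_add[of p q] by (auto simp: mpoly_homog_def)
  have "Poly_Mapping.keys (mconst c * p) \<subseteq> Poly_Mapping.keys p"
    using keys_mult[of "mconst c" p] by (auto simp: mconst_def split: if_splits)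
  then show "p \<in> mpoly_homog n d \<Longrightarrow> mconst c * p \<in> mpoly_homog n d"
    by (auto simp: mpoly_homog_def)
  show "i < n \<Longrightarrow> mvar i \<in> mpoly_homog n 1"
    unfolding mpoly_homog_def by (auto simp: mvar_def mdeg_def)
  show "0 \<in> mpoly_homog n d" by (simp add: mpoly_homog_def)
qed

text \<open>Let \<open>v\<close> avoid all the old subspaces and let the variable \<open>u\<close> lie outside the new one. Every one of the
  subspaces contains \<open>v + a u\<close> for at most one scalar \<open>a\<close>.\<close>

lemma linear_form_avoiding_proper_subspaces:
  assumes K: "infinite (UNIV :: 'a::field set)" and "finite \<Z>"
    and "\<And>Z. Z \<in> \<Z> \<Longrightarrow> proper_subspace n (Z :: 'a mpoly set)"
  shows "\<exists>l\<in>mpoly_homog n 1. \<forall>Z\<in>\<Z>. l \<notin> Z"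
  using assms(2,3)
proof (induction \<Z>)
  case empty
  show ?case using linear_forms_closed(4) by blast
next
  case (insert Z \<Z>)
  then obtain v where v: "v \<in> mpoly_homog n 1" "\<And>Z. Z \<in> \<Z> \<Longrightarrow> v \<notin> Z" by auto
  obtain i where i: "i < n" "mvar i \<notin> Z"
    using insert.prems[of Z] unfolding proper_subspace_def by blast
  define u :: "'a mpoly" where "u = mvar i"
  have one: "a = b" if Y: "Y \<in> insert Z \<Z>" and ab: "v + mconst a * u \<in> Y" "v + mconst b * u \<in> Y" for Y a b
  proof (rule ccontr)
    assume neq: "a \<noteq> b"
    have Y': "\<And>p q. p \<in> Y \<Longrightarrow> q \<in> Y \<Longrightarrow> p + q \<in> Y" "\<And>c p. p \<in> Y \<Longrightarrow> mconst c * p \<in> Y"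
      using insert.prems[OF Y] unfolding proper_subspace_def by auto
    have "mconst (1 / (a - b)) * ((v + mconst a * u) + mconst (- 1) * (v + mconst b * u)) \<in> Y"
      by (rule Y'(2)[OF Y'(1)[OF ab(1) Y'(2)[OF ab(2)]]])
    also have "(v + mconst a * u) + mconst (- 1) * (v + mconst b * u) = mconst (a - b) * u"
      by (simp add: mconst_mult algebra_simps)
    also have "mconst (1 / (a - b)) * (mconst (a - b) * u) = u"
      using neq by (simp only: mult.assoc[symmetric] mconst_mult(1)[symmetric]) (simp add: mconst_mult(3))
    finally have u: "u \<in> Y" .
    have "(v + mconst a * u) + mconst (- a) * u \<in> Y" by (rule Y'(1)[OF ab(1) Y'(2)[OF u]])
    then have "v \<in> Y" by (simp add: mconst_mult)
    then show False using Y u v(2) i(2) unfolding u_def by blast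
  qed
  have "finite {a. v + mconst a * u \<in> Y}" if "Y \<in> insert Z \<Z>" for Y
  proof (cases "{a. v + mconst a * u \<in> Y} = {}")
    case False
    then obtain a where "v + mconst a * u \<in> Y" by blast
    then have "{a. v + mconst a * u \<in> Y} \<subseteq> {a}" using one[OF that] by blast
    then show ?thesis using finite_subset by blast
  qed (simp only: finite.emptyI)
  then have "finite (\<Union>Y\<in>insert Z \<Z>. {a. v + mconst a * u \<in> Y})" using insert.hyps(1) by blast
  then obtain a where "a \<notin> (\<Union>Y\<in>insert Z \<Z>. {a. v + mconst a * u \<in> Y})"
    using K ex_new_if_finite by blast
  moreover have "v + mconst a * u \<in> mpoly_homog n 1"
    unfolding u_def using v(1) i(1) by (intro linear_forms_closed)
  ultimately show ?case by blast
qed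

locale fg_mpoly_module = mpoly_module n M
  for n :: nat and M :: "('a::field mpoly, 'b, 'c) module_scheme" (structure) +
  assumes fg: "\<exists>A. finite A \<and> A \<subseteq> carrier M \<and> span A = carrier M"
begin

lemma submodules_stabilise:
  assumes "\<And>i. submodule R (U i) M" "\<And>i j. i \<le> j \<Longrightarrow> U i \<subseteq> U j"
  shows "\<exists>N. \<forall>j\<ge>N. U j = U (N :: nat)"
proof -
  obtain A where A: "finite A" "A \<subseteq> carrier M" "span A = carrier M" using fg by blast
  show ?thesis
  proof (rule submodules_stabilise_span[OF A(1,2) assms(1)])
    show "U i \<subseteq> span A" for i unfolding A(3) using submodule_carrier[OF assms(1)] by blast
  qed (rule assms(2))
qed

lemma noetherian_induct [consumes 1, case_names step]:
  assumes "submodule R U M"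
    and step: "\<And>U. submodule R U M \<Longrightarrow> (\<And>W. submodule R W M \<Longrightarrow> U \<subset> W \<Longrightarrow> P W) \<Longrightarrow> P U"
  shows "P U"
proof -
  have "wf {(W, U). submodule R W M \<and> submodule R U M \<and> U \<subset> W}"
    unfolding wf_iff_no_infinite_down_chain
  proof (intro allI notI, elim exE)
    fix s assume s: "\<forall>i. (s (Suc i), s i) \<in> {(W, U). submodule R W M \<and> submodule R U M \<and> U \<subset> W}"
    have sub: "submodule R (s i) M" and less: "s i \<subset> s (Suc i)" for i
      using spec[OF s, of i] by simp_all
    have "\<exists>N. \<forall>j\<ge>N. s j = s N"
    proof (rule submodules_stabilise[OF sub])
      show "s i \<subseteq> s j" if "i \<le> j" for i j
        using psubset_imp_subset[OF less] that by (rule lift_Suc_mono_le)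
    qed
    then obtain N where N: "\<forall>j\<ge>N. s j = s N" by blast
    have "s (Suc N) = s N" using spec[OF N, of "Suc N"] by simp
    then show False using less[of N] by simp
  qed
  then show ?thesis using assms(1)
  proof (induction U rule: wf_induct_rule)
    case (less U)
    show ?case
    proof (rule step[OF less.prems])
      fix W assume "submodule R W M" "U \<subset> W"
      then show "P W" using less.prems by (intro less.IH) simp_all
    qed
  qed
qed

lemma irreducible_decomposition:
  assumes "submodule R U M"
  shows "\<exists>\<Q>. finite \<Q> \<and> (\<forall>Q\<in>\<Q>. irreducible_submodule Q) \<and> U = carrier M \<inter> \<Inter>\<Q>"
  using assms
proof (induction U rule: noetherian_induct)
  case (step U)
  have sub: "U \<subseteq> carrier M" using step.hyps submodule_carrier by blast
  show ?case
  proof (cases "irreducible_submodule U")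
    case True
    then show ?thesis using sub by (intro exI[of _ "{U}"]) auto
  next
    case False
    then obtain V W where VW: "submodule R V M" "submodule R W M" "U = V \<inter> W" "U \<noteq> V" "U \<noteq> W"
      using step.hyps unfolding irreducible_submodule_def by blast
    have "U \<subset> V" "U \<subset> W" using VW(3-5) by auto
    from step.IH[OF VW(1) this(1)] step.IH[OF VW(2) this(2)]
    obtain \<V> \<W> where "finite \<V>" "finite \<W>" "\<forall>Q\<in>\<V> \<union> \<W>. irreducible_submodule Q"
        "V = carrier M \<inter> \<Inter>\<V>" "W = carrier M \<inter> \<Inter>\<W>" by blast
    then show ?thesis using VW(3) by (intro exI[of _ "\<V> \<union> \<W>"]) auto
  qed
qed

text \<open>A decomposition with the fewest members is irredundant.\<close>

lemma irredundant_decomposition: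
  assumes "submodule R U M"
  shows "\<exists>\<Q>. finite \<Q> \<and> (\<forall>Q\<in>\<Q>. irreducible_submodule Q) \<and> U = carrier M \<inter> \<Inter>\<Q> \<and>
    (\<forall>Q\<in>\<Q>. \<exists>w\<in>carrier M. w \<notin> Q \<and> (\<forall>Q'\<in>\<Q> - {Q}. w \<in> Q'))"
proof -
  define P where "P \<Q> \<longleftrightarrow> finite \<Q> \<and> (\<forall>Q\<in>\<Q>. irreducible_submodule Q) \<and> U = carrier M \<inter> \<Inter>\<Q>" for \<Q>
  obtain \<Q>0 where "P \<Q>0" using irreducible_decomposition[OF assms] unfolding P_def by blast
  from ex_has_least_nat[of P, OF this, of card]
  obtain \<Q> where Q: "P \<Q>" "\<And>\<Q>'. P \<Q>' \<Longrightarrow> card \<Q> \<le> card \<Q>'" by blast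
  have "\<exists>w\<in>carrier M. w \<notin> Q \<and> (\<forall>Q'\<in>\<Q> - {Q}. w \<in> Q')" if "Q \<in> \<Q>" for Q
  proof (rule ccontr)
    assume "\<not> ?thesis"
    then have "carrier M \<inter> \<Inter>(\<Q> - {Q}) \<subseteq> Q" by blast
    then have "carrier M \<inter> \<Inter>(\<Q> - {Q}) = carrier M \<inter> \<Inter>\<Q>" by blast
    then have "P (\<Q> - {Q})" using Q(1) unfolding P_def by simp
    moreover have "card (\<Q> - {Q}) < card \<Q>" using that Q(1) unfolding P_def by (intro card_Diff1_less) simp_all
    ultimately show False using Q(2) by fastforce
  qed
  then show ?thesis using Q(1) unfolding P_def by blast
qed

text \<open>Fitting's argument: once the chain of the submodules \<open>{v. l\<^sup>k v \<in> Q}\<close> has become stationary at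
  \<open>k\<close>, the submodule \<open>Q\<close> is the intersection of \<open>{v. l v \<in> Q}\<close> and \<open>Q + l\<^sup>k M\<close>, so it equals one of the two.\<close>

lemma irreducible_nonzerodivisor_or_nilpotent:
  assumes irr: "irreducible_submodule Q" and l: "l \<in> carrier R"
  shows "nonzerodivisor_mod Q l \<or> (\<exists>k. \<forall>v\<in>carrier M. l ^ k \<odot> v \<in> Q)"
proof -
  have Q: "submodule R Q M" using irr unfolding irreducible_submodule_def by blast
  note lk = power_in_carrier[OF l]
  define U where "U k = {v \<in> carrier M. l ^ k \<odot> v \<in> Q}" for k
  have subU: "submodule R (U k) M" for k
    by (rule submoduleI') (use lk submodule_zero[OF Q] submodule_add[OF Q] submodule_smult[OF Q] in
        \<open>auto simp: U_def smult_r_distr smult_commute[of "l ^ k"]\<close>)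
  have "U k \<subseteq> U (Suc k)" for k
  proof
    fix v assume "v \<in> U k"
    then have v: "v \<in> carrier M" "l ^ k \<odot> v \<in> Q" by (simp_all add: U_def)
    then have "l ^ Suc k \<odot> v \<in> Q"
      unfolding smult_power_Suc[OF l v(1)] by (intro submodule_smult[OF Q l])
    then show "v \<in> U (Suc k)" using v(1) unfolding U_def by blast
  qed
  then have mono: "U i \<subseteq> U j" if "i \<le> j" for i j using that by (rule lift_Suc_mono_le)
  obtain k where k: "\<forall>j\<ge>k. U j = U k" using submodules_stabilise[of U, OF subU mono] by blast
  have "Q = U 1 \<inter> extend Q (l ^ k)"
  proof (rule equalityI; rule subsetI)
    fix x assume x: "x \<in> Q"
    then show "x \<in> U 1 \<inter> extend Q (l ^ k)"
      using submodule_carrier[OF Q] submodule_smult[OF Q l] subset_extend[OF Q lk] by (auto simp: U_def)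
  next
    fix x assume "x \<in> U 1 \<inter> extend Q (l ^ k)"
    then obtain q v where x: "x = q \<oplus> l ^ k \<odot> v" "q \<in> Q" "v \<in> carrier M" "l \<odot> x \<in> Q"
      unfolding extend_def U_def by auto
    have qM: "q \<in> carrier M" using x Q submodule_carrier by blast
    have "l \<odot> x = l \<odot> q \<oplus> l ^ Suc k \<odot> v"
      unfolding smult_power_Suc[OF l x(3)] x(1) using x(3) qM l lk by (simp add: smult_r_distr)
    then have "l ^ Suc k \<odot> v \<in> Q"
      using submodule_add_cancel[OF Q _ submodule_smult[OF Q l x(2)] smult_closed[OF lk x(3)]] x(4) by metis
    then have "v \<in> U (Suc k)" using x(3) unfolding U_def by blast
    then have "v \<in> U k" using spec[OF k, of "Suc k"] by simp
    then show "x \<in> Q" using x submodule_add[OF Q] by (simp add: U_def)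
  qed
  then consider "Q = U 1" | "Q = extend Q (l ^ k)"
    using irr subU[of 1] extend_submodule[OF Q lk[of k]] unfolding irreducible_submodule_def by blast
  then show ?thesis
  proof cases
    case 1
    then show ?thesis unfolding nonzerodivisor_mod_def U_def by auto
  next
    case 2
    then show ?thesis using smult_in_extend[OF Q lk] by blast
  qed
qed

text \<open>One subspace for each member \<open>Q\<close> of an irredundant decomposition of \<open>U\<close>. Suppose that it contained all the
  variables. Start with an element that lies in all the other members but not in \<open>Q\<close>, and multiply it for each
  variable by the last power that keeps it outside \<open>Q\<close>. The final element is outside \<open>U\<close>, but all the
  variables send it into \<open>U\<close>.\<close>

lemma zero_divisors_covered:
  assumes U: "submodule R U M"
    and no_socle: "\<And>v. v \<in> carrier M \<Longrightarrow> (\<And>i. i < n \<Longrightarrow> mvar i \<odot> v \<in> U) \<Longrightarrow> v \<in> U"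
  shows "\<exists>\<Z>. finite \<Z> \<and> (\<forall>Z\<in>\<Z>. proper_subspace n Z) \<and>
    (\<forall>l\<in>carrier R. (\<forall>Z\<in>\<Z>. l \<notin> Z) \<longrightarrow> nonzerodivisor_mod U l)"
proof -
  obtain \<Q> where Q: "finite \<Q>" "\<And>Q. Q \<in> \<Q> \<Longrightarrow> irreducible_submodule Q" "U = carrier M \<inter> \<Inter>\<Q>"
    and irred: "\<And>Q. Q \<in> \<Q> \<Longrightarrow> \<exists>w\<in>carrier M. w \<notin> Q \<and> (\<forall>Q'\<in>\<Q> - {Q}. w \<in> Q')"
    using irredundant_decomposition[OF U] by blast
  have subQ: "submodule R Q M" if "Q \<in> \<Q>" for Q using Q(2)[OF that] unfolding irreducible_submodule_def by blast
  define Z where "Z Q = {l \<in> carrier R. \<not> nonzerodivisor_mod Q l}" for Q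
  have "proper_subspace n (Z Q)" if QQ: "Q \<in> \<Q>" for Q
    unfolding proper_subspace_def
  proof (intro conjI ballI allI)
    fix p q assume "p \<in> Z Q" "q \<in> Z Q"
    then have pq: "p \<in> carrier R" "q \<in> carrier R" "\<not> nonzerodivisor_mod Q p" "\<not> nonzerodivisor_mod Q q"
      by (simp_all add: Z_def)
    obtain k where "\<forall>v\<in>carrier M. q ^ k \<odot> v \<in> Q"
      using irreducible_nonzerodivisor_or_nilpotent[OF Q(2)[OF QQ] pq(2)] pq(4) by blast
    then have "\<not> nonzerodivisor_mod Q (p + q)"
      using nonzerodivisor_add[OF subQ[OF QQ] pq(1-3)] by blast
    then show "p + q \<in> Z Q" using pq by (simp add: Z_def)
  next
    fix c p assume "p \<in> Z Q"
    then obtain v where v: "p \<in> carrier R" "v \<in> carrier M" "v \<notin> Q" "p \<odot> v \<in> Q"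
      unfolding Z_def nonzerodivisor_mod_def by blast
    then have "(mconst c * p) \<odot> v \<in> Q"
      using submodule_smult[OF subQ[OF QQ] mconst_in_carrier] by (simp add: smult_mult)
    then have "\<not> nonzerodivisor_mod Q (mconst c * p)"
      using v(2,3) unfolding nonzerodivisor_mod_def by blast
    then show "mconst c * p \<in> Z Q" using v(1) by (simp add: Z_def)
  next
    obtain w where w: "w \<in> carrier M" "w \<notin> Q" "\<And>Q'. Q' \<in> \<Q> - {Q} \<Longrightarrow> w \<in> Q'" using irred[OF QQ] by blast
    show "\<exists>i<n. mvar i \<notin> Z Q"
    proof (rule ccontr)
      assume "\<not> ?thesis"
      then have zd: "\<not> nonzerodivisor_mod Q (mvar i)" if "i < n" for i
        using that by (auto simp: Z_def)
      have nilp: "\<exists>k. \<forall>v\<in>carrier M. mvar i ^ k \<odot> v \<in> Q" if "i < n" for i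
        using irreducible_nonzerodivisor_or_nilpotent[OF Q(2)[OF QQ] mvar_in_carrier[OF that]] zd[OF that]
        by blast
      \<comment> \<open>The element lies in all members of the decomposition except \<open>Q\<close>, and the first \<open>i\<close> variables are dealt with.\<close>
      define good where "good i w \<longleftrightarrow> w \<in> carrier M \<and> w \<notin> Q \<and> (\<forall>Q'\<in>\<Q> - {Q}. w \<in> Q') \<and>
        (\<forall>j<i. mvar j \<odot> w \<in> Q)" for i w
      have "\<exists>w. good i w" if "i \<le> n" for i
        using that
      proof (induction i)
        case 0
        have "good 0 w" using w unfolding good_def by blast
        then show ?case by blast
      next
        case (Suc i)
        then obtain u where u: "u \<in> carrier M" "u \<notin> Q" "\<And>Q'. Q' \<in> \<Q> - {Q} \<Longrightarrow> u \<in> Q'" "\<And>j. j < i \<Longrightarrow> mvar j \<odot> u \<in> Q"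
          unfolding good_def using Suc_leD by blast
        have i: "i < n" using Suc.prems by simp
        note iR = mvar_in_carrier[OF i]
        obtain m where "\<forall>v\<in>carrier M. mvar i ^ m \<odot> v \<in> Q" using nilp[OF i] by blast
        then have "mvar i ^ m \<odot> u \<in> Q" using u(1) by blast
        then obtain k where k: "mvar i ^ k \<odot> u \<notin> Q" "mvar i \<odot> (mvar i ^ k \<odot> u) \<in> Q"
          using last_power_outside[OF iR u(1,2)] by blast
        note ik = power_in_carrier[OF iR, of k]
        have "mvar j \<odot> (mvar i ^ k \<odot> u) \<in> Q" if "j < Suc i" for j
        proof (cases "j = i")
          case False
          then have j: "j < i" using that by simp
          then have "mvar j \<odot> (mvar i ^ k \<odot> u) = mvar i ^ k \<odot> (mvar j \<odot> u)"
            using i by (intro smult_commute mvar_in_carrier ik u(1)) simp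
          then show ?thesis using submodule_smult[OF subQ[OF QQ] ik u(4)[OF j]] by simp
        qed (simp only: k)
        moreover have "mvar i ^ k \<odot> u \<in> Q'" if "Q' \<in> \<Q> - {Q}" for Q'
          using submodule_smult[OF subQ ik u(3)] that by blast
        moreover have "mvar i ^ k \<odot> u \<in> carrier M" using smult_closed[OF ik u(1)] .
        ultimately have "good (Suc i) (mvar i ^ k \<odot> u)" using k(1) unfolding good_def by blast
        then show ?case by blast
      qed
      then obtain u where "good n u" by blast
      then have u: "u \<in> carrier M" "u \<notin> Q" "\<And>Q'. Q' \<in> \<Q> - {Q} \<Longrightarrow> u \<in> Q'" "\<And>j. j < n \<Longrightarrow> mvar j \<odot> u \<in> Q"
        unfolding good_def by blast+
      have "mvar j \<odot> u \<in> U" if j: "j < n" for j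
      proof -
        have "mvar j \<odot> u \<in> Q'" if "Q' \<in> \<Q>" for Q'
          using u(4)[OF j] submodule_smult[OF subQ mvar_in_carrier[OF j] u(3)] that by (cases "Q' = Q") blast+
        then show ?thesis unfolding Q(3) using smult_closed[OF mvar_in_carrier[OF j] u(1)] by blast
      qed
      then have "u \<in> U" by (rule no_socle[OF u(1)])
      then show False using u(2) QQ unfolding Q(3) by blast
    qed
  qed
  moreover have "nonzerodivisor_mod U l" if "l \<in> carrier R" "\<forall>Y\<in>Z ` \<Q>. l \<notin> Y" for l
  proof -
    have "nonzerodivisor_mod Q l" if "Q \<in> \<Q>" for Q
      using that \<open>l \<in> carrier R\<close> \<open>\<forall>Y\<in>Z ` \<Q>. l \<notin> Y\<close> by (simp add: Z_def)
    then show ?thesis unfolding nonzerodivisor_mod_def Q(3) by blast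
  qed
  ultimately show ?thesis using Q(1) by (intro exI[of _ "Z ` \<Q>"]) blast
qed

lemma zero_divisors_along_covered:
  assumes "submodule R U M" "set fs \<subseteq> max_ideal n" "weakly_regular U fs"
  shows "\<exists>\<Z>. finite \<Z> \<and> (\<forall>Z\<in>\<Z>. proper_subspace n Z) \<and>
    (\<forall>l\<in>carrier R. (\<forall>Z\<in>\<Z>. l \<notin> Z) \<longrightarrow> nonzerodivisor_along U l fs)"
  using assms
proof (induction fs arbitrary: U)
  case Nil
  show ?case by (intro exI[of _ "{}"]) simp
next
  case (Cons f fs)
  have f: "f \<in> carrier R" using Cons.prems(2) max_ideal_carrier by auto
  have "\<exists>\<Z>. finite \<Z> \<and> (\<forall>Z\<in>\<Z>. proper_subspace n Z) \<and>
    (\<forall>l\<in>carrier R. (\<forall>Z\<in>\<Z>. l \<notin> Z) \<longrightarrow> nonzerodivisor_mod U l)"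
  proof (rule zero_divisors_covered[OF Cons.prems(1)])
    fix v assume v: "v \<in> carrier M" "\<And>i. i < n \<Longrightarrow> mvar i \<odot> v \<in> U"
    then have "f \<odot> v \<in> U" using max_ideal_smult[OF Cons.prems(1)] Cons.prems(2) by simp
    then show "v \<in> U" using Cons.prems(3) v(1) unfolding weakly_regular.simps nonzerodivisor_mod_def by blast
  qed
  then obtain \<Z> where "finite \<Z>" "\<forall>Z\<in>\<Z>. proper_subspace n Z"
    "\<forall>l\<in>carrier R. (\<forall>Z\<in>\<Z>. l \<notin> Z) \<longrightarrow> nonzerodivisor_mod U l" by blast
  moreover obtain \<Y> where "finite \<Y>" "\<forall>Z\<in>\<Y>. proper_subspace n Z"
    "\<forall>l\<in>carrier R. (\<forall>Z\<in>\<Y>. l \<notin> Z) \<longrightarrow> nonzerodivisor_along (extend U f) l fs"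
    using Cons.IH[OF extend_submodule[OF Cons.prems(1) f]] Cons.prems by auto
  ultimately show ?case by (intro exI[of _ "\<Z> \<union> \<Y>"]) auto
qed

text \<open>Each exchange puts a linear form in front and leaves a sequence that is shorter by one and weakly regular
  modulo the enlarged submodule, to which the induction hypothesis applies.\<close>

theorem linear_weakly_regular_sequence:
  assumes K: "infinite (UNIV :: 'a set)"
    and "submodule R U M" "set fs \<subseteq> max_ideal n" "weakly_regular U fs"
  shows "\<exists>ls. length ls = length fs \<and> set ls \<subseteq> mpoly_homog n 1 \<and> weakly_regular U ls"
  using assms(2-)
proof (induction "length fs" arbitrary: U fs)
  case 0
  then show ?case by (intro exI[of _ "[]"]) simp
next
  case (Suc r)
  have "fs \<noteq> []" using Suc.hyps(2) by auto
  then obtain gs f where fs: "fs = gs @ [f]" by (cases fs rule: rev_cases) simp_all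
  have carr: "set fs \<subseteq> carrier R" using Suc.prems(2) max_ideal_carrier by blast
  obtain \<Z> where \<Z>: "finite \<Z>" "\<forall>Z\<in>\<Z>. proper_subspace n Z"
    and Z: "\<forall>l\<in>carrier R. (\<forall>Z\<in>\<Z>. l \<notin> Z) \<longrightarrow> nonzerodivisor_along U l fs"
    using zero_divisors_along_covered[OF Suc.prems] by blast
  obtain l where l: "l \<in> mpoly_homog n 1" "\<forall>Z\<in>\<Z>. l \<notin> Z"
    using linear_form_avoiding_proper_subspaces[OF K \<Z>(1), of n] \<Z>(2) by blast
  have lR: "l \<in> carrier R" using l(1) by (simp add: mpoly_homog_def)
  have along: "nonzerodivisor_along U l fs" using Z lR l(2) by blast
  have "weakly_regular (extend U l) gs"
    using along Suc.prems(3) carr unfolding fs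
    by (intro weakly_regular_exchange[OF Suc.prems(1) lR, of gs f]) simp_all
  moreover have "set gs \<subseteq> max_ideal n" "r = length gs"
    using Suc.prems(2) Suc.hyps(2) by (simp_all add: fs)
  ultimately obtain ls where ls: "length ls = length gs" "set ls \<subseteq> mpoly_homog n 1" "weakly_regular (extend U l) ls"
    using Suc.hyps(1)[of gs "extend U l"] extend_submodule[OF Suc.prems(1) lR] by blast
  moreover have "nonzerodivisor_mod U l" using along by (cases gs) (simp_all add: fs)
  ultimately show ?case using l(1) fs by (intro exI[of _ "l # ls"]) simp
qed

end

section \<open>Graded modules and the upper bound\<close>

lemma mpoly_monomial_induct [consumes 1, case_names zero single add]:
  fixes p :: "'a::comm_ring_1 mpoly"
  assumes "Poly_Mapping.keys p \<subseteq> D" and "P 0" and "\<And>m c. m \<in> D \<Longrightarrow> P (Poly_Mapping.single m c)"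
    and "\<And>p q. Poly_Mapping.keys p \<subseteq> D \<Longrightarrow> Poly_Mapping.keys q \<subseteq> D \<Longrightarrow> P p \<Longrightarrow> P q \<Longrightarrow> P (p + q)"
  shows "P p"
  using assms(1)
proof (induction p rule: Poly_Mapping.update_induct)
  case const
  show ?case by (rule assms(2))
next
  case (update p m k)
  have eq: "Poly_Mapping.update m k p = Poly_Mapping.single m k + p"
    using update.hyps
    by (auto intro!: poly_mapping_eqI simp: lookup_add lookup_single lookup_update when_def in_keys_iff)
  have "Poly_Mapping.keys (Poly_Mapping.update m k p) = insert m (Poly_Mapping.keys p)"
    using update.hyps by (auto simp: keys_update)
  then have "m \<in> D" "Poly_Mapping.keys p \<subseteq> D" using update.prems by auto
  then show ?case unfolding eq using assms(3) update.IH by (intro assms(4)) auto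
qed

definition monomials_of_degree :: "nat set \<Rightarrow> nat \<Rightarrow> (nat \<Rightarrow>\<^sub>0 nat) set" where
  "monomials_of_degree V d = {m. Poly_Mapping.keys m \<subseteq> V \<and> mdeg m = d}"

lemma mdeg_superset:
  assumes "finite V" "Poly_Mapping.keys m \<subseteq> V"
  shows "mdeg m = (\<Sum>i\<in>V. Poly_Mapping.lookup m i)"
  unfolding mdeg_def using assms by (intro sum.mono_neutral_left) (auto simp: in_keys_iff)

lemma mdeg_add: "mdeg (m + k) = mdeg m + mdeg k"
proof -
  let ?V = "Poly_Mapping.keys m \<union> Poly_Mapping.keys k"
  have "mdeg (m + k) = (\<Sum>i\<in>?V. Poly_Mapping.lookup (m + k) i)"
    by (rule mdeg_superset[OF _ Poly_Mapping.keys_add]) simp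
  also have "\<dots> = mdeg m + mdeg k"
    by (simp add: lookup_add sum.distrib mdeg_superset[of ?V])
  finally show ?thesis .
qed

lemma mdeg_single [simp]: "mdeg (Poly_Mapping.single i k) = k"
  by (simp add: mdeg_def)

lemma mdeg_0 [simp]: "mdeg 0 = 0"
  by (simp add: mdeg_def)

lemma mdeg_eq_0_iff [simp]: "mdeg m = 0 \<longleftrightarrow> m = 0"
  by (auto simp: mdeg_def in_keys_iff intro!: poly_mapping_eqI)

lemma finite_monomials_of_degree:
  assumes "finite V"
  shows "finite (monomials_of_degree V d)"
proof -
  have "monomials_of_degree V d \<subseteq> Abs_poly_mapping ` {f. \<forall>i. (i \<in> V \<longrightarrow> f i \<in> {..d}) \<and> (i \<notin> V \<longrightarrow> f i = 0)}"
  proof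
    fix m assume m: "m \<in> monomials_of_degree V d"
    have "Poly_Mapping.lookup m i \<le> d" if "i \<in> V" for i
      using m member_le_sum[of i V "Poly_Mapping.lookup m"] assms that mdeg_superset[of V m]
      by (auto simp: monomials_of_degree_def)
    moreover have "Poly_Mapping.lookup m i = 0" if "i \<notin> V" for i
      using m that by (auto simp: monomials_of_degree_def in_keys_iff)
    ultimately have "Poly_Mapping.lookup m \<in> {f. \<forall>i. (i \<in> V \<longrightarrow> f i \<in> {..d}) \<and> (i \<notin> V \<longrightarrow> f i = 0)}"
      by simp
    then show "m \<in> Abs_poly_mapping ` {f. \<forall>i. (i \<in> V \<longrightarrow> f i \<in> {..d}) \<and> (i \<notin> V \<longrightarrow> f i = 0)}"
      by (rule rev_image_eqI) simp
  qed
  moreover have "finite {f. \<forall>i. (i \<in> V \<longrightarrow> f i \<in> {..d}) \<and> (i \<notin> V \<longrightarrow> f i = (0 :: nat))}"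
    using assms by (intro finite_set_of_finite_funs) simp_all
  ultimately show ?thesis using finite_surj by blast
qed

lemma single_homog: "Poly_Mapping.keys m \<subseteq> {..<n} \<Longrightarrow> Poly_Mapping.single m c \<in> mpoly_homog n (int (mdeg m))"
  unfolding mpoly_homog_def by auto

lemma mpoly_homog_carrier: "p \<in> mpoly_homog n d \<Longrightarrow> p \<in> carrier (mpoly_ring n)"
  by (simp add: mpoly_homog_def)

sublocale graded_module \<subseteq> mpoly_module n M
  by (rule mpoly_module.intro) (rule module_axioms)

sublocale fg_graded_module \<subseteq> fg_mpoly_module n M
  by unfold_locales (rule finitely_generated)

context graded_module begin

definition decomposes :: "'b \<Rightarrow> (int \<Rightarrow> 'b) \<Rightarrow> bool" where
  "decomposes v c \<longleftrightarrow> (\<forall>d. c d \<in> component M d) \<and> finite {d. c d \<noteq> \<zero>} \<and> v = (\<Oplus>d\<in>{d. c d \<noteq> \<zero>}. c d)"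

definition proj :: "'b \<Rightarrow> int \<Rightarrow> 'b" where
  "proj v = (THE c. decomposes v c)"

lemma decomposes_proj: "v \<in> carrier M \<Longrightarrow> decomposes v (proj v)"
  unfolding proj_def using direct_sum[of v] unfolding decomposes_def by (rule theI')

lemma proj_component: "v \<in> carrier M \<Longrightarrow> proj v d \<in> component M d"
  using decomposes_proj unfolding decomposes_def by blast

lemma proj_closed: "v \<in> carrier M \<Longrightarrow> proj v d \<in> carrier M"
  using proj_component component_closed by blast

lemma component_zero: "\<zero> \<in> component M d"
  and component_add: "u \<in> component M d \<Longrightarrow> v \<in> component M d \<Longrightarrow> u \<oplus> v \<in> component M d"
  using component_subgroup additive_subgroup.zero_closed additive_subgroup.a_closed by fast+

lemma proj_eqI:
  assumes "\<And>d. c d \<in> component M d" "finite F" "\<And>d. d \<notin> F \<Longrightarrow> c d = \<zero>" "v = (\<Oplus>d\<in>F. c d)"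
  shows "proj v = c"
proof -
  have cM: "c d \<in> carrier M" for d using assms(1) component_closed by blast
  have sub: "{d. c d \<noteq> \<zero>} \<subseteq> F" using assms(3) by blast
  have "v = (\<Oplus>d\<in>{d. c d \<noteq> \<zero>}. c d)"
    unfolding assms(4)
    by (rule M.add.finprod_mono_neutral_cong_right) (use assms(2) sub cM in auto)
  then have c: "decomposes v c"
    unfolding decomposes_def using assms(1,2) sub finite_subset by blast
  moreover have v: "v \<in> carrier M" unfolding assms(4) using cM by simp
  ultimately show ?thesis
    using direct_sum[OF v] decomposes_proj[OF v] unfolding decomposes_def by blast
qed

lemma proj_support:
  assumes "v \<in> carrier M"
  obtains F where "finite F" "\<And>d. d \<notin> F \<Longrightarrow> proj v d = \<zero>" "v = (\<Oplus>d\<in>F. proj v d)"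
  using decomposes_proj[OF assms] unfolding decomposes_def by (metis (mono_tags, lifting) mem_Collect_eq)

lemma proj_support_superset:
  assumes "v \<in> carrier M" "finite F" "\<And>d. d \<notin> F \<Longrightarrow> proj v d = \<zero>"
  shows "v = (\<Oplus>d\<in>F. proj v d)"
proof -
  obtain G where G: "finite G" "\<And>d. d \<notin> G \<Longrightarrow> proj v d = \<zero>" "v = (\<Oplus>d\<in>G. proj v d)"
    using proj_support[OF assms(1)] by blast
  have "(\<Oplus>d\<in>F. proj v d) = (\<Oplus>d\<in>F \<union> G. proj v d)"
    by (rule M.add.finprod_mono_neutral_cong_left) (use assms G proj_closed in auto)
  also have "\<dots> = (\<Oplus>d\<in>G. proj v d)"
    by (rule M.add.finprod_mono_neutral_cong_right) (use assms G(1,2) proj_closed in auto)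
  finally show ?thesis using G(3) by simp
qed

lemma proj_of_component: "v \<in> component M d \<Longrightarrow> proj v = (\<lambda>e. if e = d then v else \<zero>)"
  by (rule proj_eqI[where F = "{d}"]) (use component_zero component_closed in auto)

lemma proj_add:
  assumes u: "u \<in> carrier M" and v: "v \<in> carrier M"
  shows "proj (u \<oplus> v) d = proj u d \<oplus> proj v d"
proof -
  obtain F G where F: "finite F" "\<And>d. d \<notin> F \<Longrightarrow> proj u d = \<zero>" and G: "finite G" "\<And>d. d \<notin> G \<Longrightarrow> proj v d = \<zero>"
    using proj_support[OF u] proj_support[OF v] by metis
  have "proj (u \<oplus> v) = (\<lambda>d. proj u d \<oplus> proj v d)"
  proof (rule proj_eqI[where F = "F \<union> G"])
    have "u \<oplus> v = (\<Oplus>d\<in>F \<union> G. proj u d) \<oplus> (\<Oplus>d\<in>F \<union> G. proj v d)"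
      using proj_support_superset[OF u, of "F \<union> G"] proj_support_superset[OF v, of "F \<union> G"] F G by simp
    also have "\<dots> = (\<Oplus>d\<in>F \<union> G. proj u d \<oplus> proj v d)"
      by (rule M.finsum_addf[symmetric]) (use proj_closed u v in auto)
    finally show "u \<oplus> v = (\<Oplus>d\<in>F \<union> G. proj u d \<oplus> proj v d)" .
  qed (use F G u v proj_component component_add in auto)
  then show ?thesis by simp
qed

lemma proj_smult:
  assumes p: "p \<in> mpoly_homog n e" and v: "v \<in> carrier M"
  shows "proj (p \<odot> v) d = p \<odot> proj v (d - e)"
proof -
  have pR: "p \<in> carrier R" using p by (rule mpoly_homog_carrier)
  obtain F where F: "finite F" "\<And>d. d \<notin> F \<Longrightarrow> proj v d = \<zero>" "v = (\<Oplus>d\<in>F. proj v d)"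
    using proj_support[OF v] by blast
  have "proj (p \<odot> v) = (\<lambda>d. p \<odot> proj v (d - e))"
  proof (rule proj_eqI[where F = "(\<lambda>d. d + e) ` F"])
    show "p \<odot> proj v (d - e) \<in> component M d" for d
      using component_smult[OF p proj_component[OF v], of "d - e"] by simp
    show "finite ((\<lambda>d. d + e) ` F)" using F(1) by simp
    fix d assume "d \<notin> (\<lambda>d. d + e) ` F"
    then have "d - e \<notin> F" by (metis diff_add_cancel image_eqI)
    then show "p \<odot> proj v (d - e) = \<zero>" using F(2) pR by simp
  next
    have "p \<odot> v = p \<odot> (\<Oplus>d\<in>F. proj v d)" using F(3) by simp
    also have "\<dots> = (\<Oplus>d\<in>F. p \<odot> proj v d)"
      using F(1) pR proj_closed[OF v] by (intro finsum_smult_ldistr) auto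
    also have "\<dots> = (\<Oplus>d\<in>(\<lambda>d. d + e) ` F. p \<odot> proj v (d - e))"
      using pR proj_closed[OF v] by (subst M.finsum_reindex) (auto simp: inj_on_def)
    finally show "p \<odot> v = (\<Oplus>d\<in>(\<lambda>d. d + e) ` F. p \<odot> proj v (d - e))" .
  qed
  then show ?thesis by simp
qed

lemma proj_zero: "proj \<zero> d = \<zero>"
  using proj_of_component[OF component_zero, of d] by simp

lemma proj_finsum:
  assumes "\<And>x. x \<in> X \<Longrightarrow> w x \<in> carrier M"
  shows "proj (\<Oplus>x\<in>X. w x) d = (\<Oplus>x\<in>X. proj (w x) d)"
  using assms
proof (induction X rule: infinite_finite_induct)
  case (insert x X)
  then have "(\<Oplus>x\<in>X. w x) \<in> carrier M" by (intro M.finsum_closed) auto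
  then show ?case using insert by (simp add: proj_add proj_closed Pi_iff)
qed (simp_all add: proj_zero)

lemma component_space_simps [simp]:
  "carrier (component_space M d) = component M d" "add (component_space M d) = add M"
  "zero (component_space M d) = \<zero>" "module.smult (component_space M d) = (\<lambda>c v. mconst c \<odot> v)"
  by (simp_all add: component_space_def)

lemma finsum_component_space:
  assumes "\<And>x. x \<in> X \<Longrightarrow> w x \<in> component M d"
  shows "finsum (component_space M d) w X = (\<Oplus>x\<in>X. w x)"
proof -
  interpret V: vectorspace "class_ring :: 'a ring" "component_space M d"
    by (rule component_space_vectorspace)
  show ?thesis
    using assms
  proof (induction X rule: infinite_finite_induct)
    case (insert x X)
    have w: "w \<in> insert x X \<rightarrow> component M d" using insert.prems by blast
    then have "w \<in> insert x X \<rightarrow> carrier M" using component_closed by blast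
    then show ?case using insert w by (simp add: Pi_iff)
  qed simp_all
qed

end

text \<open>The component is spanned by the products of monomials with the homogeneous components of the generators.\<close>

lemma (in fg_graded_module) component_space_fin_dim:
  "vectorspace.fin_dim class_ring (component_space M d)"
proof -
  interpret V: vectorspace "class_ring :: 'a ring" "component_space M d"
    by (rule component_space_vectorspace)
  obtain A where A: "finite A" "A \<subseteq> carrier M" "span A = carrier M" using finitely_generated by blast
  define E where "E a = {e. proj a e \<noteq> \<zero>}" for a
  define X where "X = (\<Union>a\<in>A. \<Union>e\<in>E a. (\<lambda>m. Poly_Mapping.single m 1 \<odot> proj a e) ` {m \<in> monomials_of_degree {..<n} (nat (d - e)). int (mdeg m) + e = d})"
  have finE: "finite (E a)" if "a \<in> A" for a
    using decomposes_proj[of a] that A(2) unfolding decomposes_def E_def by auto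
  have finX: "finite X" unfolding X_def
    using A(1) finE finite_monomials_of_degree[of "{..<n}"] by (intro finite_UN_I finite_imageI) auto
  have mono: "Poly_Mapping.single m c \<odot> proj a (d - int (mdeg m)) \<in> component M d"
    if "a \<in> A" "Poly_Mapping.keys m \<subseteq> {..<n}" for a m c
    using component_smult[OF single_homog[OF that(2), of c] proj_component, of a "d - int (mdeg m)"] that A(2) by auto
  have X_comp: "X \<subseteq> component M d"
  proof
    fix x assume "x \<in> X"
    then obtain a m e where x: "a \<in> A" "m \<in> monomials_of_degree {..<n} (nat (d - e))" "int (mdeg m) + e = d"
      "x = Poly_Mapping.single m 1 \<odot> proj a e" unfolding X_def by blast
    have "e = d - int (mdeg m)" using x(3) by simp
    then show "x \<in> component M d" using mono[OF x(1), of m 1] x(2,4) by (simp add: monomials_of_degree_def)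
  qed
  define W where "W = V.span X"
  have subW: "submodule class_ring W (component_space M d)"
    unfolding W_def using X_comp by (intro V.span_is_submodule) simp
  have Wz: "\<zero> \<in> W" and Wadd: "\<And>u v. u \<in> W \<Longrightarrow> v \<in> W \<Longrightarrow> u \<oplus> v \<in> W" and Wsm: "\<And>c v. v \<in> W \<Longrightarrow> mconst c \<odot> v \<in> W"
    and WC: "W \<subseteq> component M d"
    using subW unfolding submodule_def by auto
  have XW: "X \<subseteq> W" unfolding W_def using X_comp by (intro V.in_own_span) simp
  have single_W: "Poly_Mapping.single m c \<odot> proj a (d - int (mdeg m)) \<in> W"
    if a: "a \<in> A" and m: "Poly_Mapping.keys m \<subseteq> {..<n}" for a m c
  proof -
    have aM: "proj a (d - int (mdeg m)) \<in> carrier M" using a A(2) proj_closed by blast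
    have sR: "Poly_Mapping.single m 1 \<in> carrier R" using m by simp
    have eq: "Poly_Mapping.single m c \<odot> proj a (d - int (mdeg m))
        = mconst c \<odot> (Poly_Mapping.single m 1 \<odot> proj a (d - int (mdeg m)))"
      using smult_mult[OF mconst_in_carrier sR aM, of c] by (simp add: mconst_def mult_single)
    show ?thesis
    proof (cases "proj a (d - int (mdeg m)) = \<zero>")
      case True
      then show ?thesis using Wz m by simp
    next
      case False
      then have "d - int (mdeg m) \<in> E a" by (simp add: E_def)
      moreover have "m \<in> {k \<in> monomials_of_degree {..<n} (nat (d - (d - int (mdeg m)))). int (mdeg k) + (d - int (mdeg m)) = d}"
        using m by (simp add: monomials_of_degree_def)
      ultimately have "Poly_Mapping.single m 1 \<odot> proj a (d - int (mdeg m)) \<in> X"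
        unfolding X_def using a by blast
      then show ?thesis unfolding eq using XW Wsm by blast
    qed
  qed
  have smult: "proj (p \<odot> a) d \<in> W" if a: "a \<in> A" and p: "p \<in> carrier R" for p a
  proof -
    have aM: "a \<in> carrier M" using a A(2) by blast
    have "Poly_Mapping.keys p \<subseteq> {m. Poly_Mapping.keys m \<subseteq> {..<n}}"
      using p by (auto simp: mpoly_carrier_iff)
    then show ?thesis
    proof (induction p rule: mpoly_monomial_induct)
      case zero
      show ?case using aM Wz by (simp add: smult_zero' proj_zero)
    next
      case (single m c)
      then have m: "Poly_Mapping.keys m \<subseteq> {..<n}" by simp
      show ?case unfolding proj_smult[OF single_homog[OF m] aM] using a m by (rule single_W)
    next
      case (add p q)
      then have "p \<in> carrier R" "q \<in> carrier R" by (auto simp: mpoly_carrier_iff)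
      then show ?case using add.IH Wadd aM by (simp add: smult_add_left proj_add)
    qed
  qed
  have "component M d \<subseteq> W"
  proof
    fix v assume v: "v \<in> component M d"
    then have "v \<in> span A" using component_closed A(3) by blast
    then obtain c where c: "c \<in> A \<rightarrow> carrier R" "v = lincomb c A" using A finite_span[OF A(1,2)] by blast
    have cl: "c a \<odot> a \<in> carrier M" if "a \<in> A" for a using c(1) A(2) that by blast
    have sumW: "(\<Oplus>a\<in>B. proj (c a \<odot> a) d) \<in> W" if "B \<subseteq> A" for B
      using that
    proof (induction B rule: infinite_finite_induct)
      case (insert a B)
      have "(\<Oplus>a\<in>insert a B. proj (c a \<odot> a) d) = proj (c a \<odot> a) d \<oplus> (\<Oplus>a\<in>B. proj (c a \<odot> a) d)"
        using insert cl proj_closed by (intro M.finsum_insert) auto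
      moreover have "proj (c a \<odot> a) d \<in> W" using insert.prems c(1) by (intro smult) auto
      ultimately show ?case using insert Wadd by simp
    qed (use Wz in auto)
    have "v = proj v d" using proj_of_component[OF v] by simp
    also have "\<dots> = (\<Oplus>a\<in>A. proj (c a \<odot> a) d)"
      unfolding c(2) lincomb_def using cl by (rule proj_finsum)
    finally show "v \<in> W" using sumW[of A] by simp
  qed
  then have "V.gen_set X" using WC unfolding W_def by auto
  then show ?thesis unfolding V.fin_dim_def using finX X_comp by auto
qed

context mpoly_module begin

text \<open>Linear independence over the field of the images of the elements of \<open>S\<close> in the quotient by \<open>U\<close>.\<close>

definition independent_mod :: "'b set \<Rightarrow> 'b set \<Rightarrow> bool" where
  "independent_mod U S \<longleftrightarrow> (\<forall>c. (\<Oplus>s\<in>S. mconst (c s) \<odot> s) \<in> U \<longrightarrow> (\<forall>s\<in>S. c s = 0))"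

lemma zero_submodule: "submodule R {\<zero>} M"
  by (rule submoduleI') simp_all

lemma weakly_regularI:
  assumes "\<And>i. i < length fs \<Longrightarrow> nonzerodivisor_mod (foldl extend U (take i fs)) (fs ! i)"
  shows "weakly_regular U fs"
  using assms
proof (induction fs arbitrary: U)
  case (Cons f fs)
  have "nonzerodivisor_mod (foldl extend (extend U f) (take i fs)) (fs ! i)" if "i < length fs" for i
    using Cons.prems[of "Suc i"] that by simp
  then have "weakly_regular (extend U f) fs" by (rule Cons.IH)
  moreover have "nonzerodivisor_mod U f" using Cons.prems[of 0] by simp
  ultimately show ?case by simp
qed simp

end

context graded_module begin

lemma list_smult_snoc:
  assumes "set fs \<subseteq> carrier R" "f \<in> carrier R"
  shows "list_smult M (fs @ [f]) = extend (list_smult M fs) f"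
proof -
  let ?n = "length fs"
  have cl: "(fs @ [f]) ! j \<in> carrier R" if "j < Suc ?n" for j
    using assms that by (cases "j = ?n") (auto simp: nth_append)
  have fs: "fs ! j \<in> carrier R" if "j < ?n" for j
    using assms(1) nth_mem[OF that] by blast
  have step: "(\<Oplus>j\<in>{..<Suc ?n}. ((fs @ [f]) ! j) \<odot> w j) = (\<Oplus>j\<in>{..<?n}. (fs ! j) \<odot> w j) \<oplus> f \<odot> w ?n"
    if w: "\<And>j. j < Suc ?n \<Longrightarrow> w j \<in> carrier M" for w
  proof -
    have "(\<Oplus>j\<in>{..<Suc ?n}. ((fs @ [f]) ! j) \<odot> w j) = f \<odot> w ?n \<oplus> (\<Oplus>j\<in>{..<?n}. ((fs @ [f]) ! j) \<odot> w j)"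
      unfolding lessThan_Suc using w cl assms(2) by (subst M.finsum_insert) (auto simp: Pi_iff)
    also have "(\<Oplus>j\<in>{..<?n}. ((fs @ [f]) ! j) \<odot> w j) = (\<Oplus>j\<in>{..<?n}. (fs ! j) \<odot> w j)"
      using w fs by (intro M.finsum_cong') (auto simp: nth_append)
    finally show ?thesis
      using w assms(2) fs by (subst M.a_comm) (auto intro!: M.finsum_closed)
  qed
  show ?thesis
  proof (rule equalityI; rule subsetI)
    fix x assume "x \<in> list_smult M (fs @ [f])"
    then obtain w where w: "w \<in> {..<Suc ?n} \<rightarrow> carrier M" "x = (\<Oplus>j\<in>{..<Suc ?n}. ((fs @ [f]) ! j) \<odot> w j)"
      unfolding list_smult_def by auto
    then have "x = (\<Oplus>j\<in>{..<?n}. (fs ! j) \<odot> w j) \<oplus> f \<odot> w ?n" using step[of w] by (simp add: Pi_iff)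
    moreover have "w \<in> {..<?n} \<rightarrow> carrier M" "w ?n \<in> carrier M" using w(1) by auto
    ultimately show "x \<in> extend (list_smult M fs) f"
      unfolding extend_def list_smult_def by blast
  next
    fix x assume "x \<in> extend (list_smult M fs) f"
    then obtain w v where w: "w \<in> {..<?n} \<rightarrow> carrier M" "v \<in> carrier M" "x = (\<Oplus>j\<in>{..<?n}. (fs ! j) \<odot> w j) \<oplus> f \<odot> v"
      unfolding extend_def list_smult_def by blast
    define w' where "w' = w(?n := v)"
    have w': "w' \<in> {..<Suc ?n} \<rightarrow> carrier M" using w(1,2) by (auto simp: w'_def Pi_iff)
    have "(\<Oplus>j\<in>{..<?n}. (fs ! j) \<odot> w j) = (\<Oplus>j\<in>{..<?n}. (fs ! j) \<odot> w' j)"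
      using w(1) fs by (intro M.finsum_cong') (auto simp: w'_def Pi_iff)
    then have "x = (\<Oplus>j\<in>{..<Suc ?n}. ((fs @ [f]) ! j) \<odot> w' j)"
      using step[of w'] w' w(3) by (simp add: Pi_iff w'_def)
    then show "x \<in> list_smult M (fs @ [f])"
      using w' unfolding list_smult_def by (intro CollectI exI[of _ w']) simp
  qed
qed

lemma list_smult_foldl:
  assumes "set fs \<subseteq> carrier R"
  shows "list_smult M fs = foldl extend {\<zero>} fs"
  using assms
proof (induction fs rule: rev_induct)
  case Nil
  show ?case unfolding list_smult_def by auto
next
  case (snoc f fs)
  then show ?case by (simp add: list_smult_snoc)
qed

lemma regular_sequence_weakly_regular:
  assumes "regular_sequence n M fs"
  shows "weakly_regular {\<zero>} fs"
proof (rule weakly_regularI)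
  fix i assume i: "i < length fs"
  have "set (take i fs) \<subseteq> carrier R"
    using assms set_take_subset[of i fs] unfolding regular_sequence_def by blast
  then show "nonzerodivisor_mod (foldl extend {\<zero>} (take i fs)) (fs ! i)"
    using assms i unfolding regular_sequence_def nonzerodivisor_mod_def by (simp flip: list_smult_foldl)
qed

lemma extend_proj_zero:
  assumes "component M (d - 1) = {\<zero>}" "l \<in> mpoly_homog n 1" and "U \<subseteq> {v \<in> carrier M. proj v d = \<zero>}"
  shows "extend U l \<subseteq> {v \<in> carrier M. proj v d = \<zero>}"
proof
  fix x assume "x \<in> extend U l"
  then obtain u v where x: "x = u \<oplus> l \<odot> v" "u \<in> U" "v \<in> carrier M" unfolding extend_def by blast
  have u: "u \<in> carrier M" "proj u d = \<zero>" using x(2) assms(3) by auto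
  have l: "l \<in> carrier R" using assms(2) by (rule mpoly_homog_carrier)
  have "proj v (d - 1) = \<zero>" using proj_component[OF x(3), of "d - 1"] assms(1) by simp
  then have "proj x d = \<zero>" using x u l by (simp add: proj_add proj_smult[OF assms(2)])
  then show "x \<in> {v \<in> carrier M. proj v d = \<zero>}" using x u l by simp
qed

text \<open>The products of the linear forms with a basis of the lowest component are independent: in a linear
  relation, the part \<open>l w\<close> that belongs to the first form \<open>l\<close> lies in \<open>U\<close> once the other coefficients are
  known to vanish, hence so does \<open>w\<close>; but \<open>U\<close> contains no nonzero element of degree \<open>d\<close>.\<close>

lemma independent_mod_products:
  assumes low: "component M (d - 1) = {\<zero>}"
    and B: "finite B" "B \<subseteq> component M d" "independent_mod {\<zero>} B"
    and "submodule R U M" "U \<subseteq> {v \<in> carrier M. proj v d = \<zero>}"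
    and "set ls \<subseteq> mpoly_homog n 1" "weakly_regular U ls"
  shows "\<exists>S. finite S \<and> S \<subseteq> component M (d + 1) \<and> card S = length ls * card B \<and> independent_mod U S"
  using assms(5-)
proof (induction ls arbitrary: U)
  case Nil
  then show ?case by (intro exI[of _ "{}"]) (simp add: independent_mod_def)
next
  case (Cons l ls)
  have l: "l \<in> mpoly_homog n 1" and lR: "l \<in> carrier R"
    using Cons.prems(3) mpoly_homog_carrier by auto
  note subU = Cons.prems(1)
  have reg: "nonzerodivisor_mod U l" "weakly_regular (extend U l) ls" using Cons.prems(4) by simp_all
  note sub = extend_submodule[OF subU lR]
  obtain S where S: "finite S" "S \<subseteq> component M (d + 1)" "card S = length ls * card B" "independent_mod (extend U l) S"
    using Cons.IH[OF sub extend_proj_zero[OF low l Cons.prems(2)] _ reg(2)] Cons.prems(3) by auto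
  have BM: "b \<in> carrier M" if "b \<in> B" for b using B(2) that component_closed by blast
  have SM: "s \<in> carrier M" if "s \<in> S" for s using S(2) that component_closed by blast
  have Ud: "w = \<zero>" if w: "w \<in> component M d" "w \<in> U" for w
    using Cons.prems(2) w(2) proj_of_component[OF w(1)] by auto
  have lw: "w = \<zero>" if w: "w \<in> component M d" "l \<odot> w \<in> U" for w
    using reg(1) w(2) Ud[OF w(1)] component_closed[OF w(1)] unfolding nonzerodivisor_mod_def by blast
  interpret Cd: additive_subgroup "component M d" M by (rule component_subgroup)
  have inj: "inj_on (\<lambda>b. l \<odot> b) B"
  proof (rule inj_onI)
    fix b b' assume b: "b \<in> B" "b' \<in> B" "l \<odot> b = l \<odot> b'"
    have lz: "l \<odot> (b \<ominus> b') = \<zero>"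
      using b BM lR by (simp add: a_minus_def smult_r_distr smult_r_minus M.r_neg)
    have "b \<ominus> b' \<in> component M d"
      using B(2) b unfolding a_minus_def by (intro component_add Cd.a_inv_closed) auto
    then have "b \<ominus> b' = \<zero>" by (rule lw) (simp add: lz submodule_zero[OF subU])
    moreover have "b = (b \<ominus> b') \<oplus> b'" using BM b by (simp add: a_minus_def M.a_assoc M.l_neg)
    ultimately show "b = b'" using BM b by simp
  qed
  have lB_comp: "l \<odot> b \<in> component M (d + 1)" if "b \<in> B" for b
    using component_smult[OF l, of b d] B(2) that by (auto simp: add.commute)
  have disj: "S \<inter> (\<lambda>b. l \<odot> b) ` B = {}"
  proof (rule ccontr)
    assume "S \<inter> (\<lambda>b. l \<odot> b) ` B \<noteq> {}"
    then obtain b where b: "b \<in> B" "l \<odot> b \<in> S" by blast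
    define c where "c s = (if s = l \<odot> b then 1 else 0 :: 'a)" for s
    have "(\<Oplus>s\<in>S. mconst (c s) \<odot> s) = (\<Oplus>s\<in>{l \<odot> b}. mconst (c s) \<odot> s)"
      by (rule M.add.finprod_mono_neutral_cong_right) (use S(1) b SM in \<open>auto simp: c_def mconst_mult smult_zero'\<close>)
    also have "\<dots> = l \<odot> b" using b SM by (simp add: c_def mconst_mult smult_one')
    finally have "(\<Oplus>s\<in>S. mconst (c s) \<odot> s) \<in> extend U l"
      using smult_in_extend[OF subU lR BM[OF b(1)]] by simp
    then have "c (l \<odot> b) = 0" using S(4) b(2) unfolding independent_mod_def by blast
    then show False by (simp add: c_def)
  qed
  let ?S = "S \<union> (\<lambda>b. l \<odot> b) ` B"
  have "independent_mod U ?S"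
    unfolding independent_mod_def
  proof (intro allI impI)
    fix c :: "'b \<Rightarrow> 'a" assume c: "(\<Oplus>s\<in>?S. mconst (c s) \<odot> s) \<in> U"
    define x where "x = (\<Oplus>s\<in>S. mconst (c s) \<odot> s)"
    define w where "w = (\<Oplus>b\<in>B. mconst (c (l \<odot> b)) \<odot> b)"
    have xM: "x \<in> carrier M" and wM: "w \<in> carrier M"
      unfolding x_def w_def using SM BM by (auto intro!: M.finsum_closed)
    have "(\<Oplus>s\<in>(\<lambda>b. l \<odot> b) ` B. mconst (c s) \<odot> s) = (\<Oplus>b\<in>B. mconst (c (l \<odot> b)) \<odot> (l \<odot> b))"
      using inj BM lR by (intro M.finsum_reindex) auto
    also have "\<dots> = (\<Oplus>b\<in>B. l \<odot> (mconst (c (l \<odot> b)) \<odot> b))"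
      using BM lR by (intro M.finsum_cong') (auto intro!: smult_commute)
    also have "\<dots> = l \<odot> w"
      unfolding w_def using BM lR B(1) by (intro finsum_smult_ldistr[symmetric]) auto
    finally have "(\<Oplus>s\<in>?S. mconst (c s) \<odot> s) = x \<oplus> l \<odot> w"
      unfolding x_def using S(1) B(1) disj SM BM lR by (subst M.finsum_Un_disjoint) auto
    then have xw: "x \<oplus> l \<odot> w \<in> U" using c by simp
    have "l \<odot> w \<oplus> x \<in> extend U l" using xw subset_extend[OF subU lR] xM wM lR by (auto simp: M.a_comm)
    then have "x \<in> extend U l"
      using submodule_add_cancel[OF sub _ smult_in_extend[OF subU lR wM] xM] by blast
    then have cS: "\<forall>s\<in>S. c s = 0" using S(4) unfolding independent_mod_def x_def by blast
    have "x = (\<Oplus>s\<in>S. \<zero>)" unfolding x_def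
      using cS SM by (intro M.finsum_cong') (auto simp: mconst_mult smult_zero')
    then have "x = \<zero>" by simp
    then have "l \<odot> w \<in> U" using xw wM lR by simp
    moreover have "w \<in> component M d"
    proof -
      have "mconst a \<odot> b \<in> component M d" if "b \<in> component M d" for a b
        using smult_monomial[of 0 a b d] that by (simp add: mconst_def)
      then have "(\<Oplus>b\<in>B'. mconst (c (l \<odot> b)) \<odot> b) \<in> component M d" if "B' \<subseteq> B" for B'
        using that
      proof (induction B' rule: infinite_finite_induct)
        case (insert b B')
        then have "(\<Oplus>b\<in>insert b B'. mconst (c (l \<odot> b)) \<odot> b)
            = mconst (c (l \<odot> b)) \<odot> b \<oplus> (\<Oplus>b\<in>B'. mconst (c (l \<odot> b)) \<odot> b)"
          using BM by (intro M.finsum_insert) auto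
        then show ?case using insert B(2) component_add by auto
      qed (simp_all add: component_zero)
      then show ?thesis unfolding w_def by blast
    qed
    ultimately have "w = \<zero>" using lw by blast
    then have "(\<Oplus>b\<in>B. mconst (c (l \<odot> b)) \<odot> b) \<in> {\<zero>}" unfolding w_def by simp
    then have "\<forall>b\<in>B. c (l \<odot> b) = 0"
      using spec[OF B(3)[unfolded independent_mod_def], of "\<lambda>b. c (l \<odot> b)"] by blast
    then show "\<forall>s\<in>?S. c s = 0" using cS by blast
  qed
  moreover have "card ?S = length (l # ls) * card B"
    using card_Un_disjoint[OF S(1) finite_imageI[OF B(1)] disj] card_image[OF inj] S(3) by simp
  moreover have "?S \<subseteq> component M (d + 1)" using S(2) lB_comp by blast
  moreover have "finite ?S" using S(1) B(1) by simp
  ultimately show ?case by blast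
qed

lemma lincomb_component_space:
  assumes "S \<subseteq> component M d"
  shows "LinearCombinations.module.lincomb (component_space M d) c S = (\<Oplus>s\<in>S. mconst (c s) \<odot> s)"
proof -
  interpret V: vectorspace "class_ring :: 'a ring" "component_space M d"
    by (rule component_space_vectorspace)
  have "mconst (c s) \<odot> s \<in> component M d" if "s \<in> S" for s
    using smult_monomial[of 0 "c s" s d] that assms by (auto simp: mconst_def)
  then show ?thesis unfolding V.lincomb_def using finsum_component_space[of S "\<lambda>s. mconst (c s) \<odot> s" d] by simp
qed

end

context fg_graded_module begin

theorem regular_sequence_length_bound:
  assumes K: "infinite (UNIV :: 'a set)"
    and low: "component M (d - 1) = {\<zero>}"
    and fs: "set fs \<subseteq> max_ideal n" "regular_sequence n M fs"
  shows "length fs * vectorspace.dim class_ring (component_space M d)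
    \<le> vectorspace.dim class_ring (component_space M (d + 1))"
proof -
  interpret V: vectorspace "class_ring :: 'a ring" "component_space M d"
    by (rule component_space_vectorspace)
  interpret W: vectorspace "class_ring :: 'a ring" "component_space M (d + 1)"
    by (rule component_space_vectorspace)
  obtain ls where ls: "length ls = length fs" "set ls \<subseteq> mpoly_homog n 1" "weakly_regular {\<zero>} ls"
    using linear_weakly_regular_sequence[OF K zero_submodule fs(1) regular_sequence_weakly_regular[OF fs(2)]] by blast
  obtain B where B: "finite B" "V.basis B" using V.finite_basis_exists[OF component_space_fin_dim] by blast
  have Bd: "B \<subseteq> component M d" "V.lin_indpt B" using B(2) unfolding V.basis_def by auto
  have "independent_mod {\<zero>} B"
    unfolding independent_mod_def
  proof (intro allI impI ballI, rule ccontr)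
    fix c b assume c: "(\<Oplus>s\<in>B. mconst (c s) \<odot> s) \<in> {\<zero>}" "b \<in> B" "c b \<noteq> (0 :: 'a)"
    then have "V.lin_dep B"
      using B(1) lincomb_component_space[OF Bd(1), of c] by (intro V.lin_dep_crit[of B B c b]) auto
    then show False using Bd(2) by blast
  qed
  moreover have "{\<zero>} \<subseteq> {v \<in> carrier M. proj v d = \<zero>}" using proj_zero by simp
  ultimately obtain S where S: "finite S" "S \<subseteq> component M (d + 1)" "card S = length ls * card B" "independent_mod {\<zero>} S"
    using independent_mod_products[OF low B(1) Bd(1) _ zero_submodule _ ls(2,3)] by blast
  have "W.lin_indpt S"
  proof (rule W.finite_lin_indpt2[OF S(1)])
    show "S \<subseteq> carrier (component_space M (d + 1))" using S(2) by simp
    fix c assume "W.lincomb c S = \<zero>\<^bsub>component_space M (d + 1)\<^esub>"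
    then have "(\<Oplus>s\<in>S. mconst (c s) \<odot> s) \<in> {\<zero>}" using lincomb_component_space[OF S(2), of c] by simp
    then show "\<forall>v\<in>S. c v = \<zero>\<^bsub>class_ring\<^esub>" using S(4) unfolding independent_mod_def by simp
  qed
  then have "card S \<le> W.dim" using W.li_le_dim[OF component_space_fin_dim _, of S] S(2) by simp
  then show ?thesis using S(3) ls(1) V.dim_basis[OF B] by simp
qed

theorem depth_le:
  assumes K: "infinite (UNIV :: 'a set)"
    and low: "component M (d - 1) = {\<zero>}"
    and pos: "vectorspace.dim class_ring (component_space M d) > 0"
    and less: "vectorspace.dim class_ring (component_space M (d + 1))
      < Suc r * vectorspace.dim class_ring (component_space M d)"
  shows "depth n M \<le> enat r"
proof -
  interpret V: vectorspace "class_ring :: 'a ring" "component_space M d"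
    by (rule component_space_vectorspace)
  have "carrier M \<noteq> {\<zero>}"
  proof
    assume "carrier M = {\<zero>}"
    then have "carrier (component_space M d) = {\<zero>}" using component_closed component_zero by auto
    then have "V.span {} = carrier (component_space M d)" using V.span_empty by simp
    then have "V.dim \<le> card ({} :: 'b set)"
      unfolding V.dim_def by (intro Least_le exI[of _ "{}"]) auto
    then show False using pos by simp
  qed
  moreover have "length fs \<le> r" if "set fs \<subseteq> max_ideal n" "regular_sequence n M fs" for fs
  proof -
    have "length fs * V.dim < Suc r * V.dim"
      using regular_sequence_length_bound[OF K low that] less by linarith
    then show ?thesis unfolding mult_less_cancel2 by simp
  qed
  ultimately show ?thesis unfolding depth_def by (auto intro!: Sup_least)
qed

end

section \<open>Graded modules spanned by monomials\<close>

lift_definition discard :: "'k set \<Rightarrow> ('k \<Rightarrow>\<^sub>0 'a::zero) \<Rightarrow> ('k \<Rightarrow>\<^sub>0 'a)" is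
  "\<lambda>Z f k. if k \<in> Z then 0 else f k"
  by (rule finite_subset) (auto split: if_splits)

lemma lookup_discard: "Poly_Mapping.lookup (discard Z p) k = (if k \<in> Z then 0 else Poly_Mapping.lookup p k)"
  by transfer simp

lemma keys_discard: "Poly_Mapping.keys (discard Z p) = Poly_Mapping.keys p - Z"
  by (auto simp: in_keys_iff lookup_discard split: if_splits)

lemma discard_add: "discard Z (p + q) = discard Z p + discard Z (q :: _ \<Rightarrow>\<^sub>0 'a::comm_monoid_add)"
  by (rule poly_mapping_eqI) (simp add: lookup_discard lookup_add)

lemma discard_eq_0: "Poly_Mapping.keys p \<subseteq> Z \<Longrightarrow> discard Z p = 0"
  by (rule poly_mapping_eqI) (auto simp: lookup_discard in_keys_iff)

lemma discard_id: "Poly_Mapping.keys p \<inter> Z = {} \<Longrightarrow> discard Z p = p"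
  by (rule poly_mapping_eqI) (auto simp: lookup_discard in_keys_iff)

text \<open>The space spanned by the monomials in \<open>B\<close>, on which polynomials act by multiplication followed by
  deletion of the monomials in \<open>Z\<close>. For disjoint \<open>B\<close> and \<open>Z\<close> it is the quotient of the span of \<open>B \<union> Z\<close> by the span of \<open>Z\<close>. Monomials may
  contain variables of index \<open>n\<close> and above, which serve as labels for the generators.\<close>

definition monomial_module :: "(nat \<Rightarrow>\<^sub>0 nat) set \<Rightarrow> (nat \<Rightarrow>\<^sub>0 nat) set \<Rightarrow> ('a::field mpoly, 'a mpoly) gmodule" where
  "monomial_module B Z = \<lparr>carrier = {p. Poly_Mapping.keys p \<subseteq> B}, monoid.mult = (*), one = 1, zero = 0,
     add = (+), module.smult = (\<lambda>p v. discard Z (p * v)),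
     component = (\<lambda>d. {p. Poly_Mapping.keys p \<subseteq> B \<and> (\<forall>m\<in>Poly_Mapping.keys p. int (mdeg m) = d)})\<rparr>"

lemma monomial_module_simps [simp]:
  "carrier (monomial_module B Z) = {p. Poly_Mapping.keys p \<subseteq> B}"
  "zero (monomial_module B Z) = 0" "add (monomial_module B Z) = (+)"
  "module.smult (monomial_module B Z) = (\<lambda>p v. discard Z (p * v))"
  "component (monomial_module B Z) d = {p. Poly_Mapping.keys p \<subseteq> B \<and> (\<forall>m\<in>Poly_Mapping.keys p. int (mdeg m) = d)}"
  by (simp_all add: monomial_module_def)

lemma keys_mult_cases:
  fixes p q :: "'a::comm_ring_1 mpoly"
  assumes "m \<in> Poly_Mapping.keys (p * q)"
  obtains a b where "m = a + b" "a \<in> Poly_Mapping.keys p" "b \<in> Poly_Mapping.keys q"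
  using assms keys_mult[of p q] by blast

text \<open>Both \<open>B \<union> Z\<close> and \<open>Z\<close> are closed under multiplication by monomials in the first \<open>n\<close> variables. The
  second closure property makes the truncated multiplication associative.\<close>

locale monomial_subquotient =
  fixes n :: nat and B Z :: "(nat \<Rightarrow>\<^sub>0 nat) set"
  assumes disjoint: "B \<inter> Z = {}"
    and times_B: "\<And>k b. Poly_Mapping.keys k \<subseteq> {..<n} \<Longrightarrow> b \<in> B \<Longrightarrow> k + b \<in> B \<union> Z"
    and times_Z: "\<And>k z. Poly_Mapping.keys k \<subseteq> {..<n} \<Longrightarrow> z \<in> Z \<Longrightarrow> k + z \<in> Z"
begin

lemma discard_mult_discard:
  fixes p q :: "'a::comm_ring_1 mpoly"
  assumes "p \<in> carrier (mpoly_ring n)"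
  shows "discard Z (p * discard Z q) = discard Z (p * q)"
proof -
  define r where "r = q - discard Z q"
  have r: "Poly_Mapping.keys r \<subseteq> Z"
    by (auto simp: r_def in_keys_iff lookup_minus lookup_discard split: if_splits)
  have "Poly_Mapping.keys (p * r) \<subseteq> Z"
  proof
    fix m assume "m \<in> Poly_Mapping.keys (p * r)"
    then obtain a b where "m = a + b" "a \<in> Poly_Mapping.keys p" "b \<in> Poly_Mapping.keys r"
      by (rule keys_mult_cases)
    then show "m \<in> Z" using times_Z[of a b] r assms by (auto simp: mpoly_carrier_iff)
  qed
  then have "discard Z (p * r) = 0" by (rule discard_eq_0)
  moreover have "p * q = p * discard Z q + p * r" by (simp add: r_def algebra_simps)
  ultimately show ?thesis by (simp add: discard_add)
qed

lemma smult_keys: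
  fixes p v :: "'a::comm_ring_1 mpoly"
  assumes "p \<in> carrier (mpoly_ring n)" "Poly_Mapping.keys v \<subseteq> B"
  shows "Poly_Mapping.keys (discard Z (p * v)) \<subseteq> B"
proof
  fix m assume "m \<in> Poly_Mapping.keys (discard Z (p * v))"
  then have m: "m \<in> Poly_Mapping.keys (p * v)" "m \<notin> Z" by (simp_all add: keys_discard)
  obtain a b where ab: "m = a + b" "a \<in> Poly_Mapping.keys p" "b \<in> Poly_Mapping.keys v"
    using m(1) by (rule keys_mult_cases)
  then have "a + b \<in> B \<union> Z" using assms by (intro times_B) (auto simp: mpoly_carrier_iff)
  then show "m \<in> B" using m(2) ab(1) by blast
qed

lemma keys_add_subset: "Poly_Mapping.keys p \<subseteq> C \<Longrightarrow> Poly_Mapping.keys q \<subseteq> C \<Longrightarrow> Poly_Mapping.keys (p + q) \<subseteq> C"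
  using Poly_Mapping.keys_add[of p q] by blast

lemma module_monomial_module:
  "Module.module (mpoly_ring n) (monomial_module B Z :: ('a::field mpoly, 'a mpoly) gmodule)"
proof (rule moduleI)
  let ?M = "monomial_module B Z :: ('a mpoly, 'a mpoly) gmodule"
  show "cring (mpoly_ring n)" by (rule cring_mpoly_ring)
  show "abelian_group ?M"
  proof (rule abelian_groupI)
    fix v assume "v \<in> carrier ?M"
    then show "\<exists>u\<in>carrier ?M. u \<oplus>\<^bsub>?M\<^esub> v = \<zero>\<^bsub>?M\<^esub>" by (intro bexI[of _ "- v"]) simp_all
  qed (simp_all add: keys_add_subset add.assoc add.commute)
  fix p q :: "'a mpoly" and u v
  assume p: "p \<in> carrier (mpoly_ring n)"
  {
    assume "v \<in> carrier ?M"
    then show "p \<odot>\<^bsub>?M\<^esub> v \<in> carrier ?M" using p smult_keys by simp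
  }
  show "(p \<otimes>\<^bsub>mpoly_ring n\<^esub> q) \<odot>\<^bsub>?M\<^esub> v = p \<odot>\<^bsub>?M\<^esub> (q \<odot>\<^bsub>?M\<^esub> v)"
    using p by (simp add: discard_mult_discard mult_mpoly_ring mult.assoc)
  show "(p \<oplus>\<^bsub>mpoly_ring n\<^esub> q) \<odot>\<^bsub>?M\<^esub> v = p \<odot>\<^bsub>?M\<^esub> v \<oplus>\<^bsub>?M\<^esub> q \<odot>\<^bsub>?M\<^esub> v"
    by (simp add: add_mpoly_ring distrib_right discard_add)
  show "p \<odot>\<^bsub>?M\<^esub> (u \<oplus>\<^bsub>?M\<^esub> v) = p \<odot>\<^bsub>?M\<^esub> u \<oplus>\<^bsub>?M\<^esub> p \<odot>\<^bsub>?M\<^esub> v"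
    by (simp add: distrib_left discard_add)
next
  let ?M = "monomial_module B Z :: ('a mpoly, 'a mpoly) gmodule"
  fix v assume "v \<in> carrier ?M"
  then show "\<one>\<^bsub>mpoly_ring n\<^esub> \<odot>\<^bsub>?M\<^esub> v = v"
    using disjoint by (simp add: one_mpoly_ring) (rule discard_id, blast)
qed

lemma finsum_monomial_module:
  fixes w :: "'x \<Rightarrow> 'a::field mpoly"
  assumes "\<And>x. x \<in> X \<Longrightarrow> Poly_Mapping.keys (w x) \<subseteq> B"
  shows "finsum (monomial_module B Z) w X = sum w X"
proof -
  interpret Module.module "mpoly_ring n" "monomial_module B Z :: ('a mpoly, 'a mpoly) gmodule"
    by (rule module_monomial_module)
  show ?thesis
    using assms
  proof (induction X rule: infinite_finite_induct)
    case (insert x X)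
    have "finsum (monomial_module B Z) w (insert x X) = w x \<oplus>\<^bsub>monomial_module B Z\<^esub> finsum (monomial_module B Z) w X"
      using insert by (intro M.finsum_insert) auto
    then show ?case using insert by simp
  qed simp_all
qed

lemma graded_monomial_module:
  "graded_module n (monomial_module B Z :: ('a::field mpoly, 'a mpoly) gmodule)"
proof (rule graded_module.intro[OF module_monomial_module], rule graded_module_axioms.intro)
  let ?M = "monomial_module B Z :: ('a mpoly, 'a mpoly) gmodule"
  interpret Module.module "mpoly_ring n" ?M by (rule module_monomial_module)
  {
    fix d
    have minus: "\<ominus>\<^bsub>?M\<^esub> v = - v" if "v \<in> carrier ?M" for v
      using that by (intro M.minus_equality) simp_all
    show "additive_subgroup (component ?M d) ?M"
    proof (rule additive_subgroup.intro, rule M.add.subgroupI)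
      have "0 \<in> component ?M d" by simp
      then show "component ?M d \<noteq> {}" by blast
    next
      fix u v assume uv: "u \<in> component ?M d" "v \<in> component ?M d"
      then have "\<forall>m\<in>Poly_Mapping.keys (u + v). int (mdeg m) = d"
        using Poly_Mapping.keys_add[of u v] by auto
      then show "u \<oplus>\<^bsub>?M\<^esub> v \<in> component ?M d" using uv keys_add_subset[of u B v] by simp
    next
      fix u assume u: "u \<in> component ?M d"
      then have "\<ominus>\<^bsub>?M\<^esub> u = - u" by (intro minus) simp
      then show "\<ominus>\<^bsub>?M\<^esub> u \<in> component ?M d" using u by simp
    qed auto
  next
    fix d e and p v :: "'a mpoly"
    assume p: "p \<in> mpoly_homog n d" and v: "v \<in> component ?M e"
    have "int (mdeg m) = d + e" if m: "m \<in> Poly_Mapping.keys (discard Z (p * v))" for m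
    proof -
      have "m \<in> Poly_Mapping.keys (p * v)" using m by (simp add: keys_discard)
      then obtain a b where "m = a + b" "a \<in> Poly_Mapping.keys p" "b \<in> Poly_Mapping.keys v"
        by (rule keys_mult_cases)
      then show ?thesis using p v by (simp add: mdeg_add mpoly_homog_def)
    qed
    then show "p \<odot>\<^bsub>?M\<^esub> v \<in> component ?M (d + e)"
      using smult_keys[OF mpoly_homog_carrier[OF p], of v] v by simp
  next
    fix v assume v: "v \<in> carrier ?M"
    define part where "part d = discard {m. int (mdeg m) \<noteq> d} v" for d
    let ?P = "\<lambda>c. (\<forall>d. c d \<in> component ?M d) \<and> finite {d. c d \<noteq> \<zero>\<^bsub>?M\<^esub>} \<and>
        v = (\<Oplus>\<^bsub>?M\<^esub>d\<in>{d. c d \<noteq> \<zero>\<^bsub>?M\<^esub>}. c d)"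
    have lookup_sum_comp: "Poly_Mapping.lookup (\<Sum>d\<in>{d. c d \<noteq> 0}. c d) m = Poly_Mapping.lookup (c (int (mdeg m))) m"
      if c: "\<And>d. c d \<in> component ?M d" "finite {d. c d \<noteq> 0}" for c m
    proof -
      have zero: "Poly_Mapping.lookup (c d) m = 0" if "d \<noteq> int (mdeg m)" for d
      proof (rule ccontr)
        assume "Poly_Mapping.lookup (c d) m \<noteq> 0"
        then have "m \<in> Poly_Mapping.keys (c d)" by (simp add: in_keys_iff)
        then show False using c(1)[of d] that by simp
      qed
      have "Poly_Mapping.lookup (\<Sum>d\<in>{d. c d \<noteq> 0}. c d) m = (\<Sum>d\<in>{d. c d \<noteq> 0}. Poly_Mapping.lookup (c d) m)"
        by (rule lookup_sum)
      also have "\<dots> = (\<Sum>d\<in>{int (mdeg m)}. Poly_Mapping.lookup (c d) m)"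
        by (rule sum.mono_neutral_cong) (use c(2) zero in auto)
      finally show ?thesis by simp
    qed
    have eq: "?P c \<longleftrightarrow> (\<forall>d. c d \<in> component ?M d) \<and> finite {d. c d \<noteq> 0} \<and> v = (\<Sum>d\<in>{d. c d \<noteq> 0}. c d)" for c
    proof -
      have "(\<Oplus>\<^bsub>?M\<^esub>d\<in>{d. c d \<noteq> \<zero>\<^bsub>?M\<^esub>}. c d) = (\<Sum>d\<in>{d. c d \<noteq> 0}. c d)" if "\<forall>d. c d \<in> component ?M d"
        using that by (subst finsum_monomial_module) simp_all
      then show ?thesis by (metis monomial_module_simps(2))
    qed
    have part_comp: "part d \<in> component ?M d" for d
      using v by (auto simp: part_def keys_discard)
    have "{d. part d \<noteq> 0} \<subseteq> (\<lambda>m. int (mdeg m)) ` Poly_Mapping.keys v"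
    proof
      fix d assume "d \<in> {d. part d \<noteq> 0}"
      then have "Poly_Mapping.keys (part d) \<noteq> {}" by simp
      then show "d \<in> (\<lambda>m. int (mdeg m)) ` Poly_Mapping.keys v" by (auto simp: part_def keys_discard)
    qed
    then have part_fin: "finite {d. part d \<noteq> 0}" by (rule finite_subset) simp
    have "v = (\<Sum>d\<in>{d. part d \<noteq> 0}. part d)"
      by (rule poly_mapping_eqI) (simp only: lookup_sum_comp[OF part_comp part_fin], simp add: part_def lookup_discard)
    then have ex: "?P part" using eq[of part] part_comp part_fin by blast
    have uniq: "c = part" if "?P c" for c
    proof
      fix d
      have c: "\<forall>d. c d \<in> component ?M d" "finite {d. c d \<noteq> 0}" "v = (\<Sum>d\<in>{d. c d \<noteq> 0}. c d)"
        using that eq[of c] by blast+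
      show "c d = part d"
      proof (rule poly_mapping_eqI)
        fix m
        show "Poly_Mapping.lookup (c d) m = Poly_Mapping.lookup (part d) m"
        proof (cases "int (mdeg m) = d")
          case True
          then show ?thesis
            using lookup_sum_comp[of c m] c by (simp add: part_def lookup_discard)
        next
          case False
          then have "m \<notin> Poly_Mapping.keys (c d)" "m \<notin> Poly_Mapping.keys (part d)"
            using c(1) part_comp by auto
          then show ?thesis by (simp add: in_keys_iff)
        qed
      qed
    qed
    show "\<exists>!c. ?P c" by (rule ex1I[of ?P part, OF ex uniq])
  }
qed

lemma fg_graded_monomial_module:
  assumes G: "finite G" "G \<subseteq> B" and gen: "\<And>b. b \<in> B \<Longrightarrow> \<exists>g\<in>G. \<exists>k. Poly_Mapping.keys k \<subseteq> {..<n} \<and> b = k + g"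
  shows "fg_graded_module n (monomial_module B Z :: ('a::field mpoly, 'a mpoly) gmodule)"
proof -
  let ?M = "monomial_module B Z :: ('a mpoly, 'a mpoly) gmodule"
  interpret graded_module n ?M by (rule graded_monomial_module)
  define A where "A = (\<lambda>g. Poly_Mapping.single g (1 :: 'a)) ` G"
  have A: "finite A" "A \<subseteq> carrier ?M" using G by (auto simp: A_def)
  have sub: "submodule (mpoly_ring n) (span A) ?M" using A(2) by (rule span_is_submodule)
  have single: "Poly_Mapping.single b c \<in> span A" if b: "b \<in> B" for b and c :: 'a
  proof -
    obtain g k where gk: "g \<in> G" "Poly_Mapping.keys k \<subseteq> {..<n}" "b = k + g" using gen[OF b] by blast
    have "Poly_Mapping.single g 1 \<in> span A" using in_own_span[OF A(2)] gk(1) by (auto simp: A_def)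
    then have "Poly_Mapping.single k c \<odot>\<^bsub>?M\<^esub> Poly_Mapping.single g 1 \<in> span A"
      using gk(2) by (intro submodule_smult[OF sub]) simp
    moreover have "Poly_Mapping.single k c \<odot>\<^bsub>?M\<^esub> Poly_Mapping.single g 1 = Poly_Mapping.single b c"
    proof -
      have "discard Z (Poly_Mapping.single b c) = Poly_Mapping.single b c"
        using b disjoint by (intro discard_id) auto
      then show ?thesis by (simp add: mult_single gk(3))
    qed
    ultimately show ?thesis by simp
  qed
  have "v \<in> span A" if "Poly_Mapping.keys v \<subseteq> B" for v
    using that
  proof (induction v rule: mpoly_monomial_induct)
    case zero
    show ?case using submodule_zero[OF sub] by simp
  next
    case (add p q)
    then show ?case using submodule_add[OF sub, of p q] by simp
  qed (rule single)
  then have "span A = carrier ?M" using span_is_subset2[OF A(2)] by auto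
  then show ?thesis using A by unfold_locales blast
qed

lemma dim_component_monomial_module:
  assumes fin: "finite {b \<in> B. int (mdeg b) = d}"
  shows "vectorspace.dim class_ring (component_space (monomial_module B Z :: ('a::field mpoly, 'a mpoly) gmodule) d)
    = card {b \<in> B. int (mdeg b) = d}"
proof -
  let ?M = "monomial_module B Z :: ('a mpoly, 'a mpoly) gmodule"
  interpret graded_module n ?M by (rule graded_monomial_module)
  interpret V: vectorspace "class_ring :: 'a ring" "component_space ?M d"
    by (rule component_space_vectorspace)
  define C where "C = {b \<in> B. int (mdeg b) = d}"
  define S where "S = (\<lambda>b. Poly_Mapping.single b (1 :: 'a)) ` C"
  have C: "finite C" "C \<subseteq> B" using fin by (auto simp: C_def)
  have inj: "inj_on (\<lambda>b. Poly_Mapping.single b (1 :: 'a)) C"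
    by (rule inj_onI) (metis lookup_single_eq lookup_single_not_eq zero_neq_one)
  have S: "finite S" "S \<subseteq> component ?M d" using C by (auto simp: S_def C_def)
  have lc: "V.lincomb c S = (\<Sum>b\<in>C. Poly_Mapping.single b (c (Poly_Mapping.single b 1)))" for c
  proof -
    have *: "mconst (c s) \<odot>\<^bsub>?M\<^esub> s = mconst (c s) * s" and k: "Poly_Mapping.keys (mconst (c s) * s) \<subseteq> B" if sS: "s \<in> S" for s
    proof -
      obtain b where b: "b \<in> B" "s = Poly_Mapping.single b 1" using sS C(2) by (auto simp: S_def)
      have "mconst (c s) * s = Poly_Mapping.single b (c s)"
        unfolding b(2) mconst_def mult_single by simp
      moreover have "Poly_Mapping.keys (Poly_Mapping.single b (c s)) \<subseteq> B" using b(1) by simp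
      ultimately show k: "Poly_Mapping.keys (mconst (c s) * s) \<subseteq> B" by (simp only:)
      then show "mconst (c s) \<odot>\<^bsub>?M\<^esub> s = mconst (c s) * s" using disjoint by (simp, intro discard_id) blast
    qed
    have "V.lincomb c S = (\<Oplus>\<^bsub>?M\<^esub>s\<in>S. mconst (c s) \<odot>\<^bsub>?M\<^esub> s)" using S(2) by (rule lincomb_component_space)
    also have "\<dots> = (\<Sum>s\<in>S. mconst (c s) \<odot>\<^bsub>?M\<^esub> s)"
      by (rule finsum_monomial_module) (simp only: * k)
    also have "\<dots> = (\<Sum>s\<in>S. mconst (c s) * s)" by (rule sum.cong[OF refl *])
    also have "\<dots> = (\<Sum>b\<in>C. Poly_Mapping.single b (c (Poly_Mapping.single b 1)))"
      unfolding S_def by (subst sum.reindex[OF inj]) (simp add: mconst_def mult_single)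
    finally show ?thesis .
  qed
  have lookup: "Poly_Mapping.lookup (V.lincomb c S) b = c (Poly_Mapping.single b 1)" if "b \<in> C" for c b
    unfolding lc lookup_sum using C(1) that by (simp add: lookup_single when_def)
  have "V.lin_indpt S"
  proof (rule V.finite_lin_indpt2[OF S(1)])
    fix c assume c: "V.lincomb c S = \<zero>\<^bsub>component_space ?M d\<^esub>"
    have "c (Poly_Mapping.single b 1) = 0" if "b \<in> C" for b
      using lookup[OF that, of c] c by simp
    then show "\<forall>v\<in>S. c v = \<zero>\<^bsub>class_ring\<^esub>" by (simp add: S_def)
  qed (use S in simp)
  moreover have "V.gen_set S"
  proof
    show "V.span S \<subseteq> carrier (component_space ?M d)" using S(2) by (intro V.span_is_subset2) simp
    show "carrier (component_space ?M d) \<subseteq> V.span S"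
    proof
      fix v assume "v \<in> carrier (component_space ?M d)"
      then have keys: "Poly_Mapping.keys v \<subseteq> C" by (auto simp: C_def)
      define c where "c s = Poly_Mapping.lookup v (the_inv_into C (\<lambda>b. Poly_Mapping.single b (1 :: 'a)) s)" for s
      have "v = V.lincomb c S"
      proof (rule poly_mapping_eqI)
        fix b
        show "Poly_Mapping.lookup v b = Poly_Mapping.lookup (V.lincomb c S) b"
        proof (cases "b \<in> C")
          case True
          then show ?thesis using lookup[OF True] the_inv_into_f_f[OF inj True] by (simp add: c_def)
        next
          case False
          then have "Poly_Mapping.lookup v b = 0" using keys by (auto simp: in_keys_iff)
          moreover have "Poly_Mapping.lookup (V.lincomb c S) b = 0"
            unfolding lc lookup_sum using False by (intro sum.neutral) (auto simp: lookup_single when_def)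
          ultimately show ?thesis by simp
        qed
      qed
      then show "v \<in> V.span S" using S(1) unfolding V.span_def by auto
    qed
  qed
  ultimately have "V.basis S" using S(2) unfolding V.basis_def by auto
  then have "V.dim = card S" by (rule V.dim_basis[OF S(1)])
  also have "card S = card C" unfolding S_def by (rule card_image[OF inj])
  finally show ?thesis unfolding C_def .
qed

end

section \<open>Powers of the maximal ideal\<close>

lemma keys_add_nat: "Poly_Mapping.keys (a + b) = Poly_Mapping.keys a \<union> Poly_Mapping.keys (b :: nat \<Rightarrow>\<^sub>0 nat)"
  by (auto simp: in_keys_iff lookup_add)

lemma exists_divisor_of_degree:
  assumes "k \<le> mdeg m"
  shows "\<exists>g l. m = l + g \<and> mdeg g = k"
  using assms
proof (induction k)
  case 0
  show ?case by (intro exI[of _ 0] exI[of _ m]) simp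
next
  case (Suc k)
  then obtain g l where gl: "m = l + g" "mdeg g = k" by auto
  then have "l \<noteq> 0" using Suc.prems by auto
  then have "Poly_Mapping.keys l \<noteq> {}" by simp
  then obtain i where i: "i \<in> Poly_Mapping.keys l" by blast
  define l' where "l' = l - Poly_Mapping.single i 1"
  have "l = l' + Poly_Mapping.single i 1"
    using i unfolding l'_def
    by (intro poly_mapping_eqI) (auto simp: lookup_add lookup_minus lookup_single when_def in_keys_iff)
  then have "m = l' + (Poly_Mapping.single i 1 + g)" using gl(1) by (simp add: add.assoc)
  then show ?case using gl(2) by (intro exI[of _ "Poly_Mapping.single i 1 + g"] exI[of _ l']) (simp add: mdeg_add)
qed

text \<open>Every monomial of the set is a unique product, because \<open>a\<close> is the part of \<open>a + b\<close> in the variables in \<open>V\<close>.\<close>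

lemma card_graded_product:
  assumes V: "finite V" and T: "\<And>j b. b \<in> T j \<Longrightarrow> Poly_Mapping.keys b \<inter> V = {} \<and> mdeg b = j"
    and fin: "\<And>j. finite (T j)"
  shows "finite {a + b | a b. Poly_Mapping.keys a \<subseteq> V \<and> b \<in> (\<Union>j. T j) \<and> mdeg (a + b) = d}"
    and "card {a + b | a b. Poly_Mapping.keys a \<subseteq> V \<and> b \<in> (\<Union>j. T j) \<and> mdeg (a + b) = d}
      = (\<Sum>j\<le>d. card (monomials_of_degree V (d - j)) * card (T j))"
proof -
  let ?X = "SIGMA j:{..d}. monomials_of_degree V (d - j) \<times> T j"
  let ?f = "\<lambda>(j, a, b). a + b :: nat \<Rightarrow>\<^sub>0 nat"
  have img: "{a + b | a b. Poly_Mapping.keys a \<subseteq> V \<and> b \<in> (\<Union>j. T j) \<and> mdeg (a + b) = d} = ?f ` ?X"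
  proof (rule equalityI; rule subsetI)
    fix m assume "m \<in> {a + b | a b. Poly_Mapping.keys a \<subseteq> V \<and> b \<in> (\<Union>j. T j) \<and> mdeg (a + b) = d}"
    then obtain a b j where m: "m = a + b" "Poly_Mapping.keys a \<subseteq> V" "b \<in> T j" "mdeg (a + b) = d" by blast
    then have "mdeg a + j = d" using T[of b j] by (simp add: mdeg_add)
    then have "(j, a, b) \<in> ?X" using m by (auto simp: monomials_of_degree_def)
    then show "m \<in> ?f ` ?X" using m(1) by (intro rev_image_eqI[of "(j, a, b)"]) simp_all
  next
    fix m assume "m \<in> ?f ` ?X"
    then obtain j a b where m: "m = a + b" "j \<le> d" "a \<in> monomials_of_degree V (d - j)" "b \<in> T j" by auto
    then have "mdeg (a + b) = d" using T[of b j] by (simp add: mdeg_add monomials_of_degree_def)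
    then show "m \<in> {a + b | a b. Poly_Mapping.keys a \<subseteq> V \<and> b \<in> (\<Union>j. T j) \<and> mdeg (a + b) = d}"
      using m by (auto simp: monomials_of_degree_def)
  qed
  have inj: "inj_on ?f ?X"
  proof (rule inj_onI)
    fix x y assume x: "x \<in> ?X" and y: "y \<in> ?X" and eq: "?f x = ?f y"
    obtain j a b where xx: "x = (j, a, b)" by (cases x)
    obtain j' a' b' where yy: "y = (j', a', b')" by (cases y)
    have ka: "Poly_Mapping.keys a \<subseteq> V" "Poly_Mapping.keys a' \<subseteq> V" and b: "b \<in> T j" "b' \<in> T j'"
      using x y by (simp_all add: xx yy monomials_of_degree_def)
    have kb: "Poly_Mapping.keys b \<inter> V = {}" "Poly_Mapping.keys b' \<inter> V = {}" using T b by blast+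
    have "discard V (a + b) = b" "discard V (a' + b') = b'"
      using ka kb by (simp_all add: discard_add discard_eq_0 discard_id)
    then have "b = b'" using eq by (simp add: xx yy)
    then show "x = y" using eq T[OF b(1)] T[OF b(2)] by (simp add: xx yy)
  qed
  have finX: "finite ?X" using finite_monomials_of_degree[OF V] fin by (intro finite_SigmaI) auto
  show "finite {a + b | a b. Poly_Mapping.keys a \<subseteq> V \<and> b \<in> (\<Union>j. T j) \<and> mdeg (a + b) = d}"
    unfolding img using finX by (rule finite_imageI)
  show "card {a + b | a b. Poly_Mapping.keys a \<subseteq> V \<and> b \<in> (\<Union>j. T j) \<and> mdeg (a + b) = d}
      = (\<Sum>j\<le>d. card (monomials_of_degree V (d - j)) * card (T j))"
    unfolding img card_image[OF inj]
    using finite_monomials_of_degree[OF V] fin by (subst card_SigmaI) (auto simp: card_cartesian_product)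
qed

lemma monomials_of_degree_Un:
  assumes "V \<inter> W = {}"
  shows "monomials_of_degree (V \<union> W) d
    = {a + b | a b. Poly_Mapping.keys a \<subseteq> V \<and> b \<in> (\<Union>j. monomials_of_degree W j) \<and> mdeg (a + b) = d}"
proof (rule equalityI; rule subsetI)
  fix m assume m: "m \<in> monomials_of_degree (V \<union> W) d"
  have "m = discard W m + discard V m"
  proof (rule poly_mapping_eqI)
    fix i
    have "i \<notin> V \<union> W \<Longrightarrow> Poly_Mapping.lookup m i = 0" using m by (auto simp: monomials_of_degree_def in_keys_iff)
    then show "Poly_Mapping.lookup m i = Poly_Mapping.lookup (discard W m + discard V m) i"
      using assms by (auto simp: lookup_add lookup_discard)
  qed
  moreover have "Poly_Mapping.keys (discard W m) \<subseteq> V" "Poly_Mapping.keys (discard V m) \<subseteq> W" "mdeg m = d"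
    using m by (auto simp: monomials_of_degree_def keys_discard)
  moreover from this have "discard V m \<in> (\<Union>j. monomials_of_degree W j)" by (auto simp: monomials_of_degree_def)
  ultimately show "m \<in> {a + b | a b. Poly_Mapping.keys a \<subseteq> V \<and> b \<in> (\<Union>j. monomials_of_degree W j) \<and> mdeg (a + b) = d}"
    by (intro CollectI exI[of _ "discard W m"] exI[of _ "discard V m"] conjI) simp_all
next
  fix m assume "m \<in> {a + b | a b. Poly_Mapping.keys a \<subseteq> V \<and> b \<in> (\<Union>j. monomials_of_degree W j) \<and> mdeg (a + b) = d}"
  then show "m \<in> monomials_of_degree (V \<union> W) d"
    by (auto simp: monomials_of_degree_def keys_add_nat)
qed

lemma card_monomials_of_degree_fps:
  assumes "finite V"
  shows "Abs_fps (\<lambda>d. int (card (monomials_of_degree V d))) = geom ^ card V"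
  using assms
proof (induction V)
  case empty
  have "monomials_of_degree {} d = (if d = 0 then {0} else {})" for d
    by (auto simp: monomials_of_degree_def)
  then show ?case by (intro fps_ext) (simp add: fps_one_nth)
next
  case (insert v V)
  have single: "card (monomials_of_degree {v} d) = 1" for d
  proof -
    have "monomials_of_degree {v} d = {Poly_Mapping.single v d}"
    proof (rule equalityI; rule subsetI)
      fix m assume m: "m \<in> monomials_of_degree {v} d"
      have "m = Poly_Mapping.single v (Poly_Mapping.lookup m v)"
        using m by (intro poly_mapping_eqI) (auto simp: monomials_of_degree_def lookup_single when_def in_keys_iff)
      moreover from this have "Poly_Mapping.lookup m v = d"
        using m mdeg_single by (metis (mono_tags, lifting) mem_Collect_eq monomials_of_degree_def)
      ultimately show "m \<in> {Poly_Mapping.single v d}" by simp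
    qed (auto simp: monomials_of_degree_def)
    then show ?thesis by simp
  qed
  have "int (card (monomials_of_degree (insert v V) d)) = fps_nth (geom * geom ^ card V) d" for d
  proof -
    have disj: "{v} \<inter> V = {}" using insert.hyps by simp
    have "card (monomials_of_degree ({v} \<union> V) d)
        = (\<Sum>j\<le>d. card (monomials_of_degree {v} (d - j)) * card (monomials_of_degree V j))"
      unfolding monomials_of_degree_Un[OF disj]
      by (rule card_graded_product(2)) (use insert.hyps finite_monomials_of_degree in \<open>auto simp: monomials_of_degree_def\<close>)
    also have "\<dots> = (\<Sum>j\<le>d. card (monomials_of_degree V j))" by (simp only: single mult_1)
    finally have "int (card (monomials_of_degree ({v} \<union> V) d)) = (\<Sum>j\<le>d. int (card (monomials_of_degree V j)))"
      by simp
    also have "\<dots> = (\<Sum>j\<le>d. fps_nth (geom ^ card V) j)"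
      by (simp flip: insert.IH)
    finally show ?thesis by (simp add: fps_mult_nth mult.commute[of geom] atLeast0AtMost)
  qed
  then show ?case using insert.hyps by (intro fps_ext) simp
qed

lemma card_monomials_of_degree:
  "finite V \<Longrightarrow> int (card (monomials_of_degree V d)) = fps_nth (geom ^ card V) d"
  by (simp flip: card_monomials_of_degree_fps)

definition high_monomials :: "nat \<Rightarrow> nat \<Rightarrow> (nat \<Rightarrow>\<^sub>0 nat) set" where
  "high_monomials n t = {m. Poly_Mapping.keys m \<subseteq> {..<n} \<and> t \<le> mdeg m}"

definition high_ideal :: "nat \<Rightarrow> nat \<Rightarrow> 'a::field mpoly set" where
  "high_ideal n t = {p. Poly_Mapping.keys p \<subseteq> high_monomials n t}"

lemma high_ideal_carrier: "high_ideal n t \<subseteq> carrier (mpoly_ring n)"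
  by (auto simp: high_ideal_def high_monomials_def mpoly_carrier_iff subset_iff)

lemma high_ideal_mult:
  assumes "p \<in> high_ideal n s" "q \<in> high_ideal n t"
  shows "p * q \<in> high_ideal n (s + t)"
  unfolding high_ideal_def
proof (rule CollectI, rule subsetI)
  fix m assume "m \<in> Poly_Mapping.keys (p * q)"
  then obtain a b where "m = a + b" "a \<in> Poly_Mapping.keys p" "b \<in> Poly_Mapping.keys q" by (rule keys_mult_cases)
  moreover from this have "a \<in> high_monomials n s" "b \<in> high_monomials n t" using assms by (auto simp: high_ideal_def)
  ultimately show "m \<in> high_monomials n (s + t)" by (simp add: high_monomials_def keys_add_nat mdeg_add)
qed

lemma high_ideal_0: "high_ideal n 0 = carrier (mpoly_ring n)"
  by (auto simp: high_ideal_def high_monomials_def mpoly_carrier_iff subset_iff)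

lemma high_ideal_add: "p \<in> high_ideal n t \<Longrightarrow> q \<in> high_ideal n t \<Longrightarrow> p + q \<in> high_ideal n t"
  using Poly_Mapping.keys_add[of p q] by (auto simp: high_ideal_def)

lemma high_ideal_ideal: "ideal (high_ideal n t :: 'a::field mpoly set) (mpoly_ring n)"
proof -
  interpret R: cring "mpoly_ring n :: 'a mpoly ring" by (rule cring_mpoly_ring)
  have neg: "\<ominus>\<^bsub>mpoly_ring n\<^esub> p = - p" if "p \<in> carrier (mpoly_ring n)" for p :: "'a mpoly"
    using that by (intro R.minus_equality) (simp_all add: add_mpoly_ring zero_mpoly_ring)
  show ?thesis
  proof (rule idealI)
    show "Ring.ring (mpoly_ring n :: 'a mpoly ring)" by (rule R.ring_axioms)
    show "subgroup (high_ideal n t :: 'a mpoly set) (add_monoid (mpoly_ring n))"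
    proof (rule R.add.subgroupI)
      have "0 \<in> (high_ideal n t :: 'a mpoly set)" by (simp add: high_ideal_def)
      then show "(high_ideal n t :: 'a mpoly set) \<noteq> {}" by blast
      fix p q :: "'a mpoly" assume p: "p \<in> high_ideal n t"
      then have "p \<in> carrier (mpoly_ring n)" using high_ideal_carrier by blast
      then show "\<ominus>\<^bsub>mpoly_ring n\<^esub> p \<in> high_ideal n t" using p by (simp add: neg high_ideal_def)
      assume "q \<in> high_ideal n t"
      then show "p \<oplus>\<^bsub>mpoly_ring n\<^esub> q \<in> high_ideal n t" using p by (simp add: add_mpoly_ring high_ideal_add)
    qed (rule high_ideal_carrier)
    fix p q :: "'a mpoly" assume "p \<in> high_ideal n t" "q \<in> carrier (mpoly_ring n)"
    then show "q \<otimes>\<^bsub>mpoly_ring n\<^esub> p \<in> high_ideal n t" "p \<otimes>\<^bsub>mpoly_ring n\<^esub> q \<in> high_ideal n t"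
      using high_ideal_mult[of q n 0 p t] by (simp_all add: high_ideal_0 mult_mpoly_ring mult.commute)
  qed
qed

lemma high_monomials_Suc:
  assumes "m \<in> high_monomials n (Suc t)"
  shows "\<exists>i<n. \<exists>k\<in>high_monomials n t. m = k + Poly_Mapping.single i 1"
proof -
  obtain g l where gl: "m = l + g" "mdeg g = 1"
    using exists_divisor_of_degree[of 1 m] assms by (auto simp: high_monomials_def)
  then obtain i where i: "i \<in> Poly_Mapping.keys g" by (metis all_not_in_conv mdeg_0 keys_eq_empty zero_neq_one)
  define k where "k = m - Poly_Mapping.single i 1"
  have "i \<in> Poly_Mapping.keys m" using gl i by (simp add: keys_add_nat)
  then have m: "m = k + Poly_Mapping.single i 1"
    unfolding k_def by (intro poly_mapping_eqI) (auto simp: lookup_add lookup_minus lookup_single when_def in_keys_iff)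
  then have "i < n" "k \<in> high_monomials n t" using assms by (auto simp: high_monomials_def keys_add_nat mdeg_add)
  then show ?thesis using m by blast
qed

lemma max_ideal_eq: "(max_ideal n :: 'a::field mpoly set) = high_ideal n 1"
proof
  interpret R: cring "mpoly_ring n :: 'a mpoly ring" by (rule cring_mpoly_ring)
  have "(mvar ` {..<n} :: 'a mpoly set) \<subseteq> high_ideal n 1"
    by (auto simp: mvar_def high_ideal_def high_monomials_def)
  then show "(max_ideal n :: 'a mpoly set) \<subseteq> high_ideal n 1"
    unfolding max_ideal_def by (rule R.genideal_minimal[OF high_ideal_ideal])
  have sub: "(mvar ` {..<n} :: 'a mpoly set) \<subseteq> carrier (mpoly_ring n)"
    using mvar_in_carrier by blast
  interpret I: ideal "max_ideal n :: 'a mpoly set" "mpoly_ring n"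
    unfolding max_ideal_def using sub by (rule R.genideal_ideal)
  show "high_ideal n 1 \<subseteq> (max_ideal n :: 'a mpoly set)"
  proof
    fix p :: "'a mpoly" assume "p \<in> high_ideal n 1"
    then have "Poly_Mapping.keys p \<subseteq> high_monomials n (Suc 0)" by (simp add: high_ideal_def)
    then show "p \<in> max_ideal n"
    proof (induction p rule: mpoly_monomial_induct)
      case zero
      show ?case using I.zero_closed by (simp add: zero_mpoly_ring)
    next
      case (single m c)
      obtain i k where ik: "i < n" "k \<in> high_monomials n 0" "m = k + Poly_Mapping.single i 1"
        using high_monomials_Suc[OF single] by blast
      have "mvar i \<in> (max_ideal n :: 'a mpoly set)"
        unfolding max_ideal_def using R.genideal_self[OF sub] ik(1) by blast
      then have "Poly_Mapping.single k c \<otimes>\<^bsub>mpoly_ring n\<^esub> mvar i \<in> max_ideal n"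
        using ik(2) by (intro I.I_l_closed) (auto simp: high_monomials_def)
      then show ?case by (simp add: mult_mpoly_ring mvar_def mult_single ik(3))
    next
      case (add p q)
      then show ?case using I.a_closed[of p q] by (simp add: add_mpoly_ring)
    qed
  qed
qed

lemma max_ideal_power:
  "(max_ideal n :: 'a::field mpoly set) [^]\<^bsub>ideals_set (mpoly_ring n)\<^esub> t = high_ideal n t"
proof (induction t)
  case 0
  show ?case by (simp add: nat_pow_def ideals_set_def high_ideal_0)
next
  case (Suc t)
  have "ideal_prod (mpoly_ring n) (high_ideal n t) (high_ideal n 1) = (high_ideal n (Suc t) :: 'a mpoly set)"
  proof (rule equalityI; rule subsetI)
    fix p :: "'a mpoly" assume "p \<in> ideal_prod (mpoly_ring n) (high_ideal n t) (high_ideal n 1)"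
    then show "p \<in> high_ideal n (Suc t)"
    proof (induction p rule: ideal_prod.induct)
      case (prod i j)
      then show ?case using high_ideal_mult[of i n t j 1] by (simp add: mult_mpoly_ring)
    next
      case (sum p q)
      then show ?case using high_ideal_add by (simp add: add_mpoly_ring)
    qed
  next
    fix p :: "'a mpoly" assume "p \<in> high_ideal n (Suc t)"
    then have "Poly_Mapping.keys p \<subseteq> high_monomials n (Suc t)" by (simp add: high_ideal_def)
    then show "p \<in> ideal_prod (mpoly_ring n) (high_ideal n t) (high_ideal n 1)"
    proof (induction p rule: mpoly_monomial_induct)
      case zero
      show ?case using ideal_prod.prod[of 0 "high_ideal n t" 0 "high_ideal n 1 :: 'a mpoly set" "mpoly_ring n"]
        by (simp add: mult_mpoly_ring high_ideal_def)
    next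
      case (single m c)
      obtain i k where ik: "i < n" "k \<in> high_monomials n t" "m = k + Poly_Mapping.single i 1"
        using high_monomials_Suc[OF single] by blast
      have "Poly_Mapping.single k c \<otimes>\<^bsub>mpoly_ring n\<^esub> mvar i \<in> ideal_prod (mpoly_ring n) (high_ideal n t) (high_ideal n 1)"
        using ik by (intro ideal_prod.prod) (auto simp: high_ideal_def mvar_def high_monomials_def)
      then show ?case by (simp add: mult_mpoly_ring mvar_def mult_single ik(3))
    next
      case (add p q)
      then show ?case using ideal_prod.sum[of p "mpoly_ring n"] by (simp add: add_mpoly_ring)
    qed
  qed
  then show ?case using Suc by (simp add: nat_pow_def ideals_set_def max_ideal_eq)
qed

lemma graded_ideal_high_ideal:
  "graded_ideal n (high_ideal n t :: 'a::field mpoly set) = monomial_module (high_monomials n t) {}"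
proof -
  have "discard {} p = (p :: 'a mpoly)" for p by (rule discard_id) simp
  moreover have "high_ideal n t \<inter> mpoly_homog n d
      = {p :: 'a mpoly. Poly_Mapping.keys p \<subseteq> high_monomials n t \<and> (\<forall>m\<in>Poly_Mapping.keys p. int (mdeg m) = d)}" for d
    by (auto simp: high_ideal_def mpoly_homog_def high_monomials_def mpoly_carrier_iff)
  ultimately show ?thesis
    unfolding graded_ideal_def monomial_module_def by (simp add: high_ideal_def)
qed

lemma subquotient_high_monomials: "monomial_subquotient n (high_monomials n t) {}"
  by unfold_locales (auto simp: high_monomials_def keys_add_nat mdeg_add)

lemma fg_high_ideal:
  "fg_graded_module n (graded_ideal n (high_ideal n t :: 'a::field mpoly set))"
  unfolding graded_ideal_high_ideal
proof (rule monomial_subquotient.fg_graded_monomial_module[OF subquotient_high_monomials])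
  show "finite (monomials_of_degree {..<n} t)" by (rule finite_monomials_of_degree) simp
  show "monomials_of_degree {..<n} t \<subseteq> high_monomials n t"
    by (auto simp: monomials_of_degree_def high_monomials_def)
  fix b assume b: "b \<in> high_monomials n t"
  then obtain g l where gl: "b = l + g" "mdeg g = t"
    using exists_divisor_of_degree[of t b] by (auto simp: high_monomials_def)
  then have "g \<in> monomials_of_degree {..<n} t" "Poly_Mapping.keys l \<subseteq> {..<n}"
    using b by (auto simp: high_monomials_def monomials_of_degree_def keys_add_nat)
  then show "\<exists>g\<in>monomials_of_degree {..<n} t. \<exists>k. Poly_Mapping.keys k \<subseteq> {..<n} \<and> b = k + g"
    using gl(1) by blast
qed

lemma high_monomials_of_degree:
  "{b \<in> high_monomials n t. int (mdeg b) = d} = (if int t \<le> d then monomials_of_degree {..<n} (nat d) else {})"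
  by (auto simp: high_monomials_def monomials_of_degree_def)

lemma dim_high_ideal:
  "int (vectorspace.dim class_ring (component_space (graded_ideal n (high_ideal n t :: 'a::field mpoly set)) d))
    = (if int t \<le> d then fps_nth (geom ^ n) (nat d) else 0)"
  unfolding graded_ideal_high_ideal
  by (subst monomial_subquotient.dim_component_monomial_module[OF subquotient_high_monomials])
    (simp_all add: high_monomials_of_degree finite_monomials_of_degree card_monomials_of_degree)

section \<open>A module of large depth\<close>

text \<open>The series \<open>(1 - z)\<^sup>r H\<close>, where \<open>H\<close> is the Hilbert series of the \<open>t\<close>-th power of the maximal ideal.\<close>

definition numerator :: "nat \<Rightarrow> nat \<Rightarrow> nat \<Rightarrow> int fps" where
  "numerator n t r = (1 - fps_X) ^ r * Abs_fps (\<lambda>d. if d < t then 0 else fps_nth (geom ^ n) d)"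

lemma numerator_nth:
  assumes "t \<le> j"
  shows "fps_nth (numerator n t r) j = (\<Sum>i\<le>j - t. (- 1) ^ i * int (r choose i) * fps_nth (geom ^ n) (j - i))"
proof -
  have "fps_nth (numerator n t r) j
      = (\<Sum>i\<le>j. (- 1) ^ i * int (r choose i) * (if j - i < t then 0 else fps_nth (geom ^ n) (j - i)))"
    by (simp add: numerator_def fps_mult_nth one_minus_X_power_nth atLeast0AtMost)
  also have "\<dots> = (\<Sum>i\<le>j - t. (- 1) ^ i * int (r choose i) * fps_nth (geom ^ n) (j - i))"
    by (rule sum.mono_neutral_cong_right) (use assms in auto)
  finally show ?thesis .
qed

lemma numerator_nth_low: "j < t \<Longrightarrow> fps_nth (numerator n t r) j = 0"
  by (simp add: numerator_def fps_mult_nth)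

text \<open>From here on all nonzero terms of the alternating sum for \<open>1/(1 - z)\<^bsup>n-r\<^esup>\<close> are present.\<close>

lemma numerator_nth_high:
  assumes "t + r \<le> j" "r \<le> n"
  shows "fps_nth (numerator n t r) j = fps_nth (geom ^ (n - r)) j"
proof -
  have "fps_nth (geom ^ (n - r)) j = fps_nth ((1 - fps_X) ^ r * geom ^ n) j"
    by (simp add: one_minus_X_power_geom_power[OF assms(2)])
  also have "\<dots> = (\<Sum>i\<le>j. (- 1) ^ i * int (r choose i) * fps_nth (geom ^ n) (j - i))"
    by (simp add: fps_mult_nth one_minus_X_power_nth atLeast0AtMost)
  also have "\<dots> = (\<Sum>i\<le>j - t. (- 1) ^ i * int (r choose i) * fps_nth (geom ^ n) (j - i))"
    by (rule sum.mono_neutral_right) (use assms(1) in \<open>auto simp: binomial_eq_0\<close>)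
  finally show ?thesis using numerator_nth[of t j n r] assms(1) by simp
qed

lemma geom_numerator: "geom ^ r * numerator n t r = Abs_fps (\<lambda>d. if d < t then 0 else fps_nth (geom ^ n) d)"
proof -
  have "geom ^ r * (1 - fps_X) ^ r = 1"
    using one_minus_X_power_geom_power[of r r] by (simp add: mult.commute)
  then show ?thesis unfolding numerator_def by (simp flip: mult.assoc)
qed

text \<open>The condition \<open>1 \<le> t\<close> ensures that a power of a label variable with exponent at least \<open>t\<close> really contains that
  variable.\<close>

locale depth_witness =
  fixes n t r :: nat
  assumes r: "1 \<le> r" "r \<le> n" and t: "1 \<le> t"
    and nonneg: "\<And>j. 0 \<le> fps_nth (numerator n t r) j"
begin

definition mult_at :: "nat \<Rightarrow> nat" where "mult_at j = nat (fps_nth (numerator n t r) j)"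

text \<open>The basis of the module over \<open>K[x\<^sub>0, \<dots>, x\<^bsub>r-1\<^esub>]\<close>, degree by degree. For \<open>t \<le> j < t + r\<close> the
  free summands are generated by \<open>j\<close>-th powers of label variables, so that the generator has degree \<open>j\<close>; from degree
  \<open>t + r\<close> on the basis elements are the monomials in the remaining variables.\<close>

definition tails :: "nat \<Rightarrow> (nat \<Rightarrow>\<^sub>0 nat) set" where
  "tails j = (if j < t then {} else if j < t + r then (\<lambda>k. Poly_Mapping.single (n + k) j) ` {..<mult_at j}
    else monomials_of_degree {r..<n} j)"

definition basis_monomials :: "(nat \<Rightarrow>\<^sub>0 nat) set" where
  "basis_monomials = {a + b | a b. Poly_Mapping.keys a \<subseteq> {..<r} \<and> b \<in> (\<Union>j. tails j)}"

text \<open>The variables \<open>x\<^sub>r, \<dots>, x\<^bsub>n-1\<^esub>\<close> act as zero on every labelled summand.\<close>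

definition killed :: "(nat \<Rightarrow>\<^sub>0 nat) set" where
  "killed = {m. Poly_Mapping.keys m \<inter> {n..} \<noteq> {} \<and> Poly_Mapping.keys m \<inter> {r..<n} \<noteq> {}}"

lemma tails_cases:
  assumes "b \<in> tails j"
  obtains (generator) k where "b = Poly_Mapping.single (n + k) j" "t \<le> j" "j < t + r" "k < mult_at j"
  | (ideal) "Poly_Mapping.keys b \<subseteq> {r..<n}" "mdeg b = j" "t + r \<le> j"
  using assms unfolding tails_def monomials_of_degree_def by (auto split: if_splits)

lemma tails_props:
  assumes "b \<in> tails j"
  shows "Poly_Mapping.keys b \<inter> {..<r} = {}" "mdeg b = j"
  using assms r by (cases rule: tails_cases; force)+

lemma finite_tails: "finite (tails j)"
  unfolding tails_def using finite_monomials_of_degree by auto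

lemma card_tails: "int (card (tails j)) = fps_nth (numerator n t r) j"
proof -
  consider "j < t" | "t \<le> j" "j < t + r" | "t + r \<le> j" by linarith
  then show ?thesis
  proof cases
    case 1
    then show ?thesis by (simp add: tails_def numerator_nth_low)
  next
    case 2
    have "inj_on (\<lambda>k. Poly_Mapping.single (n + k) j) {..<mult_at j}"
    proof (rule inj_onI)
      fix k k' assume "Poly_Mapping.single (n + k) j = Poly_Mapping.single (n + k') j"
      then have "Poly_Mapping.keys (Poly_Mapping.single (n + k) j) = Poly_Mapping.keys (Poly_Mapping.single (n + k') j)"
        by simp
      then show "k = k'" using t 2 by simp
    qed
    then have "card (tails j) = mult_at j" using 2 by (simp add: tails_def card_image)
    then show ?thesis using nonneg[of j] by (simp add: mult_at_def)
  next
    case 3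
    then show ?thesis using card_monomials_of_degree[of "{r..<n}" j] r by (simp add: tails_def numerator_nth_high)
  qed
qed

lemma subquotient: "monomial_subquotient n basis_monomials killed"
proof
  show "basis_monomials \<inter> killed = {}"
  proof (rule ccontr)
    assume "basis_monomials \<inter> killed \<noteq> {}"
    then obtain a b j where ab: "Poly_Mapping.keys a \<subseteq> {..<r}" "b \<in> tails j" "a + b \<in> killed"
      unfolding basis_monomials_def by blast
    have b: "Poly_Mapping.keys b \<inter> {n..} \<noteq> {}" "Poly_Mapping.keys b \<inter> {r..<n} \<noteq> {}"
      using ab(1,3) r by (auto simp: killed_def keys_add_nat)
    from ab(2) show False
    proof (cases rule: tails_cases)
      case (generator k)
      then show False using b(2) by (simp split: if_splits)
    next
      case ideal
      then show False using b(1) by fastforce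
    qed
  qed
  fix k m :: "nat \<Rightarrow>\<^sub>0 nat" assume k: "Poly_Mapping.keys k \<subseteq> {..<n}"
  {
    assume "m \<in> killed"
    then show "k + m \<in> killed" by (auto simp: killed_def keys_add_nat)
  }
  assume "m \<in> basis_monomials"
  then obtain a b j where m: "m = a + b" "Poly_Mapping.keys a \<subseteq> {..<r}" "b \<in> tails j"
    unfolding basis_monomials_def by blast
  from m(3) show "k + m \<in> basis_monomials \<union> killed"
  proof (cases rule: tails_cases)
    case (generator l)
    show ?thesis
    proof (cases "Poly_Mapping.keys k \<subseteq> {..<r}")
      case True
      then have "Poly_Mapping.keys (k + a) \<subseteq> {..<r}" using m(2) by (simp add: keys_add_nat)
      moreover have "k + m = (k + a) + b" using m(1) by (simp add: add.assoc)
      ultimately show ?thesis using m(3) unfolding basis_monomials_def by blast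
    next
      case False
      then have "Poly_Mapping.keys k \<inter> {r..<n} \<noteq> {}" using k by fastforce
      moreover have "n + l \<in> Poly_Mapping.keys b" using generator t by simp
      ultimately show ?thesis using m(1) by (auto simp: killed_def keys_add_nat)
    qed
  next
    case ideal
    define k1 k2 where "k1 = discard {r..} k" and "k2 = discard {..<r} k"
    have "k = k1 + k2"
      by (rule poly_mapping_eqI) (simp add: k1_def k2_def lookup_add lookup_discard)
    then have "k + m = (k1 + a) + (k2 + b)" using m(1) by (simp add: ac_simps)
    moreover have "Poly_Mapping.keys (k1 + a) \<subseteq> {..<r}"
      using m(2) by (auto simp: keys_add_nat k1_def keys_discard)
    moreover have "k2 + b \<in> tails (mdeg (k2 + b))"
      using ideal k by (auto simp: tails_def monomials_of_degree_def keys_add_nat mdeg_add k2_def keys_discard)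
    ultimately show ?thesis unfolding basis_monomials_def by blast
  qed
qed

sublocale monomial_subquotient n basis_monomials killed
  by (rule subquotient)

lemma fg_graded: "fg_graded_module n (monomial_module basis_monomials killed :: ('a::field mpoly, 'a mpoly) gmodule)"
proof (rule fg_graded_monomial_module)
  let ?G = "\<Union>j\<le>t + r. tails j"
  show "finite ?G" using finite_tails by blast
  have tail: "b \<in> basis_monomials" if "b \<in> tails j" for b j
    unfolding basis_monomials_def using that by (intro CollectI exI[of _ 0] exI[of _ b]) auto
  then show "?G \<subseteq> basis_monomials" by blast
  fix m assume "m \<in> basis_monomials"
  then obtain a b j where m: "m = a + b" "Poly_Mapping.keys a \<subseteq> {..<r}" "b \<in> tails j"
    unfolding basis_monomials_def by blast
  have a: "Poly_Mapping.keys a \<subseteq> {..<n}" using m(2) r(2) by auto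
  from m(3) show "\<exists>g\<in>?G. \<exists>k. Poly_Mapping.keys k \<subseteq> {..<n} \<and> m = k + g"
  proof (cases rule: tails_cases)
    case (generator k)
    then have "b \<in> ?G" using m(3) by auto
    then show ?thesis using m(1) a by blast
  next
    case ideal
    then obtain g l where gl: "b = l + g" "mdeg g = t + r" using exists_divisor_of_degree[of "t + r" b] by auto
    then have "Poly_Mapping.keys g \<subseteq> {r..<n}" "Poly_Mapping.keys l \<subseteq> {r..<n}" using ideal(1) by (simp_all add: keys_add_nat)
    then have "g \<in> tails (t + r)" "Poly_Mapping.keys (a + l) \<subseteq> {..<n}"
      using gl(2) a by (auto simp: tails_def monomials_of_degree_def keys_add_nat)
    moreover have "m = (a + l) + g" using m(1) gl(1) by (simp add: add.assoc)
    ultimately show ?thesis by blast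
  qed
qed

lemma dim_component:
  "int (vectorspace.dim class_ring (component_space (monomial_module basis_monomials killed :: ('a::field mpoly, 'a mpoly) gmodule) d))
    = (if int t \<le> d then fps_nth (geom ^ n) (nat d) else 0)"
proof -
  have eq: "{b \<in> basis_monomials. int (mdeg b) = d}
      = (if 0 \<le> d then {a + b | a b. Poly_Mapping.keys a \<subseteq> {..<r} \<and> b \<in> (\<Union>j. tails j) \<and> mdeg (a + b) = nat d} else {})"
  proof (cases "0 \<le> d")
    case True
    then have "int (mdeg m) = d \<longleftrightarrow> mdeg m = nat d" for m by auto
    then show ?thesis unfolding basis_monomials_def if_P[OF True] by (simp only:) blast
  qed auto
  have props: "Poly_Mapping.keys b \<inter> {..<r} = {} \<and> mdeg b = j" if "b \<in> tails j" for b j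
    using tails_props[OF that] by blast
  note prod = card_graded_product[of "{..<r}" tails, OF finite_lessThan props finite_tails]
  have "vectorspace.dim class_ring (component_space (monomial_module basis_monomials killed :: ('a mpoly, 'a mpoly) gmodule) d)
      = card {b \<in> basis_monomials. int (mdeg b) = d}"
    by (rule dim_component_monomial_module) (simp only: eq prod(1) finite.emptyI if_split, simp)
  moreover have "int (card {b \<in> basis_monomials. int (mdeg b) = d}) = (if int t \<le> d then fps_nth (geom ^ n) (nat d) else 0)"
  proof (cases "0 \<le> d")
    case True
    have "int (card {b \<in> basis_monomials. int (mdeg b) = d})
        = (\<Sum>j\<le>nat d. int (card (monomials_of_degree {..<r} (nat d - j))) * int (card (tails j)))"
      using prod(2)[of "nat d"] unfolding eq if_P[OF True] by simp
    also have "\<dots> = (\<Sum>j\<le>nat d. fps_nth (numerator n t r) j * fps_nth (geom ^ r) (nat d - j))"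
      by (simp add: card_monomials_of_degree card_tails mult.commute)
    also have "\<dots> = fps_nth (numerator n t r * geom ^ r) (nat d)"
      by (simp only: fps_mult_nth atLeast0AtMost)
    also have "\<dots> = (if nat d < t then 0 else fps_nth (geom ^ n) (nat d))"
      by (subst mult.commute) (simp add: geom_numerator)
    finally show ?thesis using True by auto
  qed (simp add: eq)
  ultimately show ?thesis by simp
qed

lemma times_variable:
  fixes v :: "'a::field mpoly"
  assumes i: "i < r" and v: "Poly_Mapping.keys v \<subseteq> basis_monomials"
  shows "discard killed (mvar i * v) = mvar i * v" "Poly_Mapping.keys (mvar i * v) \<subseteq> basis_monomials"
proof -
  show keys: "Poly_Mapping.keys (mvar i * v) \<subseteq> basis_monomials"
  proof
    fix m assume "m \<in> Poly_Mapping.keys (mvar i * v)"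
    then obtain x b where xb: "m = x + b" "x \<in> Poly_Mapping.keys (mvar i :: 'a mpoly)" "b \<in> Poly_Mapping.keys v"
      by (rule keys_mult_cases)
    have "x = Poly_Mapping.single i 1" using xb(2) by (simp add: mvar_def)
    note b = xb(1)[unfolded this] xb(3)
    have "b \<in> basis_monomials" by (rule subsetD[OF v b(2)])
    then obtain a c where ac: "b = a + c" "Poly_Mapping.keys a \<subseteq> {..<r}" "c \<in> (\<Union>j. tails j)"
      unfolding basis_monomials_def by blast
    have "m = (Poly_Mapping.single i 1 + a) + c" using b(1) ac(1) by (simp add: add.assoc)
    moreover have "Poly_Mapping.keys (Poly_Mapping.single i 1 + a) \<subseteq> {..<r}"
      using ac(2) i by (simp add: keys_add_nat)
    ultimately show "m \<in> basis_monomials" using ac(3) unfolding basis_monomials_def by blast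
  qed
  have "Poly_Mapping.keys (mvar i * v) \<inter> killed \<subseteq> {}"
    using Int_mono[OF keys subset_refl[of killed]] unfolding disjoint .
  then show "discard killed (mvar i * v) = mvar i * v"
    by (intro discard_id) (simp only: subset_empty)
qed

text \<open>The basis is closed under multiplication by the first \<open>r\<close> variables, and under division by them as long as the
  exponents permit, so the submodule is spanned by monomials as well.\<close>

lemma list_smult_variables:
  assumes "i \<le> r"
  shows "list_smult (monomial_module basis_monomials killed :: ('a::field mpoly, 'a mpoly) gmodule) (map mvar [0..<i])
    = {v. Poly_Mapping.keys v \<subseteq> {m \<in> basis_monomials. Poly_Mapping.keys m \<inter> {..<i} \<noteq> {}}}"
  using assms
proof (induction i)
  case 0
  interpret graded_module n "monomial_module basis_monomials killed :: ('a mpoly, 'a mpoly) gmodule"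
    by (rule graded_monomial_module)
  show ?case using list_smult_foldl[of "[]"] by simp
next
  case (Suc i)
  let ?M = "monomial_module basis_monomials killed :: ('a mpoly, 'a mpoly) gmodule"
  interpret graded_module n ?M by (rule graded_monomial_module)
  define L where "L i = {m \<in> basis_monomials. Poly_Mapping.keys m \<inter> {..<i} \<noteq> {}}" for i
  have i: "i < r" "i < n" using Suc.prems r by auto
  have carr: "set (map mvar [0..<i]) \<subseteq> carrier R" using i by auto
  have IH: "list_smult ?M (map mvar [0..<i]) = {v. Poly_Mapping.keys v \<subseteq> L i}"
    using Suc by (simp add: L_def)
  have sub: "submodule R {v. Poly_Mapping.keys v \<subseteq> L i} ?M"
  proof -
    have "submodule R (foldl extend {\<zero>\<^bsub>?M\<^esub>} (map mvar [0..<i])) ?M"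
    proof -
      have "submodule R (foldl extend U fs) ?M" if "set fs \<subseteq> carrier R" "submodule R U ?M" for fs U
        using that by (induction fs arbitrary: U) (auto intro: extend_submodule)
      then show ?thesis using carr zero_submodule by blast
    qed
    then show ?thesis using IH list_smult_foldl[OF carr] by simp
  qed
  have "list_smult ?M (map mvar [0..<Suc i]) = extend {v. Poly_Mapping.keys v \<subseteq> L i} (mvar i)"
    using list_smult_snoc[OF carr mvar_in_carrier[OF i(2)]] IH by simp
  also have "\<dots> = {v. Poly_Mapping.keys v \<subseteq> L (Suc i)}"
  proof (rule equalityI; rule subsetI)
    fix x assume "x \<in> extend {v. Poly_Mapping.keys v \<subseteq> L i} (mvar i)"
    then obtain u v where uv: "Poly_Mapping.keys u \<subseteq> L i" "Poly_Mapping.keys v \<subseteq> basis_monomials" "x = u + mvar i * v"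
      unfolding extend_def by (auto simp: times_variable[OF i(1)])
    have "m \<in> L (Suc i)" if m: "m \<in> Poly_Mapping.keys (mvar i * v)" for m
    proof -
      obtain x b where xb: "m = x + b" "x \<in> Poly_Mapping.keys (mvar i :: 'a mpoly)" "b \<in> Poly_Mapping.keys v"
        using m by (rule keys_mult_cases)
      have "x = Poly_Mapping.single i 1" using xb(2) by (simp add: mvar_def)
      then have "i \<in> Poly_Mapping.keys m" by (simp add: xb(1) keys_add_nat)
      then show ?thesis using times_variable(2)[OF i(1) uv(2)] m by (auto simp: L_def)
    qed
    moreover have "L i \<subseteq> L (Suc i)" by (auto simp: L_def)
    ultimately show "x \<in> {v. Poly_Mapping.keys v \<subseteq> L (Suc i)}"
      using uv(1) unfolding uv(3) by (intro CollectI keys_add_subset) blast+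
  next
    fix p :: "'a mpoly" assume "p \<in> {v. Poly_Mapping.keys v \<subseteq> L (Suc i)}"
    then have "Poly_Mapping.keys p \<subseteq> L (Suc i)" by simp
    then show "p \<in> extend {v. Poly_Mapping.keys v \<subseteq> L i} (mvar i)"
    proof (induction p rule: mpoly_monomial_induct)
      case zero
      show ?case using submodule_zero[OF extend_submodule[OF sub mvar_in_carrier[OF i(2)]]] by simp
    next
      case (add p q)
      then show ?case using submodule_add[OF extend_submodule[OF sub mvar_in_carrier[OF i(2)]], of p q] by simp
    next
      case (single m c)
      show ?case
      proof (cases "m \<in> L i")
        case True
        then have "Poly_Mapping.single m c \<in> {v. Poly_Mapping.keys v \<subseteq> L i}" by simp
        then show ?thesis using subset_extend[OF sub mvar_in_carrier[OF i(2)]] by blast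
      next
        case False
        then have im: "i \<in> Poly_Mapping.keys m" using single by (auto simp: L_def less_Suc_eq)
        obtain a b where ab: "m = a + b" "Poly_Mapping.keys a \<subseteq> {..<r}" "b \<in> (\<Union>j. tails j)"
          using single unfolding L_def basis_monomials_def by blast
        have "i \<notin> Poly_Mapping.keys b" using ab(3) tails_props(1) i(1) by blast
        then have ia: "i \<in> Poly_Mapping.keys a" using im ab(1) by (simp add: keys_add_nat)
        define a' where "a' = a - Poly_Mapping.single i 1"
        have a: "a = Poly_Mapping.single i 1 + a'"
          using ia unfolding a'_def
          by (intro poly_mapping_eqI) (auto simp: lookup_add lookup_minus lookup_single when_def in_keys_iff)
        have "Poly_Mapping.keys a' \<subseteq> {..<r}" using ab(2) a by (simp add: keys_add_nat)
        then have "a' + b \<in> basis_monomials" using ab(3) unfolding basis_monomials_def by blast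
        then have v: "Poly_Mapping.keys (Poly_Mapping.single (a' + b) c) \<subseteq> basis_monomials" by simp
        have "mvar i \<odot>\<^bsub>?M\<^esub> Poly_Mapping.single (a' + b) c \<in> extend {v. Poly_Mapping.keys v \<subseteq> L i} (mvar i)"
          using v by (intro smult_in_extend[OF sub mvar_in_carrier[OF i(2)]]) simp
        moreover have "mvar i \<odot>\<^bsub>?M\<^esub> Poly_Mapping.single (a' + b) c = Poly_Mapping.single m c"
          using times_variable(1)[OF i(1) v] by (simp add: mvar_def mult_single ab(1) a add.assoc)
        ultimately show ?thesis by simp
      qed
    qed
  qed
  finally show ?case by (simp only: L_def)
qed

text \<open>The quotient by all \<open>r\<close> variables is nonzero because there are tails of degree \<open>t\<close>.\<close>

lemma regular_variables:
  "regular_sequence n (monomial_module basis_monomials killed :: ('a::field mpoly, 'a mpoly) gmodule) (map mvar [0..<r])"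
  unfolding regular_sequence_def
proof (intro conjI allI impI ballI)
  let ?M = "monomial_module basis_monomials killed :: ('a mpoly, 'a mpoly) gmodule"
  show "set (map mvar [0..<r]) \<subseteq> carrier (mpoly_ring n)" using r by auto
  fix i and v :: "'a mpoly"
  assume "i < length (map mvar [0..<r] :: 'a mpoly list)" and v: "v \<in> carrier ?M"
    and iv: "(map mvar [0..<r] ! i) \<odot>\<^bsub>?M\<^esub> v \<in> list_smult ?M (take i (map mvar [0..<r]))"
  then have i: "i < r" by simp
  have "take i (map mvar [0..<r]) = (map mvar [0..<i] :: 'a mpoly list)"
    using i by (simp add: take_map)
  then have ls: "list_smult ?M (take i (map mvar [0..<r]))
      = {v. Poly_Mapping.keys v \<subseteq> {m \<in> basis_monomials. Poly_Mapping.keys m \<inter> {..<i} \<noteq> {}}}"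
    using list_smult_variables[of i, where 'a = 'a] i by simp
  have vB: "Poly_Mapping.keys v \<subseteq> basis_monomials" using v by simp
  have iv': "Poly_Mapping.keys (mvar i * v) \<subseteq> {m \<in> basis_monomials. Poly_Mapping.keys m \<inter> {..<i} \<noteq> {}}"
    using iv i times_variable(1)[OF i vB] unfolding ls by simp
  have "Poly_Mapping.keys m \<inter> {..<i} \<noteq> {}" if "m \<in> Poly_Mapping.keys v" for m
  proof -
    have "Poly_Mapping.single i 1 + m \<in> Poly_Mapping.keys (mvar i * v)"
      using that lookup_single_times[of "Poly_Mapping.single i 1" 1 v m] by (simp add: in_keys_iff mvar_def)
    then have "Poly_Mapping.keys (Poly_Mapping.single i 1 + m) \<inter> {..<i} \<noteq> {}" using iv' by blast
    then show ?thesis by (auto simp: keys_add_nat)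
  qed
  then show "v \<in> list_smult ?M (take i (map mvar [0..<r]))" using vB unfolding ls by blast
next
  let ?M = "monomial_module basis_monomials killed :: ('a mpoly, 'a mpoly) gmodule"
  have "fps_nth (numerator n t r) t = int ((n + t - 1) choose t)"
    by (simp add: numerator_nth geom_power_nth)
  moreover have "(n + t - 1) choose t > 0" using r by (intro zero_less_binomial) simp
  ultimately have "card (tails t) \<noteq> 0" using card_tails[of t] by simp
  then obtain b where b: "b \<in> tails t" by fastforce
  have "b \<in> basis_monomials"
    unfolding basis_monomials_def using b by (intro CollectI exI[of _ 0] exI[of _ b]) auto
  then have "Poly_Mapping.single b 1 \<in> carrier ?M" by simp
  moreover have "Poly_Mapping.single b 1 \<notin> list_smult ?M (map mvar [0..<r])"
    using tails_props(1)[OF b] by (simp add: list_smult_variables)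
  ultimately show "list_smult ?M (map mvar [0..<r]) \<noteq> carrier ?M" by metis
qed

lemma depth_ge: "enat r \<le> depth n (monomial_module basis_monomials killed :: ('a::field mpoly, 'a mpoly) gmodule)"
proof -
  have "set (map mvar [0..<r]) \<subseteq> (max_ideal n :: 'a mpoly set)"
    using r(2) by (auto simp: max_ideal_eq high_ideal_def high_monomials_def mvar_def)
  then have "enat r \<in> {enat (length fs) | fs. set fs \<subseteq> max_ideal n \<and>
      regular_sequence n (monomial_module basis_monomials killed :: ('a mpoly, 'a mpoly) gmodule) fs}"
    using regular_variables by (intro CollectI exI[of _ "map mvar [0..<r]"]) simp
  then show ?thesis unfolding depth_def by (auto intro: Sup_upper)
qed

lemma hilbert_series_eq:
  "hilbert_series (monomial_module basis_monomials killed :: ('a::field mpoly, 'a mpoly) gmodule)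
    = hilbert_series (graded_ideal n (high_ideal n t :: 'a mpoly set))"
  unfolding hilbert_series_def dim_component dim_high_ideal ..

end

section \<open>The Hilbert depth of powers of the maximal ideal\<close>

theorem theorem3p15:
  fixes n t :: nat
  assumes "infinite (UNIV :: 'a::field set)"
    and "n \<ge> 1" and "t \<ge> 1"
    and "n \<le> (t + 1) * (t + 3)"
  shows "hdepth n (graded_ideal n ((max_ideal n :: 'a mpoly set) [^]\<^bsub>ideals_set (mpoly_ring n)\<^esub> t))
           = enat (nat \<lceil>real n / real (t + 1)\<rceil>)"
proof -
  define r where "r = nat \<lceil>real n / real (t + 1)\<rceil>"
  have pos: "0 < real n / real (t + 1)" using assms(2) by simp
  have ceil: "real r = of_int \<lceil>real n / real (t + 1)\<rceil>" using pos by (simp add: r_def)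
  have "real n / real (t + 1) \<le> real r" unfolding ceil by (rule le_of_int_ceiling)
  then have "real n \<le> real (r * (t + 1))" by (simp add: divide_le_eq distrib_left)
  then have upper: "n \<le> r * (t + 1)" by linarith
  have "real r < real n / real (t + 1) + 1" unfolding ceil by linarith
  then have "real r - 1 < real n / real (t + 1)" by simp
  then have "(real r - 1) * real (t + 1) < real n" by (simp add: less_divide_eq)
  moreover have r1: "r \<ge> 1" using upper assms(2) by (cases r) auto
  moreover have "real ((r - 1) * (t + 1)) = (real r - 1) * real (t + 1)"
    unfolding of_nat_mult of_nat_diff[OF r1] by simp
  ultimately have "real ((r - 1) * (t + 1)) < real n" by (simp only:)
  then have lower: "(r - 1) * (t + 1) < n" by linarith
  have rn: "r \<le> n"
  proof -
    have "r - 1 \<le> (r - 1) * (t + 1)" by simp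
    then show ?thesis using lower by linarith
  qed
  have "0 \<le> fps_nth (numerator n t r) j" for j
  proof (cases "t \<le> j")
    case True
    then show ?thesis
      using hilbert_numerator_nonneg[OF assms(3) lower r1 rn, of "j - t"]
      by (simp add: numerator_nth geom_power_nth mult.assoc)
  qed (simp add: numerator_nth_low)
  then interpret depth_witness n t r
    using r1 rn assms(3) by (intro depth_witness.intro)
  let ?I = "graded_ideal n (high_ideal n t :: 'a mpoly set)"
  have "depth n N \<le> enat r"
    if N: "fg_graded_module n N" "hilbert_series N = hilbert_series ?I" for N :: "('a mpoly, 'a mpoly) gmodule"
  proof -
    interpret N: fg_graded_module n N by fact
    have dim: "int (vectorspace.dim class_ring (component_space N d)) = (if int t \<le> d then fps_nth (geom ^ n) (nat d) else 0)" for d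
      unfolding N.fls_nth_hilbert_series[symmetric] N(2)
        fg_graded_module.fls_nth_hilbert_series[OF fg_high_ideal] dim_high_ideal ..
    interpret V: vectorspace "class_ring :: 'a ring" "component_space N (int t - 1)"
      by (rule N.component_space_vectorspace)
    obtain B where B: "finite B" "V.basis B" using V.finite_basis_exists[OF N.component_space_fin_dim] by blast
    have "card B = 0" using V.dim_basis[OF B] dim[of "int t - 1"] by simp
    then have "V.span {} = component N (int t - 1)" using B unfolding V.basis_def by simp
    then have low: "component N (int t - 1) = {\<zero>\<^bsub>N\<^esub>}" using V.span_empty by simp
    let ?a = "vectorspace.dim class_ring (component_space N (int t))"
    let ?b = "vectorspace.dim class_ring (component_space N (int t + 1))"
    have "int ?a = int ((n + t - 1) choose t)" "int ?b = int ((n + t) choose (t + 1))"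
      using dim[of "int t"] dim[of "int t + 1"] by (simp_all add: geom_power_nth nat_add_distrib)
    then have a: "?a = (n + t - 1) choose t" and b: "?b = (n + t) choose (t + 1)" by simp_all
    have apos: "?a > 0" unfolding a using assms(2) by (intro zero_less_binomial) simp
    have "(t + 1) * ?b = (n + t) * ?a"
      unfolding a b using binomial_absorption[of t "n + t"] by simp
    also have "n + t < (t + 1) * Suc r" using upper by (simp add: mult.commute)
    then have "(n + t) * ?a < ((t + 1) * Suc r) * ?a" using apos by (rule mult_strict_right_mono)
    finally have "(t + 1) * ?b < (t + 1) * (Suc r * ?a)" by (simp only: mult.assoc)
    then have "?b < Suc r * ?a" by (subst (asm) mult_less_cancel1) simp
    then show ?thesis using N.depth_le[OF assms(1) low apos] by simp
  qed
  then have "hdepth n ?I \<le> enat r" unfolding hdepth_def by (intro Sup_least) (elim CollectE exE conjE, simp only:)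
  moreover have "enat r \<le> hdepth n ?I"
  proof -
    have "depth n (monomial_module basis_monomials killed :: ('a mpoly, 'a mpoly) gmodule) \<le> hdepth n ?I"
      unfolding hdepth_def
      by (intro Sup_upper CollectI exI conjI) (rule refl fg_graded hilbert_series_eq)+
    with depth_ge show ?thesis by (rule order_trans)
  qed
  ultimately show ?thesis unfolding max_ideal_power r_def by (rule antisym)
qed

end
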